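(* Let $\mu$ be an infinitely divisible distribution on $\mathbb{R}$ with Lévy measure $\nu(dx)=g(x)\,dx$ (with $\nu((1,\infty))>0$) such that $g_1(x)=\mathbf 1_{\{x>1\}}g(x)/\nu((1,\infty))$ is bounded. Let $\mu_+$ be the infinitely divisible distribution with characteristic function $$\widehat\mu_+(z)=\exp\Big\{\int_0^\infty(e^{izx}-1-izx\mathbf 1_{\{0<x\le1\}})\,\nu(dx)\Big\},$$ and suppose that $\int_{-\infty}^\infty|\widehat\mu_+(z)|\,dz<\infty$, which implies $\int_{-\infty}^\infty|\widehat\mu(z)|\,dz<\infty$, so that $\mu$ has a bounded continuous density $f$. Consider the following properties of a density $f$ of $\mu$: (i) $f\in\mathcal{S}_+$ and $f$ is almost decreasing (al.d.); (ii) $g_1\in\mathcal{S}_+$; (iii) $g_1\in\mathcal{L}$ and $\lim_{x\to\infty}f(x)/g_1(x)=\nu((1,\infty))$. Then: (a) If $g$ is asymptotic to a non-increasing function (a.n.i.), then one can choose $f$ such that (i), (ii) and (iii) are equivalent. (b) If $g$ is al.d., then one can choose $f$ such that (ii) and (iii) are equivalent and imply (i).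
   Context: The characteristic function of $\mu$ is $\widehat\mu(z)=\exp\{\int_{-\infty}^\infty(e^{izy}-1-izy\mathbf 1_{\{|y|\le1\}})\nu(dy)+iaz-\frac12b^2z^2\}$ with $a\in\mathbb{R}$, $b\ge0$ and Lévy measure $\nu$ ($\nu(\{0\})=0$, $\int(1\wedge x^2)\nu(dx)<\infty$). Notation: $\mathbb{R}_+=[0,\infty)$; $\alpha(x)\sim\beta(x)$ means $\alpha(x)/\beta(x)\to1$ as $x\to\infty$; $h^{\ast n}$ is $n$-fold convolution. For a probability density $h$ on $\mathbb{R}$ with distribution function $H$ and $\overline H=1-H$: - $h\in\mathcal{L}$ (long-tailed) if there is $x_0>0$ with $h(x)>0$ for $x\ge x_0$ and, for each fixed $y>0$, $h(x+y)\sim h(x)$. - $h\in\mathcal{S}$ (subexponential) if $h\in\mathcal{L}$ and $h^{\ast2}(x)\sim2h(x)$. - $h\in\mathcal{S}_+$ (weakly subexponential) if $h\in\mathcal{L}$ and the density $h_+(x)=\mathbf 1_{\mathbb{R}_+}(x)h(x)/\overline H(0)$ belongs to $\mathcal{S}$. For a non-negative function $h$ on $\mathbb{R}$ (a probability density, or a possibly non-proper density of a Lévy measure): - $h$ is asymptotic to a non-increasing function (a.n.i.) if, for some $x_0>0$, $h$ is locally bounded and positive on $[x_0,\infty)$, and $\sup_{t\ge x}h(t)\sim h(x)$ and $\inf_{x_0\le t\le x}h(t)\sim h(x)$. - $h$ is almost decreasing (al.d.) if there are $x_0>0$ and $K>0$ such that $h(x+y)\le Kh(x)$ for all $x>x_0$,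 $y>0$. *)

theory Defs
  imports "HOL-Probability.Probability" "HOL-Library.Landau_Symbols"
begin

section \<open>Infinitely divisible distributions on the real line\<close>

definition conv_power :: "real measure \<Rightarrow> nat \<Rightarrow> real measure" where
  "conv_power \<rho> n = ((\<lambda>M. M \<star> \<rho>) ^^ n) (return borel 0)"

definition infinitely_divisible :: "real measure \<Rightarrow> bool" where
  "infinitely_divisible \<mu> \<longleftrightarrow> real_distribution \<mu> \<and>
     (\<forall>n\<ge>1. \<exists>\<rho>. real_distribution \<rho> \<and> \<mu> = conv_power \<rho> n)"

definition levy_measure :: "real measure \<Rightarrow> bool" where
  "levy_measure \<nu> \<longleftrightarrow> sets \<nu> = sets borel \<and> emeasure \<nu> {0} = 0 \<and>
     (\<integral>\<^sup>+ x. ennreal (min 1 (x\<^sup>2)) \<partial>\<nu>) < \<infinity>"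

text \<open>For a Levy measure the integrand below is integrable, being \<open>O(min 1 (y\<^sup>2))\<close>.\<close>

definition levy_khintchine_exponent :: "real measure \<Rightarrow> real \<Rightarrow> real \<Rightarrow> real \<Rightarrow> complex" where
  "levy_khintchine_exponent \<nu> a b z =
     (CLINT y|\<nu>. iexp (z * y) - 1 - \<i> * of_real z * of_real y * indicator {y. \<bar>y\<bar> \<le> 1} y)
     + \<i> * of_real a * of_real z - of_real (b\<^sup>2 * z\<^sup>2 / 2)"

definition infinitely_divisible_with_levy_measure :: "real measure \<Rightarrow> real measure \<Rightarrow> bool" where
  "infinitely_divisible_with_levy_measure \<mu> \<nu> \<longleftrightarrow>
     infinitely_divisible \<mu> \<and> levy_measure \<nu> \<and>
     (\<exists>a b. b \<ge> 0 \<and> (\<forall>z. char \<mu> z = exp (levy_khintchine_exponent \<nu> a b z)))"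

section \<open>Classes of densities\<close>

definition has_density :: "real measure \<Rightarrow> (real \<Rightarrow> real) \<Rightarrow> bool" where
  "has_density \<mu> h \<longleftrightarrow> h \<in> borel_measurable borel \<and> (\<forall>x. h x \<ge> 0) \<and>
     \<mu> = density lborel (\<lambda>x. ennreal (h x))"

definition bounded_continuous_density :: "real measure \<Rightarrow> (real \<Rightarrow> real) \<Rightarrow> bool" where
  "bounded_continuous_density \<mu> f \<longleftrightarrow>
     has_density \<mu> f \<and> continuous_on UNIV f \<and> bounded (range f)"

definition probability_density :: "(real \<Rightarrow> real) \<Rightarrow> bool" where
  "probability_density h \<longleftrightarrow> h \<in> borel_measurable borel \<and> (\<forall>x. h x \<ge> 0) \<and>
     (\<integral>\<^sup>+ x. ennreal (h x) \<partial>lborel) = 1"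

text \<open>Where the convolution integral diverges, \<open>density_conv\<close> takes the value 0. This does not affect
  \<open>subexponential\<close>: a value 0, like a value infinity, at arbitrarily large arguments
  rules out asymptotic equivalence to the eventually positive function \<open>2 * h x\<close>.\<close>

definition density_conv :: "(real \<Rightarrow> real) \<Rightarrow> (real \<Rightarrow> real) \<Rightarrow> real \<Rightarrow> real" where
  "density_conv h k x = (LINT y|lborel. h (x - y) * k y)"

definition long_tailed :: "(real \<Rightarrow> real) \<Rightarrow> bool" where
  "long_tailed h \<longleftrightarrow> probability_density h \<and>
     (\<exists>x\<^sub>0>0. \<forall>x\<ge>x\<^sub>0. h x > 0) \<and>
     (\<forall>y>0. (\<lambda>x. h (x + y)) \<sim>[at_top] h)"

definition subexponential :: "(real \<Rightarrow> real) \<Rightarrow> bool" where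
  "subexponential h \<longleftrightarrow> long_tailed h \<and> density_conv h h \<sim>[at_top] (\<lambda>x. 2 * h x)"

definition right_tail :: "(real \<Rightarrow> real) \<Rightarrow> real \<Rightarrow> real" where
  "right_tail h x = 1 - cdf (density lborel (\<lambda>x. ennreal (h x))) x"

definition positive_part_density :: "(real \<Rightarrow> real) \<Rightarrow> real \<Rightarrow> real" where
  "positive_part_density h x = indicator {0..} x * h x / right_tail h 0"

definition weakly_subexponential :: "(real \<Rightarrow> real) \<Rightarrow> bool" where
  "weakly_subexponential h \<longleftrightarrow> long_tailed h \<and> subexponential (positive_part_density h)"

text \<open>The supremum over \<open>{x..}\<close> is an extended real in the mathematics. Being asymptotic to \<open>h\<close>,
  it has to be finite for large \<open>x\<close>, hence by local boundedness for all \<open>x \<ge> x\<^sub>0\<close>; this finiteness is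
  spelled out because a real \<open>SUP\<close> is meaningful only for sets bounded above.\<close>

definition asymptotic_to_nonincreasing :: "(real \<Rightarrow> real) \<Rightarrow> bool" where
  "asymptotic_to_nonincreasing h \<longleftrightarrow>
     (\<exists>x\<^sub>0>0. (\<forall>x\<ge>x\<^sub>0. bounded (h ` {x\<^sub>0..x})) \<and> (\<forall>x\<ge>x\<^sub>0. h x > 0) \<and>
        (\<forall>x\<ge>x\<^sub>0. bdd_above (h ` {x..})) \<and>
        (\<lambda>x. SUP t\<in>{x..}. h t) \<sim>[at_top] h \<and>
        (\<lambda>x. INF t\<in>{x\<^sub>0..x}. h t) \<sim>[at_top] h)"

definition almost_decreasing :: "(real \<Rightarrow> real) \<Rightarrow> bool" where
  "almost_decreasing h \<longleftrightarrow>
     (\<exists>x\<^sub>0>0. \<exists>K>0. \<forall>x>x\<^sub>0. \<forall>y>0. h (x + y) \<le> K * h x)"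

end

theory Submission
  imports Defs
begin

text \<open>For a cutoff \<open>R\<close> write \<open>\<mu>\<close> as the convolution of a factor whose jumps are bounded above by \<open>R\<close>
  and a compound Poisson law with the jumps above \<open>R\<close>, of total rate \<open>c R\<close>. By the integrability
  assumption the first factor has a bounded continuous density \<open>f\<^sub>R\<close>, and so has its exponential tilting;
  hence \<open>f\<^sub>R x = O(exp (- x))\<close>, which is negligible against every long-tailed function.
  With \<open>k\<^sub>R\<close> the density of the jumps above \<open>R\<close>, the density \<open>f\<close> of \<open>\<mu>\<close> satisfies
  \<open>f \<ge> exp (- c R) * (f\<^sub>R \<star> k\<^sub>R)\<close> and, for \<open>D = f - exp (- c R) * f\<^sub>R\<close>,
  \<open>D \<le> exp (- c R) * (f\<^sub>R \<star> k\<^sub>R) + D \<star> k\<^sub>R\<close>. The mass of \<open>D\<close> and that of \<open>k\<^sub>R\<close> tend to 0 as \<open>R\<close> grows,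
  so under subexponentiality \<open>D \<star> k\<^sub>R\<close> is a small multiple of the reference function, and \<open>f \<sim> g\<close>.
  Conversely \<open>f \<sim> g\<close> leaves no room for two large jumps, which forces subexponentiality of \<open>g\<close>.\<close>

section \<open>Long-tailed almost decreasing functions\<close>

text \<open>The obstacle is that \<open>g\<close> is only almost decreasing, so comparing its values
  at far apart points costs a factor \<open>K\<close> that cannot be made close to 1. The errors
  must therefore be multiplied by masses that vanish with the cutoff, and the constant in the a
  priori bound f = O(g) has to be fixed before the final cutoff is chosen. A constant of exactly 1
  comes only from fixed shifts, where long-tailedness applies. Passing from (i) to (ii) asks for
  more because \<open>f\<close> sees \<open>g\<close> only through local averages and
  \<open>g\<close> is not known to be long-tailed there. The two one-sided comparisons of an a.n.i.
  function bound an average over a window by the values at its ends, and long-tailedness of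
  \<open>f\<close> absorbs the width of the window. The exponential bound on the truncated factor is
  obtained without constructing its law: the transform is followed on two vertical lines through
  compound Poisson approximations, for which positivity and tilting are explicit. The weight
  \<open>exp x\<close> suffices since a long-tailed function decays more slowly than any
  exponential.\<close>

lemma integrable_boundI:
  fixes f :: "'a \<Rightarrow> 'b :: {banach, second_countable_topology}"
  assumes "integrable M w" "f \<in> borel_measurable M" "\<And>x. norm (f x) \<le> w x"
  shows "integrable M f"
  by (rule Bochner_Integration.integrable_bound[OF assms(1,2)])
    (use order_trans[OF assms(3) abs_ge_self] in simp)

lemma tendsto_integral_at_top:
  fixes s :: "real \<Rightarrow> 'a \<Rightarrow> 'b :: {banach, second_countable_topology}"
  assumes "integrable M w" "\<And>x. ((\<lambda>t. s t x) \<longlongrightarrow> f x) at_top"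
    and "\<forall>\<^sub>F t in at_top. \<forall>x. norm (s t x) \<le> w x"
    and "f \<in> borel_measurable M" "\<And>t. s t \<in> borel_measurable M"
  shows "((\<lambda>t. integral\<^sup>L M (s t)) \<longlongrightarrow> integral\<^sup>L M f) at_top"
  by (rule integral_dominated_convergence_at_top[where w=w])
    (use assms in \<open>auto elim: eventually_mono\<close>)

lemma integral_outside_tendsto:
  fixes w :: "real \<Rightarrow> real"
  assumes w: "integrable lborel w"
  shows "((\<lambda>b. LINT u|lborel. indicator (- {-b..b}) u * w u) \<longlongrightarrow> 0) at_top"
proof -
  have "((\<lambda>b. LINT u|lborel. indicator (- {-b..b}) u * w u) \<longlongrightarrow> (LINT u::real|lborel. 0)) at_top"
  proof (rule tendsto_integral_at_top[where w="\<lambda>u. \<bar>w u\<bar>"])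
    fix x :: real
    have "\<forall>\<^sub>F b in at_top. indicator (- {-b..b}) x * w x = 0"
      using eventually_ge_at_top[of "\<bar>x\<bar>"] by eventually_elim (auto simp: indicator_def)
    then show "((\<lambda>b. indicator (- {-b..b}) x * w x) \<longlongrightarrow> 0) at_top" by (rule tendsto_eventually)
  qed (use w in \<open>auto simp: indicator_def\<close>)
  then show ?thesis by simp
qed

lemma integral_indicator_split:
  fixes w :: "real \<Rightarrow> real"
  assumes w: "integrable lborel w" and A: "A \<in> sets borel"
  shows "(LINT u|lborel. w u) = (LINT u|lborel. indicator A u * w u) + (LINT u|lborel. indicator (- A) u * w u)"
proof -
  have "integrable lborel (\<lambda>u. indicator S u * w u)" if "S \<in> sets borel" for S
    using integrable_mult_indicator[OF _ w, of S] that by simp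
  from Bochner_Integration.integral_add[OF this[OF A] this[of "- A"], symmetric] A show ?thesis
    by (auto simp: indicator_def intro!: Bochner_Integration.integral_cong)
qed

lemma integrable_conv:
  fixes h k :: "real \<Rightarrow> real"
  assumes [measurable]: "h \<in> borel_measurable borel" and bd: "\<And>x. \<bar>h x\<bar> \<le> B" and k: "integrable lborel k"
  shows "integrable lborel (\<lambda>y. h (x - y) * k y)"
proof (rule integrable_boundI)
  show "integrable lborel (\<lambda>y. B * \<bar>k y\<bar>)" using k by simp
  have [measurable]: "k \<in> borel_measurable borel" using k by auto
  show "(\<lambda>y. h (x - y) * k y) \<in> borel_measurable lborel" by measurable
  show "norm (h (x - y) * k y) \<le> B * \<bar>k y\<bar>" for y
    using bd[of "x - y"] by (simp add: abs_mult mult_right_mono)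
qed

lemma density_conv_commute: "density_conv h k x = density_conv k h x"
  unfolding density_conv_def
  by (subst lborel_integral_real_affine[where c="-1" and t=x]) (simp_all add: mult.commute)

lemma integrable_reflect:
  fixes k :: "real \<Rightarrow> real"
  assumes "integrable lborel k"
  shows "integrable lborel (\<lambda>y. k (x - y))" "(LINT y|lborel. k (x - y)) = (LINT y|lborel. k y)"
  using lborel_integrable_real_affine[OF assms, of "-1" x] lborel_integral_real_affine[of "-1" k x]
  by simp_all

lemma tendsto_at_topI_le:
  fixes f :: "real \<Rightarrow> real"
  assumes "\<And>e. e > 0 \<Longrightarrow> eventually (\<lambda>x. \<bar>f x - l\<bar> \<le> e) F"
  shows "(f \<longlongrightarrow> l) F"
proof (rule tendstoI)
  fix e :: real assume "e > 0"
  then have "eventually (\<lambda>x. \<bar>f x - l\<bar> \<le> e / 2) F" by (intro assms) simp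
  then show "eventually (\<lambda>x. dist (f x) l < e) F"
    by (rule eventually_mono) (use \<open>e > 0\<close> in \<open>simp add: dist_real_def\<close>)
qed

text \<open>For a long-tailed density the ends of the convolution integral always contribute
  \<open>2 * h x\<close>, so subexponentiality is equivalent to the middle part being negligible.\<close>

definition middle_conv :: "(real \<Rightarrow> real) \<Rightarrow> real \<Rightarrow> real \<Rightarrow> real" where
  "middle_conv h A x = (LINT y|lborel. indicator {A..x - A} y * (h (x - y) * h y))"

definition tight_conv :: "(real \<Rightarrow> real) \<Rightarrow> bool" where
  "tight_conv h \<longleftrightarrow> (\<forall>e>0. \<exists>A>0. \<forall>\<^sub>F x in at_top. middle_conv h A x \<le> e * h x)"

locale long_tailed_ad =
  fixes h :: "real \<Rightarrow> real" and x0 K B :: real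
  assumes meas [measurable]: "h \<in> borel_measurable borel"
    and nonneg: "0 \<le> h x"
    and bounded: "h x \<le> B"
    and int: "integrable lborel h"
    and x0: "0 < x0" and K: "1 \<le> K"
    and pos: "x0 \<le> x \<Longrightarrow> 0 < h x"
    and ad: "x0 \<le> x \<Longrightarrow> 0 \<le> y \<Longrightarrow> h (x + y) \<le> K * h x"
    and shift: "((\<lambda>x. h (x + y) / h x) \<longlongrightarrow> 1) at_top"
begin

lemma abs_bounded: "\<bar>h x\<bar> \<le> B"
  using nonneg[of x] bounded[of x] by simp

lemma ev_pos: "\<forall>\<^sub>F x in at_top. x0 \<le> x \<and> 0 < h x"
  using eventually_ge_at_top[of x0] by (rule eventually_mono) (use pos in auto)

lemma ev_shift_le:
  assumes "c > 1" shows "\<forall>\<^sub>F x in at_top. h (x + y) \<le> c * h x"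
  using order_tendstoD(2)[OF shift[of y] assms] ev_pos
  by eventually_elim (auto simp: divide_less_eq)

lemma ev_shift_ge:
  assumes "c < 1" shows "\<forall>\<^sub>F x in at_top. c * h x \<le> h (x + y)"
  using order_tendstoD(1)[OF shift[of y] assms] ev_pos
  by eventually_elim (auto simp: less_divide_eq)

text \<open>Uniform in all \<open>y \<le> A\<close>, including arbitrarily negative ones:
  \<open>x - y\<close> lies to the right of \<open>x - A\<close>, so almost decrease costs
  \<open>K\<close>, and the fixed shift by \<open>A\<close> costs at most 2 for large
  \<open>x\<close>.\<close>

lemma ev_left: "\<forall>\<^sub>F x in at_top. \<forall>y\<le>A. h (x - y) \<le> 2 * K * h x"
  using ev_shift_le[of 2 "- A", simplified] eventually_ge_at_top[of "x0 + A"]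
proof eventually_elim
  case (elim x)
  show ?case
  proof (intro allI impI)
    fix y assume "y \<le> A"
    then have "h (x - A + (A - y)) \<le> K * h (x - A)" using elim by (intro ad) auto
    also have "\<dots> \<le> K * (2 * h x)" using elim K by (intro mult_left_mono) auto
    finally show "h (x - y) \<le> 2 * K * h x" by simp
  qed
qed

lemma lower_bound_upto:
  assumes "x0 \<le> x" "x \<le> y" shows "h y \<le> K * h x"
  using ad[of x "y - x"] assms by simp

text \<open>Up to the point \<open>z\<close> almost decrease gives \<open>h z \<le> K * h x\<close>,
  so \<open>h\<close> is bounded away from 0 there without any continuity, and an upper bound
  \<open>M\<close> for \<open>u\<close> suffices. This turns asymptotic estimates into ones that can
  be used in inductions over convolutions.\<close>

lemma bigo_extend:
  assumes "\<forall>\<^sub>F x in at_top. u x \<le> C * h x" and "\<And>x. x0 \<le> x \<Longrightarrow> u x \<le> M"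
  shows "\<exists>C'\<ge>0. \<forall>x\<ge>x0. u x \<le> C' * h x"
proof -
  obtain x2 where x2: "\<And>x. x2 \<le> x \<Longrightarrow> u x \<le> C * h x"
    using assms(1) by (auto simp: eventually_at_top_linorder)
  define z where "z = max x0 x2"
  define C' where "C' = max \<bar>C\<bar> (\<bar>M\<bar> * K / h z)"
  have hz: "0 < h z" by (rule pos) (simp add: z_def)
  have "u x \<le> C' * h x" if "x0 \<le> x" for x
  proof (cases "x \<le> z")
    case True
    have "u x \<le> \<bar>M\<bar>" using assms(2)[OF that] by linarith
    also have "\<bar>M\<bar> = \<bar>M\<bar> / h z * h z" using hz by simp
    also have "\<dots> \<le> \<bar>M\<bar> / h z * (K * h x)"
      using hz lower_bound_upto[OF that True] by (intro mult_left_mono) auto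
    also have "\<dots> = (\<bar>M\<bar> * K / h z) * h x" by simp
    also have "\<dots> \<le> C' * h x" using nonneg by (intro mult_right_mono) (auto simp: C'_def)
    finally show ?thesis .
  next
    case False
    then have "u x \<le> C * h x" by (intro x2) (simp add: z_def)
    also have "\<dots> \<le> C' * h x" using nonneg by (intro mult_right_mono) (auto simp: C'_def)
    finally show ?thesis .
  qed
  moreover have "C' \<ge> 0" by (simp add: C'_def le_max_iff_disj)
  ultimately show ?thesis by blast
qed

text \<open>A Potter-type bound: the unit shift is iterated, each step costing
  \<open>exp (1 / 2)\<close>, and non-integer shifts are filled in by almost decrease. The rate 1/2
  only has to be beaten by the decay \<open>exp (- u)\<close> of the light factor.\<close>

lemma potter: "\<exists>x1\<ge>x0. \<exists>C>0. \<forall>x\<ge>x1. \<forall>u\<ge>0. h x \<le> C * exp (u / 2) * h (x + u)"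
proof -
  have "\<forall>\<^sub>F x in at_top. exp (- 1 / 2) * h x \<le> h (x + 1)"
    by (rule ev_shift_ge) simp
  then obtain a where a: "\<And>x. a \<le> x \<Longrightarrow> exp (- 1 / 2) * h x \<le> h (x + 1)"
    by (auto simp: eventually_at_top_linorder)
  define x1 where "x1 = max x0 a"
  have step: "h x \<le> exp (1 / 2) * h (x + 1)" if "x1 \<le> x" for x
  proof -
    have "exp (1 / 2) * (exp (- 1 / 2) * h x) \<le> exp (1 / 2) * h (x + 1)"
      using that by (intro mult_left_mono a) (auto simp: x1_def)
    moreover have "exp (1 / 2 :: real) * exp (- 1 / 2) = 1"
      unfolding exp_add[symmetric] by simp
    then have "exp (1 / 2) * (exp (- 1 / 2) * h x) = h x"
      by (simp only: mult.assoc[symmetric])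
    ultimately show ?thesis by linarith
  qed
  have steps: "h x \<le> exp (real n / 2) * h (x + real n)" if "x1 \<le> x" for x n
  proof (induction n)
    case (Suc n)
    note Suc
    also have "h (x + real n) \<le> exp (1 / 2) * h (x + real n + 1)"
      using that by (intro step) simp
    finally show ?case by (simp add: exp_add[symmetric] mult.assoc[symmetric] add_divide_distrib add_ac)
  qed simp
  have "h x \<le> (exp (1 / 2) * K) * exp (u / 2) * h (x + u)" if "x1 \<le> x" "0 \<le> u" for x u
  proof -
    \<comment> \<open>Rounding \<open>u\<close> up costs at most one further step, hence the
      \<open>exp (1 / 2)\<close> in the constant; \<open>K\<close> pays for comparing
      \<open>h (x + real n)\<close> with \<open>h (x + u)\<close>.\<close>
    define n where "n = nat \<lceil>u\<rceil>"
    have n: "u \<le> real n" "real n \<le> u + 1" using that by (auto simp: n_def)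
    have "h x \<le> exp (real n / 2) * h (x + real n)" by (rule steps[OF that(1)])
    also have "\<dots> \<le> exp ((u + 1) / 2) * (K * h (x + u))"
    proof (rule mult_mono)
      show "h (x + real n) \<le> K * h (x + u)"
        by (rule lower_bound_upto) (use that n in \<open>auto simp: x1_def\<close>)
    qed (use n nonneg in auto)
    finally show ?thesis by (simp add: add_divide_distrib exp_add mult_ac)
  qed
  moreover have "0 < exp (1 / 2) * K" using K by simp
  ultimately show ?thesis
    by (intro exI[of _ x1] conjI exI[of _ "exp (1 / 2) * K"]) (auto simp: x1_def)
qed

text \<open>The Potter bound from the fixed base point \<open>x1\<close> makes \<open>h x\<close> at
  least a constant multiple of \<open>exp (- x / 2)\<close>.\<close>

lemma exp_negligible: "((\<lambda>x. exp (- x) / h x) \<longlongrightarrow> 0) at_top"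
proof -
  obtain x1 C where x1: "x1 \<ge> x0" and C: "C > 0"
    and P: "\<And>x u. x \<ge> x1 \<Longrightarrow> u \<ge> 0 \<Longrightarrow> h x \<le> C * exp (u / 2) * h (x + u)"
    using potter by blast
  have h1: "h x1 > 0" by (rule pos[OF x1])
  have "((\<lambda>x::real. C * exp (- x1 / 2) / h x1 * exp (- x / 2)) \<longlongrightarrow> C * exp (- x1 / 2) / h x1 * 0) at_top"
    by (intro tendsto_mult_left) real_asymp
  moreover have "\<forall>\<^sub>F x in at_top. norm (exp (- x) / h x) \<le> C * exp (- x1 / 2) / h x1 * exp (- x / 2)"
    using eventually_ge_at_top[of x1] ev_pos
  proof eventually_elim
    case (elim x)
    have "h x1 \<le> C * exp ((x - x1) / 2) * h x" using P[of x1 "x - x1"] elim by simp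
    then have "exp (- x) * h x1 \<le> exp (- x) * (C * exp ((x - x1) / 2) * h x)"
      by (intro mult_left_mono) auto
    also have "\<dots> = C * exp (- x1 / 2) * exp (- x / 2) * h x"
    proof -
      have "exp (- x) * exp ((x - x1) / 2) = exp (- x1 / 2) * exp (- x / 2)"
        unfolding exp_add[symmetric] by (simp add: field_simps)
      then show ?thesis by (metis (no_types, lifting) mult.assoc mult.left_commute)
    qed
    finally show ?case using h1 elim by (simp add: field_simps)
  qed
  ultimately show ?thesis
    by (intro Lim_null_comparison[where f="\<lambda>x. exp (- x) / h x"]) auto
qed

end

section \<open>Convolution with a density that decays exponentially to the right\<close>

lemma integrable_exp_half: "integrable lborel (\<lambda>u::real. indicator {0..} u * exp (- u / 2))"
proof -
  have "integrable lborel (exponential_density (1 / 2))"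
  proof (rule integrableI_nonneg)
    have "prob_space (density lborel (exponential_density (1 / 2)))"
      by (rule prob_space_exponential_density) simp
    then have "emeasure (density lborel (exponential_density (1 / 2))) UNIV = 1"
      using prob_space.emeasure_space_1 by fastforce
    then show "(\<integral>\<^sup>+ x. ennreal (exponential_density (1 / 2) x) \<partial>lborel) < \<infinity>"
      by (simp add: emeasure_density)
  qed (auto simp: exponential_density_def)
  then have "integrable lborel (\<lambda>u. 2 * exponential_density (1 / 2) u)" by simp
  moreover have "(\<lambda>u. 2 * exponential_density (1 / 2) u) = (\<lambda>u::real. indicator {0..} u * exp (- u / 2))"
    by (auto simp: exponential_density_def indicator_def fun_eq_iff)
  ultimately show ?thesis by simp
qed

text \<open>The exponential bound is one-sided: for negative arguments it gives no decay, in keeping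
  with negative jumps that are not truncated.\<close>

locale light_density =
  fixes p :: "real \<Rightarrow> real" and Cp Bp :: real
  assumes p_meas [measurable]: "p \<in> borel_measurable borel"
    and p_nonneg: "0 \<le> p x"
    and p_bounded: "p x \<le> Bp"
    and p_int: "integrable lborel p"
    and p_one: "(LINT x|lborel. p x) = 1"
    and p_light: "p x \<le> Cp * exp (- x)"
begin

text \<open>The Potter loss \<open>exp (u / 2)\<close> arises only for \<open>u > 0\<close>; for
  \<open>u < 0\<close> almost decrease costs a constant. Up to constants this is the dominating
  function for convolutions with \<open>p\<close>.\<close>

definition weight :: "real \<Rightarrow> real" where "weight u = p u * exp (max u 0 / 2)"

lemma weight_meas [measurable]: "weight \<in> borel_measurable borel"
  unfolding weight_def[abs_def] by measurable

lemma weight_nonneg: "0 \<le> weight u" using p_nonneg by (simp add: weight_def)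

lemma Cp_nonneg: "0 \<le> Cp"
  using order_trans[OF p_nonneg[of 0] p_light[of 0]] by simp

lemma weight_int: "integrable lborel weight"
proof (rule integrable_boundI)
  show "integrable lborel (\<lambda>u. p u + Cp * (indicator {0..} u * exp (- u / 2)))"
    by (intro Bochner_Integration.integrable_add integrable_mult_right p_int integrable_exp_half)
  show "norm (weight u) \<le> p u + Cp * (indicator {0..} u * exp (- u / 2))" for u
  proof (cases "0 \<le> u")
    case True
    have "weight u \<le> Cp * exp (- u) * exp (u / 2)"
      unfolding weight_def using p_light[of u] True by (auto intro!: mult_right_mono)
    also have "\<dots> = Cp * exp (- u / 2)"
      by (simp add: mult.assoc exp_add[symmetric])
    finally show ?thesis using True p_nonneg[of u] weight_nonneg[of u] by simp
  next
    case False
    then show ?thesis using p_nonneg[of u] by (simp add: weight_def)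
  qed
qed measurable

lemma mass_outside:
  assumes "e > 0"
  shows "\<exists>b0>0. \<forall>b\<ge>b0. (LINT u|lborel. indicator (- {-b..b}) u * weight u) \<le> e"
proof -
  have "\<forall>\<^sub>F b in at_top. (LINT u|lborel. indicator (- {-b..b}) u * weight u) < e"
    using assms by (rule order_tendstoD(2)[OF integral_outside_tendsto[OF weight_int]])
  then obtain b0 where b0: "\<And>b. b \<ge> b0 \<Longrightarrow> (LINT u|lborel. indicator (- {-b..b}) u * weight u) < e"
    by (auto simp: eventually_at_top_linorder)
  show ?thesis
    by (rule exI[of _ "max b0 1"]) (use b0 in \<open>auto simp: less_imp_le\<close>)
qed

end

locale light_conv = long_tailed_ad h x0 K B + light_density p Cp Bp
  for h x0 K B p Cp Bp
begin

text \<open>Two regimes. If \<open>x - u\<close> is beyond \<open>x1\<close>, the Potter bound or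
  almost decrease compares \<open>h (x - u)\<close> with \<open>h x\<close>. Otherwise
  \<open>u > x - x1\<close>, and the decay of \<open>p\<close> alone yields a factor
  \<open>exp (- x)\<close>, so that \<open>k\<close> will enter only through its integral.\<close>

lemma conv_pointwise:
  fixes k :: "real \<Rightarrow> real"
  assumes k0: "\<And>x. 0 \<le> k x" and tail_ft: "\<And>x. x0 \<le> x \<Longrightarrow> k x \<le> C * h x" and C: "0 \<le> C"
  shows "\<exists>x1\<ge>x0. \<exists>C1\<ge>0. \<exists>C2\<ge>0. \<forall>x\<ge>x1. \<forall>u.
    (x1 \<le> x - u \<longrightarrow> p u * k (x - u) \<le> C1 * h x * weight u) \<and>
    (x - u < x1 \<longrightarrow> p u * k (x - u) \<le> C2 * exp (- x) * k (x - u))"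
proof -
  obtain x1 C' where x1: "x1 \<ge> x0" and C': "C' > 0"
    and P: "\<And>x u. x \<ge> x1 \<Longrightarrow> u \<ge> 0 \<Longrightarrow> h x \<le> C' * exp (u / 2) * h (x + u)"
    using potter by blast
  let ?C1 = "C * max C' K" and ?C2 = "Cp * exp x1"
  have "p u * k (x - u) \<le> ?C1 * h x * weight u" if "x1 \<le> x" "x1 \<le> x - u" for x u
  proof -
    have "h (x - u) \<le> max C' K * exp (max u 0 / 2) * h x"
    proof (cases "0 \<le> u")
      case True
      have "h (x - u) \<le> C' * exp (u / 2) * h x" using P[of "x - u" u] that True by simp
      also have "\<dots> \<le> max C' K * exp (u / 2) * h x" using nonneg by (intro mult_right_mono) auto
      finally show ?thesis using True by simp
    next
      case False
      have "h (x - u) \<le> K * h x" using lower_bound_upto[of x "x - u"] that False x1 by simp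
      also have "\<dots> \<le> max C' K * h x" using nonneg by (intro mult_right_mono) auto
      finally show ?thesis using False by simp
    qed
    then have "C * h (x - u) \<le> C * (max C' K * exp (max u 0 / 2) * h x)"
      using C by (rule mult_left_mono)
    moreover have "k (x - u) \<le> C * h (x - u)" using that x1 by (intro tail_ft) simp
    ultimately have "k (x - u) \<le> C * (max C' K * exp (max u 0 / 2) * h x)" by simp
    from mult_left_mono[OF this p_nonneg[of u]] show ?thesis
      by (simp add: weight_def mult_ac)
  qed
  moreover have "p u * k (x - u) \<le> ?C2 * exp (- x) * k (x - u)" if "x - u < x1" for x u
  proof (rule mult_right_mono[OF _ k0])
    have "p u \<le> Cp * exp (- u)" by (rule p_light)
    also have "\<dots> \<le> Cp * exp (x1 - x)" using that Cp_nonneg by (intro mult_left_mono) auto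
    also have "\<dots> = ?C2 * exp (- x)" by (simp add: exp_diff exp_minus field_simps)
    finally show "p u \<le> ?C2 * exp (- x)" .
  qed
  moreover have "0 \<le> ?C1" "0 \<le> ?C2" using C C' Cp_nonneg by auto
  ultimately show ?thesis using x1 by blast
qed

text \<open>Dominated convergence on \<open>u \<le> x - x1\<close> with a multiple of
  \<open>weight\<close> as majorant; the rest is at most a constant times \<open>exp (- x)\<close>
  times the mass of \<open>k\<close>, which is negligible against \<open>h\<close>.\<close>

lemma conv_limit:
  fixes k :: "real \<Rightarrow> real"
  assumes [measurable]: "k \<in> borel_measurable borel" and k0: "\<And>x. 0 \<le> k x" and ki: "integrable lborel k"
    and tail_ft: "\<And>x. x0 \<le> x \<Longrightarrow> k x \<le> C * h x" and C: "0 \<le> C"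
    and lim: "((\<lambda>x. k x / h x) \<longlongrightarrow> a) at_top"
  shows "((\<lambda>x. density_conv p k x / h x) \<longlongrightarrow> a) at_top"
proof -
  obtain x1 C1 C2 where x1: "x1 \<ge> x0" and C12: "0 \<le> C1" "0 \<le> C2"
    and P1: "\<And>x u. x1 \<le> x \<Longrightarrow> x1 \<le> x - u \<Longrightarrow> p u * k (x - u) \<le> C1 * h x * weight u"
    and P2: "\<And>x u. x1 \<le> x \<Longrightarrow> x - u < x1 \<Longrightarrow> p u * k (x - u) \<le> C2 * exp (- x) * k (x - u)"
    using conv_pointwise[OF k0 tail_ft C] by blast
  let ?F = "\<lambda>x u. indicator {..x - x1} u * (p u * k (x - u)) / h x"
  let ?G = "\<lambda>x u. indicator {x - x1<..} u * (p u * k (x - u)) / h x"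
  have absp: "\<bar>p x\<bar> \<le> Bp" for x using p_nonneg p_bounded by simp
  have ip: "integrable lborel (\<lambda>u. p u * k (x - u))" for x
    using lborel_integrable_real_affine[OF integrable_conv[OF p_meas absp ki, of x], of "-1" x] by simp
  have iF: "integrable lborel (?F x)" and iG: "integrable lborel (?G x)" for x
    using integrable_mult_indicator[OF _ ip[of x], of "{..x - x1}"]
      integrable_mult_indicator[OF _ ip[of x], of "{x - x1<..}"] by simp_all
  have split: "density_conv p k x / h x = (LINT u|lborel. ?F x u) + (LINT u|lborel. ?G x u)" for x
  proof -
    have "density_conv p k x / h x = (LINT u|lborel. p u * k (x - u) / h x)"
      unfolding density_conv_commute[of p k x] unfolding density_conv_def by (simp add: mult.commute)
    also have "\<dots> = (LINT u|lborel. ?F x u + ?G x u)"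
      by (intro Bochner_Integration.integral_cong refl) (auto simp: indicator_def)
    also have "\<dots> = (LINT u|lborel. ?F x u) + (LINT u|lborel. ?G x u)"
      using iF iG by (rule Bochner_Integration.integral_add)
    finally show ?thesis .
  qed
  have "((\<lambda>x. LINT u|lborel. ?F x u) \<longlongrightarrow> (LINT u|lborel. a * p u)) at_top"
  proof (rule tendsto_integral_at_top[where w="\<lambda>u. C1 * weight u"])
    show "\<forall>\<^sub>F x in at_top. \<forall>u. norm (?F x u) \<le> C1 * weight u"
      using ev_pos eventually_ge_at_top[of x1]
    proof eventually_elim
      case (elim x)
      show ?case
      proof
        fix u
        have "0 \<le> C1 * weight u" "0 \<le> C1 * (h x * weight u)" using C12 weight_nonneg nonneg by simp_all
        then show "norm (?F x u) \<le> C1 * weight u"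
          using P1[of x u] elim p_nonneg[of u] k0[of "x - u"]
          by (auto simp: indicator_def divide_le_eq mult_ac)
      qed
    qed
    show "((\<lambda>x. ?F x u) \<longlongrightarrow> a * p u) at_top" for u
    proof -
      have sh: "filterlim (\<lambda>x::real. x - u) at_top at_top" by real_asymp
      have "((\<lambda>x. (k (x - u) / h (x - u)) * (h (x + (- u)) / h x) * p u) \<longlongrightarrow> a * 1 * p u) at_top"
        by (intro tendsto_intros filterlim_compose[OF lim sh] shift)
      then have l: "((\<lambda>x. (k (x - u) / h (x - u)) * (h (x - u) / h x) * p u) \<longlongrightarrow> a * p u) at_top" by simp
      have "\<forall>\<^sub>F x in at_top. (k (x - u) / h (x - u)) * (h (x - u) / h x) * p u = ?F x u"
        using ev_pos eventually_ge_at_top[of "x1 + u"]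
      proof eventually_elim
        case (elim x)
        have "h (x - u) > 0" using elim x1 by (intro pos) simp
        then show ?case using elim by (simp add: indicator_def)
      qed
      from Lim_transform_eventually[OF l this] show ?thesis .
    qed
    show "integrable lborel (\<lambda>u. C1 * weight u)" using weight_int by simp
  qed measurable
  moreover have "((\<lambda>x. LINT u|lborel. ?G x u) \<longlongrightarrow> 0) at_top"
  proof (rule Lim_null_comparison)
    have "((\<lambda>x. C2 * (LINT y|lborel. k y) * (exp (- x) / h x)) \<longlongrightarrow> C2 * (LINT y|lborel. k y) * 0) at_top"
      by (intro tendsto_mult_left exp_negligible)
    then show "((\<lambda>x. C2 * (LINT y|lborel. k y) * (exp (- x) / h x)) \<longlongrightarrow> 0) at_top" by simp
    show "\<forall>\<^sub>F x in at_top. norm (LINT u|lborel. ?G x u) \<le> C2 * (LINT y|lborel. k y) * (exp (- x) / h x)"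
      using ev_pos eventually_ge_at_top[of x1]
    proof eventually_elim
      case (elim x)
      have "norm (LINT u|lborel. ?G x u) = (LINT u|lborel. ?G x u)"
        using p_nonneg k0 nonneg by (simp add: integral_nonneg_AE)
      also have "\<dots> \<le> (LINT u|lborel. (C2 * exp (- x) / h x) * k (x - u))"
      proof (rule integral_mono[OF iG])
        show "integrable lborel (\<lambda>u. (C2 * exp (- x) / h x) * k (x - u))"
          using integrable_reflect(1)[OF ki] by simp
        show "?G x u \<le> (C2 * exp (- x) / h x) * k (x - u)" for u
          using P2[of x u] elim k0[of "x - u"] C12
          by (auto simp: indicator_def divide_right_mono)
      qed
      also have "\<dots> = C2 * (LINT y|lborel. k y) * (exp (- x) / h x)"
        using integrable_reflect(2)[OF ki, of x] by simp
      finally show ?case .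
    qed
  qed
  ultimately have "((\<lambda>x. density_conv p k x / h x) \<longlongrightarrow> (LINT u|lborel. a * p u) + 0) at_top"
    unfolding split by (rule tendsto_add)
  then show ?thesis by (simp add: p_one)
qed

text \<open>The tails of the majorant \<open>weight\<close> are small uniformly in \<open>x\<close>,
  so the window is chosen before \<open>x\<close> tends to infinity. It serves the situation where
  \<open>k = O(h)\<close> is known but the behaviour of \<open>k x / h x\<close> is not.\<close>

lemma conv_outside:
  fixes k :: "real \<Rightarrow> real"
  assumes [measurable]: "k \<in> borel_measurable borel" and k0: "\<And>x. 0 \<le> k x" and ki: "integrable lborel k"
    and tail_ft: "\<And>x. x0 \<le> x \<Longrightarrow> k x \<le> C * h x" and C: "0 \<le> C" and e: "0 < e"
  shows "\<exists>b0>0. \<forall>b\<ge>b0. \<forall>\<^sub>F x in at_top. (LINT u|lborel. indicator (- {-b..b}) u * (p u * k (x - u))) \<le> e * h x"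
proof -
  obtain x1 C1 C2 where x1: "x1 \<ge> x0" and C12: "0 \<le> C1" "0 \<le> C2"
    and P1: "\<And>x u. x1 \<le> x \<Longrightarrow> x1 \<le> x - u \<Longrightarrow> p u * k (x - u) \<le> C1 * h x * weight u"
    and P2: "\<And>x u. x1 \<le> x \<Longrightarrow> x - u < x1 \<Longrightarrow> p u * k (x - u) \<le> C2 * exp (- x) * k (x - u)"
    using conv_pointwise[OF k0 tail_ft C] by blast
  define m where "m = (LINT y|lborel. k y)"
  have m: "0 \<le> m" unfolding m_def using k0 by (simp add: integral_nonneg_AE)
  \<comment> \<open>Half of \<open>e\<close> is spent on the weight outside the window, half on the
    \<open>exp (- x)\<close> remainder; the added 1 guards against a vanishing constant.\<close>
  obtain b0 where b0: "b0 > 0" "\<And>b. b0 \<le> b \<Longrightarrow> (LINT u|lborel. indicator (- {-b..b}) u * weight u) \<le> e / (2 * (C1 + 1))"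
    using mass_outside[of "e / (2 * (C1 + 1))"] e C12 by auto
  have "\<forall>\<^sub>F x in at_top. exp (- x) / h x < e / (2 * (C2 * m + 1))"
    using e C12 m by (intro order_tendstoD(2)[OF exp_negligible]) (simp add: add_nonneg_pos)
  then have ev: "\<forall>\<^sub>F x in at_top. (LINT u|lborel. indicator (- {-b..b}) u * (p u * k (x - u))) \<le> e * h x" if b: "b0 \<le> b" for b
    using ev_pos eventually_ge_at_top[of x1]
  proof eventually_elim
    case (elim x)
    have absp: "\<bar>p x\<bar> \<le> Bp" for x using p_nonneg p_bounded by simp
    have ip: "integrable lborel (\<lambda>u. p u * k (x - u))"
      using lborel_integrable_real_affine[OF integrable_conv[OF p_meas absp ki, of x], of "-1" x] by simp
    let ?R = "\<lambda>u. (C1 * h x) * (indicator (- {-b..b}) u * weight u) + (C2 * exp (- x)) * k (x - u)"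
    have iw: "integrable lborel (\<lambda>u. indicator (- {-b..b}) u * weight u)"
      using integrable_mult_indicator[OF _ weight_int, of "- {-b..b}"] by simp
    have "(LINT u|lborel. indicator (- {-b..b}) u * (p u * k (x - u))) \<le> (LINT u|lborel. ?R u)"
    proof (rule integral_mono)
      show "integrable lborel (\<lambda>u. indicator (- {-b..b}) u * (p u * k (x - u)))"
        using integrable_mult_indicator[OF _ ip, of "- {-b..b}"] by simp
      show "integrable lborel ?R" using iw integrable_reflect(1)[OF ki, of x] by simp
      fix u
      have n: "0 \<le> C1 * h x * weight u" "0 \<le> C2 * exp (- x) * k (x - u)"
        using C12 nonneg[of x] weight_nonneg[of u] k0[of "x - u"] by simp_all
      show "indicator (- {-b..b}) u * (p u * k (x - u)) \<le> ?R u"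
      proof (cases "u \<in> {-b..b}")
        case True then show ?thesis using n by simp
      next
        case False
        then show ?thesis using n P1[of x u] P2[of x u] elim by (cases "x1 \<le> x - u") auto
      qed
    qed
    also have "\<dots> = (C1 * h x) * (LINT u|lborel. indicator (- {-b..b}) u * weight u) + (C2 * exp (- x)) * m"
      using iw integrable_reflect[OF ki, of x] by (simp add: m_def)
    also have "\<dots> \<le> (C1 * h x) * (e / (2 * (C1 + 1))) + (C2 * (e / (2 * (C2 * m + 1)) * h x)) * m"
    proof (intro add_mono mult_left_mono mult_right_mono b0 b m C12)
      show "0 \<le> C1 * h x" using C12 nonneg by simp
      show "exp (- x) \<le> e / (2 * (C2 * m + 1)) * h x" using elim by (simp add: divide_less_eq)
    qed
    also have "\<dots> \<le> e / 2 * h x + e / 2 * h x"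
    proof (rule add_mono)
      have "C1 * (e / (2 * (C1 + 1))) \<le> e / 2" using C12 e by (simp add: field_simps)
      from mult_right_mono[OF this nonneg[of x]] show "(C1 * h x) * (e / (2 * (C1 + 1))) \<le> e / 2 * h x"
        by (simp add: mult_ac)
      have "C2 * m * (e / (2 * (C2 * m + 1))) \<le> e / 2"
      proof -
        define q where "q = C2 * m"
        have q: "0 \<le> q" using C12 m by (simp add: q_def)
        have "q * (e / (2 * (q + 1))) = e / 2 * (q / (q + 1))" by (simp add: field_simps)
        also have "\<dots> \<le> e / 2 * 1" using q e by (intro mult_left_mono) auto
        finally show ?thesis by (simp add: q_def)
      qed
      from mult_right_mono[OF this nonneg[of x]] show "(C2 * (e / (2 * (C2 * m + 1)) * h x)) * m \<le> e / 2 * h x"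
        by (simp add: mult_ac)
    qed
    finally show ?case by simp
  qed
  show ?thesis using b0(1) ev by blast
qed

end

section \<open>Convolution bounds through the middle part, and transfer between comparable
  functions\<close>

context long_tailed_ad
begin

lemma middle_integrable: "integrable lborel (\<lambda>y. indicator {A..x - A} y * (h (x - y) * h y))"
  using integrable_mult_indicator[OF _ integrable_conv[OF meas abs_bounded int, of x], of "{A..x - A}"] by simp

lemma middle_nonneg: "0 \<le> middle_conv h A x"
  unfolding middle_conv_def using nonneg by (simp add: integral_nonneg_AE)

lemma middle_mono: "A \<le> A' \<Longrightarrow> middle_conv h A' x \<le> middle_conv h A x"
  unfolding middle_conv_def
  by (rule integral_mono[OF middle_integrable middle_integrable]) (auto simp: indicator_def nonneg)

lemma tightD:
  assumes "tight_conv h" "e > 0"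
  shows "\<exists>A\<ge>a. \<forall>\<^sub>F x in at_top. middle_conv h A x \<le> e * h x"
proof -
  obtain A where A: "\<forall>\<^sub>F x in at_top. middle_conv h A x \<le> e * h x"
    using assms unfolding tight_conv_def by blast
  have "\<forall>\<^sub>F x in at_top. middle_conv h (max A a) x \<le> e * h x"
    using A by (rule eventually_mono) (rule order_trans[OF middle_mono], auto)
  then show ?thesis by (intro exI[of _ "max A a"]) auto
qed

text \<open>If \<open>y \<le> A\<close>, then \<open>D (x - y)\<close> is at most a multiple of
  \<open>h x\<close>, and integration leaves the mass of \<open>k\<close>; the case
  \<open>x - y \<le> A\<close> is symmetric and leaves the mass of \<open>D\<close>; what remains is
  the tight middle part. Each constant is multiplied by a mass, which makes the bound small for a
  large cutoff.\<close>

lemma conv_mid_bound: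
  fixes D k :: "real \<Rightarrow> real"
  assumes tight: "tight_conv h"
    and [measurable]: "D \<in> borel_measurable borel" "k \<in> borel_measurable borel"
    and D: "\<And>x. 0 \<le> D x" "integrable lborel D" "\<And>x. x0 \<le> x \<Longrightarrow> D x \<le> C * h x" "\<And>x. D x \<le> BD"
    and k: "\<And>x. 0 \<le> k x" "integrable lborel k" "\<And>x. x0 \<le> x \<Longrightarrow> k x \<le> C' * h x"
    and C: "0 \<le> C" "0 \<le> C'" and e: "0 < e"
  shows "\<forall>\<^sub>F x in at_top. density_conv D k x \<le>
    (2 * K * (C * (LINT y|lborel. k y) + C' * (LINT y|lborel. D y)) + e) * h x"
proof -
  have CC: "0 \<le> C * C'" using C by simp
  \<comment> \<open>Together with \<open>x \<ge> 2 * A\<close> this puts whichever of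
    \<open>y\<close> and \<open>x - y\<close> is not small beyond \<open>x0\<close>, where the
    bounds on \<open>D\<close> and \<open>k\<close> hold.\<close>
  obtain A where A: "A \<ge> x0" "\<forall>\<^sub>F x in at_top. middle_conv h A x \<le> e / (C * C' + 1) * h x"
    using tightD[OF tight, of "e / (C * C' + 1)"] e CC by (auto simp: add_nonneg_pos)
  have absD: "\<bar>D x\<bar> \<le> BD" for x using D(1,4)[of x] by simp
  show ?thesis
    using A(2) ev_left[of A] ev_pos eventually_ge_at_top[of "2 * A"]
  proof eventually_elim
    case (elim x)
    let ?R = "\<lambda>y. 2 * K * C * h x * k y + 2 * K * C' * h x * D (x - y)
        + C * C' * (indicator {A..x - A} y * (h (x - y) * h y))"
    have iR: "integrable lborel ?R"
      using middle_integrable k(2) integrable_reflect(1)[OF D(2), of x] by simp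
    have "density_conv D k x \<le> (LINT y|lborel. ?R y)"
      unfolding density_conv_def
    proof (rule integral_mono[OF integrable_conv[OF _ absD k(2)] iR])
      fix y
      have n: "0 \<le> 2 * K * C * h x * k y" "0 \<le> 2 * K * C' * h x * D (x - y)"
        "0 \<le> C * C' * (indicator {A..x - A} y * (h (x - y) * h y))"
        using K C CC nonneg k(1) D(1) by (simp_all add: indicator_def)
      consider "y \<le> A" | "x - y \<le> A" | "A < y" "A < x - y" by linarith
      then show "D (x - y) * k y \<le> ?R y"
      proof cases
        case 1
        have "D (x - y) \<le> C * h (x - y)" using 1 A elim by (intro D) linarith
        also have "\<dots> \<le> C * (2 * K * h x)" using elim 1 C by (intro mult_left_mono) auto
        finally have "D (x - y) * k y \<le> C * (2 * K * h x) * k y" by (intro mult_right_mono k)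
        then show ?thesis using n by (simp add: mult_ac)
      next
        case 2
        have "k y \<le> C' * h (x - (x - y))" using 2 A elim by (simp add: k)
        also have "\<dots> \<le> C' * (2 * K * h x)" using elim 2 C by (intro mult_left_mono) blast+
        finally have "D (x - y) * k y \<le> D (x - y) * (C' * (2 * K * h x))" by (intro mult_left_mono D)
        then show ?thesis using n by (simp add: mult_ac)
      next
        case 3
        have "D (x - y) * k y \<le> (C * h (x - y)) * (C' * h y)"
          using 3 A by (intro mult_mono D k) (auto simp: C nonneg)
        then show ?thesis using n 3 by (simp add: mult_ac)
      qed
    qed simp
    also have "\<dots> = 2 * K * C * h x * (LINT y|lborel. k y) + 2 * K * C' * h x * (LINT y|lborel. D y)
        + C * C' * middle_conv h A x"
      using middle_integrable k(2) integrable_reflect[OF D(2), of x]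
      by (simp add: middle_conv_def)
    also have "C * C' * middle_conv h A x \<le> C * C' * (e / (C * C' + 1) * h x)"
      using elim CC by (intro mult_left_mono)
    also have "\<dots> \<le> e * h x"
    proof -
      define q where "q = C * C'"
      have q: "0 \<le> q" using CC by (simp add: q_def)
      have "q * (e / (q + 1)) = e * (q / (q + 1))" by simp
      also have "\<dots> \<le> e * 1" using q e by (intro mult_left_mono) auto
      finally have "C * C' * (e / (C * C' + 1)) \<le> e" by (simp add: q_def)
      from mult_right_mono[OF this nonneg[of x]] show ?thesis by (simp only: mult.assoc)
    qed
    finally show ?case by (simp add: algebra_simps)
  qed
qed

end

text \<open>Eventually \<open>k\<close> lies between \<open>a / 2 * h\<close> and
  \<open>2 * a * h\<close>; the quotient 4 of these constants enters the new almost-decrease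
  constant. The shift quotient of \<open>k\<close> is a combination of three quotients with known
  limits.\<close>

lemma long_tailed_ad_transfer:
  assumes h: "long_tailed_ad h x0 K B"
    and [measurable]: "k \<in> borel_measurable borel" and k: "\<And>x. 0 \<le> k x" "\<And>x. k x \<le> B'" "integrable lborel k"
    and lim: "((\<lambda>x. k x / h x) \<longlongrightarrow> a) at_top" and a: "0 < a"
  shows "\<exists>x1 K'. long_tailed_ad k x1 K' B'"
proof -
  interpret long_tailed_ad h x0 K B by fact
  have "\<forall>\<^sub>F x in at_top. a / 2 < k x / h x" using a by (intro order_tendstoD(1)[OF lim]) simp
  moreover have "\<forall>\<^sub>F x in at_top. k x / h x < 2 * a" using a by (intro order_tendstoD(2)[OF lim]) simp
  ultimately have "\<forall>\<^sub>F x in at_top. a / 2 * h x \<le> k x \<and> k x \<le> 2 * a * h x \<and> 0 < k x"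
    using ev_pos
  proof eventually_elim
    case (elim x)
    have 1: "a / 2 * h x < k x" using elim(1,3) by (subst (asm) less_divide_eq) simp
    have 2: "k x < 2 * a * h x" using elim(2,3) by (subst (asm) divide_less_eq) simp
    have "0 < a / 2 * h x" using a elim(3) by simp
    with 1 2 show ?case by linarith
  qed
  then obtain x2 where x2: "\<And>x. x2 \<le> x \<Longrightarrow> a / 2 * h x \<le> k x \<and> k x \<le> 2 * a * h x \<and> 0 < k x"
    by (auto simp: eventually_at_top_linorder)
  define x1 where "x1 = max x0 x2"
  have "long_tailed_ad k x1 (4 * K) B'"
  proof
    show "0 < x1" "1 \<le> 4 * K" using x0 K by (auto simp: x1_def)
    show "0 < k x" if "x1 \<le> x" for x using x2[of x] that by (simp add: x1_def)
    show "k (x + y) \<le> 4 * K * k x" if "x1 \<le> x" "0 \<le> y" for x y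
    proof -
      have "k (x + y) \<le> 2 * a * h (x + y)" using x2[of "x + y"] that by (simp add: x1_def)
      also have "\<dots> \<le> 2 * a * (K * h x)" using a ad[of x y] that by (intro mult_left_mono) (auto simp: x1_def)
      also have "\<dots> = 4 * K * (a / 2 * h x)" by simp
      also have "\<dots> \<le> 4 * K * k x" using x2[of x] that K by (intro mult_left_mono) (auto simp: x1_def)
      finally show ?thesis .
    qed
    show "((\<lambda>x. k (x + y) / k x) \<longlongrightarrow> 1) at_top" for y
    proof -
      have sh: "filterlim (\<lambda>x::real. x + y) at_top at_top" by real_asymp
      have "((\<lambda>x. (k (x + y) / h (x + y)) * (h (x + y) / h x) / (k x / h x)) \<longlongrightarrow> a * 1 / a) at_top"
        using a by (intro tendsto_intros filterlim_compose[OF lim sh] lim shift) simp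
      then have l: "((\<lambda>x. (k (x + y) / h (x + y)) * (h (x + y) / h x) / (k x / h x)) \<longlongrightarrow> 1) at_top" using a by simp
      have "\<forall>\<^sub>F x in at_top. (k (x + y) / h (x + y)) * (h (x + y) / h x) / (k x / h x) = k (x + y) / k x"
        using ev_pos eventually_ge_at_top[of "x0 - y"] eventually_ge_at_top[of x1]
      proof eventually_elim
        case (elim x)
        have "h (x + y) > 0" using elim by (intro pos) simp
        then show ?case using elim by simp
      qed
      from Lim_transform_eventually[OF l this] show ?thesis .
    qed
  qed (use k in auto)
  then show ?thesis by blast
qed

text \<open>Two-sided comparability is enough: the middle integral is quadratic in the function and
  so picks up \<open>C\<^sup>2\<close>, and one factor \<open>C'\<close> returns from
  \<open>h x\<close> to \<open>k x\<close>.\<close>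

lemma (in long_tailed_ad) tight_conv_transfer:
  assumes tight: "tight_conv h" and [measurable]: "k \<in> borel_measurable borel" and k0: "\<And>x. 0 \<le> k x"
    and tail_ft: "\<forall>\<^sub>F x in at_top. k x \<le> C * h x" and hk: "\<forall>\<^sub>F x in at_top. h x \<le> C' * k x"
  shows "tight_conv k"
  unfolding tight_conv_def
proof (intro allI impI)
  fix e :: real assume e: "0 < e"
  obtain a where a: "\<And>x. a \<le> x \<Longrightarrow> k x \<le> \<bar>C\<bar> * h x"
  proof -
    obtain a where "\<And>x. a \<le> x \<Longrightarrow> k x \<le> C * h x" using tail_ft by (auto simp: eventually_at_top_linorder)
    moreover have "C * h x \<le> \<bar>C\<bar> * h x" for x using nonneg by (intro mult_right_mono) auto
    ultimately show ?thesis by (intro that[of a]) (meson order_trans)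
  qed
  define d where "d = e / (C\<^sup>2 * \<bar>C'\<bar> + 1)"
  have den: "0 < C\<^sup>2 * \<bar>C'\<bar> + 1" by (simp add: add_nonneg_pos)
  have d: "0 < d" using e den by (simp add: d_def)
  \<comment> \<open>The cutoff is raised past \<open>a\<close>, so that both \<open>y\<close> and
    \<open>x - y\<close> lie where \<open>k\<close> is dominated by \<open>h\<close>.\<close>
  obtain A where A: "A \<ge> max a 1" "\<forall>\<^sub>F x in at_top. middle_conv h A x \<le> d * h x"
    using tightD[OF tight d] by blast
  have "\<forall>\<^sub>F x in at_top. middle_conv k A x \<le> e * k x"
    using A(2) hk
  proof eventually_elim
    case (elim x)
    have "middle_conv k A x \<le> (LINT y|lborel. C\<^sup>2 * (indicator {A..x - A} y * (h (x - y) * h y)))"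
      unfolding middle_conv_def
    proof (rule integral_mono')
      show "integrable lborel (\<lambda>y. C\<^sup>2 * (indicator {A..x - A} y * (h (x - y) * h y)))"
        using middle_integrable by simp
      show "indicator {A..x - A} y * (k (x - y) * k y) \<le> C\<^sup>2 * (indicator {A..x - A} y * (h (x - y) * h y))" for y
      proof (cases "y \<in> {A..x - A}")
        case True
        have "k (x - y) * k y \<le> (\<bar>C\<bar> * h (x - y)) * (\<bar>C\<bar> * h y)"
          using True A nonneg k0 by (intro mult_mono a) auto
        also have "\<dots> = C\<^sup>2 * (h (x - y) * h y)"
          by (simp add: power2_eq_square flip: abs_mult)
        finally show ?thesis using True by simp
      qed simp
      show "0 \<le> C\<^sup>2 * (indicator {A..x - A} y * (h (x - y) * h y))" for y
        using nonneg by (simp add: indicator_def)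
    qed
    also have "\<dots> = C\<^sup>2 * middle_conv h A x" by (simp add: middle_conv_def)
    also have "\<dots> \<le> C\<^sup>2 * (d * h x)" using elim by (intro mult_left_mono) auto
    also have "\<dots> \<le> C\<^sup>2 * (d * (\<bar>C'\<bar> * k x))"
    proof -
      have "h x \<le> \<bar>C'\<bar> * k x"
        using elim(2) mult_right_mono[OF abs_ge_self[of C'] k0[of x]] by linarith
      then show ?thesis using d by (intro mult_left_mono) auto
    qed
    also have "\<dots> = (C\<^sup>2 * \<bar>C'\<bar> * d) * k x" by simp
    also have "\<dots> \<le> e * k x"
    proof (rule mult_right_mono[OF _ k0])
      have "C\<^sup>2 * \<bar>C'\<bar> * d \<le> (C\<^sup>2 * \<bar>C'\<bar> + 1) * d" using d by (intro mult_right_mono) auto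
      also have "\<dots> = e" using den by (simp add: d_def)
      finally show "C\<^sup>2 * \<bar>C'\<bar> * d \<le> e" .
    qed
    finally show ?case .
  qed
  then show "\<exists>A>0. \<forall>\<^sub>F x in at_top. middle_conv k A x \<le> e * k x"
    using A(1) by (intro exI[of _ A]) auto
qed

section \<open>Weak subexponentiality and the middle part of the convolution\<close>

lemma probability_density_integral:
  assumes "probability_density h"
  shows "integrable lborel h" "(LINT x|lborel. h x) = 1"
proof -
  have m [measurable]: "h \<in> borel_measurable borel" and h0: "\<And>x. 0 \<le> h x"
    and nn: "(\<integral>\<^sup>+ x. ennreal (h x) \<partial>lborel) = 1"
    using assms by (auto simp: probability_density_def)
  show i: "integrable lborel h" by (rule integrableI_nonneg) (use h0 nn in auto)
  have "ennreal (LINT x|lborel. h x) = 1" using nn_integral_eq_integral[OF i] h0 nn by simp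
  then show "(LINT x|lborel. h x) = 1" by (simp add: ennreal_eq_1)
qed

lemma right_tail_eq:
  assumes "probability_density h"
  shows "right_tail h 0 = (LINT x|lborel. indicator {0..} x * h x)"
proof -
  have m [measurable]: "h \<in> borel_measurable borel" and h0: "\<And>x. 0 \<le> h x"
    using assms by (auto simp: probability_density_def)
  note i = probability_density_integral[OF assms]
  let ?M = "density lborel (\<lambda>x. ennreal (h x))"
  have "cdf ?M 0 = (LINT x|?M. indicator {..0} x)"
    by (simp add: cdf_def)
  also have "\<dots> = (LINT x|lborel. h x * indicator {..0} x)"
    by (subst integral_density) (use h0 in auto)
  also have "\<dots> = (LINT x|lborel. h x - indicator {0..} x * h x)"
  proof (rule integral_cong_AE)
    show "AE x in lborel. h x * indicator {..0} x = h x - indicator {0..} x * h x"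
      using AE_lborel_singleton[of "0::real"] by eventually_elim (auto simp: indicator_def)
  qed measurable
  also have "\<dots> = 1 - (LINT x|lborel. indicator {0..} x * h x)"
    using i integrable_mult_indicator[OF _ i(1), of "{0..}"] by (subst Bochner_Integration.integral_diff) auto
  finally show ?thesis by (simp add: right_tail_def)
qed

context long_tailed_ad
begin

lemma long_tailedI: "probability_density h \<Longrightarrow> long_tailed h"
  unfolding long_tailed_def
  using x0 pos shift by (auto intro!: exI[of _ x0] asymp_equivI')

lemma almost_decreasingI: "almost_decreasing h"
  unfolding almost_decreasing_def
  using x0 K ad by (intro exI[of _ x0] exI[of _ K] conjI) auto

lemma right_tail_pos:
  assumes "probability_density h"
  shows "0 < right_tail h 0"
proof -
  have i: "integrable lborel (\<lambda>x. indicator {0..} x * h x)"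
    using integrable_mult_indicator[OF _ int, of "{0..}"] by simp
  have n: "0 \<le> (LINT x|lborel. indicator {0..} x * h x)"
    using nonneg by (simp add: integral_nonneg_AE)
  have "(LINT x|lborel. indicator {0..} x * h x) \<noteq> 0"
  proof
    assume "(LINT x|lborel. indicator {0..} x * h x) = 0"
    then have "AE x in lborel. indicator {0..} x * h x = 0"
      using integral_nonneg_eq_0_iff_AE[OF i] nonneg by simp
    then have "AE x in lborel. x \<notin> {x0..x0 + 1}"
      by eventually_elim (use pos x0 in \<open>force simp: indicator_def\<close>)
    then have "emeasure lborel {x0..x0 + 1} = 0"
      by (subst (asm) AE_iff_measurable[where N="{x0..x0 + 1}"]) auto
    then show False by simp
  qed
  with n show ?thesis by (simp add: right_tail_eq[OF assms])
qed

text \<open>The self-convolution of the positive part is split at \<open>A\<close> and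
  \<open>x - A\<close>. By symmetry the two ends agree; divided by \<open>h x\<close>, each tends to
  the mass \<open>I A\<close> of \<open>h\<close> on \<open>[0, A)\<close>, and \<open>I A\<close>
  tends to \<open>q\<close> as \<open>A\<close> grows. Hence the normalised convolution tends to
  \<open>2 * q\<close> exactly when the middle part is negligible.\<close>

lemma weakly_subexponential_iff_tight:
  assumes pd: "probability_density h"
  shows "weakly_subexponential h \<longleftrightarrow> tight_conv h"
proof -
  define q where "q = right_tail h 0"
  define hp where "hp = positive_part_density h"
  define I where "I A = (LINT y|lborel. indicator {0..<A} y * h y)" for A
  define J where "J A x = (LINT y|lborel. indicator {0..<A} y * (h (x - y) * h y))" for A x
  have q: "0 < q" unfolding q_def by (rule right_tail_pos[OF pd])
  have hp: "hp = (\<lambda>x. indicator {0..} x * h x / q)"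
    unfolding hp_def positive_part_density_def q_def ..
  have [measurable]: "hp \<in> borel_measurable borel" unfolding hp by measurable
  have hp_int: "integrable lborel (\<lambda>x. indicator {0..} x * h x)"
    using integrable_mult_indicator[OF _ int, of "{0..}"] by simp
  have hp_pd: "probability_density hp"
    unfolding probability_density_def
  proof (intro conjI allI)
    show "hp \<in> borel_measurable borel" by measurable
    show hp0: "0 \<le> hp x" for x using q nonneg by (simp add: hp)
    have "(\<integral>\<^sup>+ x. ennreal (hp x) \<partial>lborel) = ennreal (LINT x|lborel. hp x)"
      using hp_int hp0 by (intro nn_integral_eq_integral) (auto simp: hp)
    also have "(LINT x|lborel. hp x) = 1"
      using q by (simp add: hp right_tail_eq[OF pd, folded q_def, symmetric])
    finally show "(\<integral>\<^sup>+ x. ennreal (hp x) \<partial>lborel) = 1" by simp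
  qed
  have hp_eq: "hp x = h x / q" if "0 \<le> x" for x using that by (simp add: hp)
  have hp_lt: "long_tailed hp"
    unfolding long_tailed_def
  proof (intro conjI hp_pd allI impI)
    show "\<exists>x\<^sub>0>0. \<forall>x\<ge>x\<^sub>0. 0 < hp x"
      by (rule exI[of _ x0]) (use x0 pos q in \<open>auto simp: hp_eq\<close>)
    fix y :: real assume y: "0 < y"
    have "\<forall>\<^sub>F x in at_top. h (x + y) / h x = hp (x + y) / hp x"
      using eventually_ge_at_top[of 0] by eventually_elim (use y q in \<open>simp add: hp_eq\<close>)
    from Lim_transform_eventually[OF shift this] show "(\<lambda>x. hp (x + y)) \<sim>[at_top] hp"
      by (rule asymp_equivI')
  qed
  have conv_int: "integrable lborel (\<lambda>y. indicator S y * (h (x - y) * h y))" if "S \<in> sets borel" for S x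
    using integrable_mult_indicator[OF _ integrable_conv[OF meas abs_bounded int, of x], of S] that by simp
  have conv: "q\<^sup>2 * density_conv hp hp x = 2 * J A x + middle_conv h A x" if A: "0 < A" "2 * A < x" for A x
  proof -
    have refl: "(LINT y|lborel. indicator {x - A<..x} y * (h (x - y) * h y)) = J A x"
      unfolding J_def
      by (subst lborel_integral_real_affine[where c="-1" and t=x])
        (auto simp: indicator_def mult_ac intro!: Bochner_Integration.integral_cong)
    have "q\<^sup>2 * density_conv hp hp x = (LINT y|lborel. q\<^sup>2 * (hp (x - y) * hp y))"
      by (simp add: density_conv_def)
    also have "\<dots> = (LINT y|lborel. (indicator {0..<A} y * (h (x - y) * h y) + indicator {A..x - A} y * (h (x - y) * h y))
        + indicator {x - A<..x} y * (h (x - y) * h y))"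
      using A q by (intro Bochner_Integration.integral_cong refl) (auto simp: hp indicator_def power2_eq_square)
    also have "\<dots> = 2 * J A x + middle_conv h A x"
      using conv_int[of "{0..<A}" x] conv_int[of "{A..x - A}" x] conv_int[of "{x - A<..x}" x]
      by (simp add: J_def middle_conv_def refl[unfolded J_def])
    finally show ?thesis .
  qed
  have J_lim: "((\<lambda>x. J A x / h x) \<longlongrightarrow> I A) at_top" for A
  proof -
    have "((\<lambda>x. LINT y|lborel. indicator {0..<A} y * (h (x - y) * h y) / h x) \<longlongrightarrow> I A) at_top"
      unfolding I_def
    proof (rule tendsto_integral_at_top[where w="\<lambda>y. 2 * K * h y"])
      show "\<forall>\<^sub>F x in at_top. \<forall>y. norm (indicator {0..<A} y * (h (x - y) * h y) / h x) \<le> 2 * K * h y"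
        using ev_left[of A] ev_pos
      proof eventually_elim
        case (elim x)
        show ?case
        proof
          fix y
          show "norm (indicator {0..<A} y * (h (x - y) * h y) / h x) \<le> 2 * K * h y"
          proof (cases "y \<in> {0..<A}")
            case True
            have "h (x - y) * h y \<le> 2 * K * h x * h y"
              using elim True nonneg by (intro mult_right_mono) auto
            then show ?thesis using True elim nonneg by (simp add: divide_le_eq mult_ac)
          next
            case False
            then show ?thesis using K nonneg by simp
          qed
        qed
      qed
      show "((\<lambda>x. indicator {0..<A} y * (h (x - y) * h y) / h x) \<longlongrightarrow> indicator {0..<A} y * h y) at_top" for y
        using tendsto_mult_left[OF shift[of "- y"], of "indicator {0..<A} y * h y"] by (simp add: mult_ac)
      show "integrable lborel (\<lambda>y. 2 * K * h y)" using int by simp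
    qed measurable
    then show ?thesis by (simp add: J_def)
  qed
  have I_lim: "(I \<longlongrightarrow> q) at_top"
  proof -
    have "((\<lambda>A. LINT y|lborel. indicator {0..<A} y * h y) \<longlongrightarrow> (LINT y|lborel. indicator {0..} y * h y)) at_top"
    proof (rule tendsto_integral_at_top[where w=h])
      fix y :: real
      have "\<forall>\<^sub>F A in at_top. indicator {0..<A} y * h y = indicator {0..} y * h y"
        using eventually_gt_at_top[of y] by eventually_elim (auto simp: indicator_def)
      then show "((\<lambda>A. indicator {0..<A} y * h y) \<longlongrightarrow> indicator {0..} y * h y) at_top"
        by (rule tendsto_eventually)
    qed (use int nonneg in \<open>auto simp: indicator_def\<close>)
    then show ?thesis by (simp add: I_def[abs_def] right_tail_eq[OF pd, folded q_def])
  qed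
  \<comment> \<open>Since \<open>hp = h / q\<close> on the right half line, this normalisation turns
    the defining limit 1 into the limit \<open>2 * q\<close>.\<close>
  define r where "r x = q\<^sup>2 * density_conv hp hp x / h x" for x
  have r_eq: "\<forall>\<^sub>F x in at_top. r x = 2 * (J A x / h x) + middle_conv h A x / h x" if "0 < A" for A
    using eventually_gt_at_top[of "2 * A"]
    by eventually_elim (use that in \<open>simp add: r_def conv add_divide_distrib\<close>)
  have "weakly_subexponential h \<longleftrightarrow> subexponential hp"
    using long_tailedI[OF pd] by (simp add: weakly_subexponential_def hp_def)
  also have "\<dots> \<longleftrightarrow> density_conv hp hp \<sim>[at_top] (\<lambda>x. 2 * hp x)"
    using hp_lt by (simp add: subexponential_def)
  also have "\<dots> \<longleftrightarrow> ((\<lambda>x. density_conv hp hp x / (2 * hp x)) \<longlongrightarrow> 1) at_top"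
  proof
    assume "density_conv hp hp \<sim>[at_top] (\<lambda>x. 2 * hp x)"
    moreover have "\<forall>\<^sub>F x in at_top. density_conv hp hp x \<noteq> 0 \<or> 2 * hp x \<noteq> 0"
      using ev_pos by eventually_elim (use x0 q in \<open>auto simp: hp\<close>)
    ultimately show "((\<lambda>x. density_conv hp hp x / (2 * hp x)) \<longlongrightarrow> 1) at_top"
      by (rule asymp_equivD_strong)
  qed (rule asymp_equivI')
  also have "\<dots> \<longleftrightarrow> (r \<longlongrightarrow> 2 * q) at_top"
  proof
    assume "((\<lambda>x. density_conv hp hp x / (2 * hp x)) \<longlongrightarrow> 1) at_top"
    then have "((\<lambda>x. 2 * q * (density_conv hp hp x / (2 * hp x))) \<longlongrightarrow> 2 * q * 1) at_top"
      by (rule tendsto_mult_left)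
    then have l: "((\<lambda>x. 2 * q * (density_conv hp hp x / (2 * hp x))) \<longlongrightarrow> 2 * q) at_top" by simp
    have "\<forall>\<^sub>F x in at_top. 2 * q * (density_conv hp hp x / (2 * hp x)) = r x"
      using eventually_ge_at_top[of 0] by eventually_elim (use q in \<open>simp add: r_def hp_eq power2_eq_square\<close>)
    from Lim_transform_eventually[OF l this] show "(r \<longlongrightarrow> 2 * q) at_top" .
  next
    assume "(r \<longlongrightarrow> 2 * q) at_top"
    then have "((\<lambda>x. r x / (2 * q)) \<longlongrightarrow> 2 * q / (2 * q)) at_top" using q by (intro tendsto_intros) auto
    then have l: "((\<lambda>x. r x / (2 * q)) \<longlongrightarrow> 1) at_top" using q by simp
    have "\<forall>\<^sub>F x in at_top. r x / (2 * q) = density_conv hp hp x / (2 * hp x)"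
      using eventually_ge_at_top[of 0] by eventually_elim (use q in \<open>simp add: r_def hp_eq power2_eq_square mult_ac\<close>)
    from Lim_transform_eventually[OF l this] show "((\<lambda>x. density_conv hp hp x / (2 * hp x)) \<longlongrightarrow> 1) at_top" .
  qed
  also have "\<dots> \<longleftrightarrow> tight_conv h"
  proof
    assume r: "(r \<longlongrightarrow> 2 * q) at_top"
    show "tight_conv h"
      unfolding tight_conv_def
    proof (intro allI impI)
      fix e :: real assume e: "0 < e"
      \<comment> \<open>With such an \<open>A\<close> the two ends miss less than
        \<open>e / 2\<close> of the limit \<open>2 * q\<close>, so the middle part eventually stays
        below \<open>e * h x\<close>.\<close>
      have "\<forall>\<^sub>F A in at_top. q - e / 4 < I A \<and> 0 < A"
        using e by (intro eventually_conj order_tendstoD(1)[OF I_lim] eventually_gt_at_top) simp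
      then obtain A where A: "q - e / 4 < I A" "0 < A" using eventually_happens'[OF trivial_limit_at_top_linorder] by blast
      have "((\<lambda>x. r x - 2 * (J A x / h x)) \<longlongrightarrow> 2 * q - 2 * I A) at_top"
        by (intro tendsto_intros r J_lim)
      then have "\<forall>\<^sub>F x in at_top. r x - 2 * (J A x / h x) < e"
        by (rule order_tendstoD(2)) (use A(1) e in linarith)
      then have "\<forall>\<^sub>F x in at_top. middle_conv h A x \<le> e * h x"
        using r_eq[OF A(2)] ev_pos
      proof eventually_elim
        case (elim x)
        then have "middle_conv h A x / h x < e" by simp
        then show ?case using elim by (simp add: divide_less_eq)
      qed
      then show "\<exists>A>0. \<forall>\<^sub>F x in at_top. middle_conv h A x \<le> e * h x" using A(2) by blast
    qed
  next
    assume tight: "tight_conv h"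
    show "(r \<longlongrightarrow> 2 * q) at_top"
    proof (rule tendsto_at_topI_le)
      fix e :: real assume e: "0 < e"
      have "\<forall>\<^sub>F A in at_top. \<bar>I A - q\<bar> < e / 6"
        using tendstoD[OF I_lim, of "e / 6"] e by (simp add: dist_real_def)
      then obtain A0 where A0: "\<And>A. A0 \<le> A \<Longrightarrow> \<bar>I A - q\<bar> < e / 6"
        by (auto simp: eventually_at_top_linorder)
      obtain A where A: "A \<ge> max A0 1" "\<forall>\<^sub>F x in at_top. middle_conv h A x \<le> e / 3 * h x"
        using tightD[OF tight divide_pos_pos[OF e zero_less_numeral]] by blast
      have "\<forall>\<^sub>F x in at_top. \<bar>J A x / h x - I A\<bar> < e / 6"
        using tendstoD[OF J_lim, of "e / 6"] e by (simp add: dist_real_def)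
      moreover have "\<forall>\<^sub>F x in at_top. r x = 2 * (J A x / h x) + middle_conv h A x / h x"
        by (rule r_eq) (use A in simp)
      ultimately show "\<forall>\<^sub>F x in at_top. \<bar>r x - 2 * q\<bar> \<le> e"
        using A(2) ev_pos
      proof eventually_elim
        case (elim x)
        have 1: "middle_conv h A x / h x \<le> e / 3" using elim by (simp add: divide_le_eq)
        have 2: "0 \<le> middle_conv h A x / h x" using middle_nonneg nonneg by simp
        have 3: "\<bar>I A - q\<bar> < e / 6" using A0[of A] A by simp
        show ?case unfolding elim(2) using elim(1) 1 2 3 by linarith
      qed
    qed
  qed
  finally show ?thesis .
qed

end

section \<open>The asymptotic comparison of a compound Poisson type density with its jump density\<close>

lemma density_conv_integral:
  fixes h k :: "real \<Rightarrow> real"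
  assumes h: "integrable lborel h" and k: "integrable lborel k"
  shows "integrable lborel (density_conv h k)"
    and "(LINT x|lborel. density_conv h k x) = (LINT x|lborel. h x) * (LINT x|lborel. k x)"
proof -
  have [measurable]: "h \<in> borel_measurable borel" "k \<in> borel_measurable borel" using h k by auto
  have i: "integrable (lborel \<Otimes>\<^sub>M lborel) (\<lambda>(y, x). h (x - y) * k y)"
  proof (rule lborel_pair.Fubini_integrable)
    have 1: "(LINT x|lborel. \<bar>h (x - y)\<bar>) = (LINT x|lborel. \<bar>h x\<bar>)" for y
      using lborel_integral_real_affine[of 1 "\<lambda>x. \<bar>h x\<bar>" "-y"] by simp
    have "(LINT x|lborel. norm (case (y, x) of (y, x) \<Rightarrow> h (x - y) * k y)) = (LINT x|lborel. \<bar>h x\<bar>) * \<bar>k y\<bar>" for y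
      by (simp add: abs_mult 1)
    then show "integrable lborel (\<lambda>y. LINT x|lborel. norm (case (y, x) of (y, x) \<Rightarrow> h (x - y) * k y))"
      using k by simp
    show "AE y in lborel. integrable lborel (\<lambda>x. case (y, x) of (y, x) \<Rightarrow> h (x - y) * k y)"
      using lborel_integrable_real_affine[OF h, of 1 "- y" for y] by simp
  qed measurable
  show "integrable lborel (density_conv h k)"
    using lborel_pair.integrable_snd[OF i] by (simp add: density_conv_def[abs_def])
  have "(LINT x|lborel. density_conv h k x) = (LINT y|lborel. LINT x|lborel. h (x - y) * k y)"
    using lborel_pair.Fubini_integral[OF i] by (simp add: density_conv_def)
  also have "\<dots> = (LINT y|lborel. (LINT x|lborel. h x) * k y)"
    using lborel_integral_real_affine[of 1 h "- y" for y] by simp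
  finally show "(LINT x|lborel. density_conv h k x) = (LINT x|lborel. h x) * (LINT x|lborel. k x)"
    by simp
qed

lemma sum_le_sums:
  fixes a :: "nat \<Rightarrow> real"
  assumes "a sums s" "\<And>n. 0 \<le> a n" "finite A"
  shows "sum a A \<le> s"
  using sum_le_suminf[OF sums_summable[OF assms(1)] assms(3)] assms(2) sums_unique[OF assms(1)] by simp

text \<open>\<open>g\<close> is the density of the jumps larger than 1. For each cutoff \<open>R\<close>, \<open>T R 0\<close> is the density of
  the factor of \<open>\<mu>\<close> whose jumps are at most \<open>R\<close>, and \<open>T R n\<close> is its convolution with the \<open>n\<close>-th power
  of the jumps above \<open>R\<close>. All estimates let the argument tend to infinity first and \<open>R\<close>
  afterwards, which makes the compound Poisson mass arbitrarily small.\<close>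

locale jump_split =
  fixes f g :: "real \<Rightarrow> real" and Bf Bg :: real and T :: "real \<Rightarrow> nat \<Rightarrow> real \<Rightarrow> real"
  assumes f_meas [measurable]: "f \<in> borel_measurable borel"
    and f_nonneg: "0 \<le> f x" and f_bounded: "f x \<le> Bf"
    and f_int: "integrable lborel f" and f_one: "(LINT x|lborel. f x) = 1"
    and g_meas [measurable]: "g \<in> borel_measurable borel"
    and g_nonneg: "0 \<le> g x" and g_bounded: "g x \<le> Bg" and g_int: "integrable lborel g"
    and T_meas [measurable]: "T R n \<in> borel_measurable borel"
    and T_light: "1 \<le> R \<Longrightarrow> \<exists>Cp Bp. light_density (T R 0) Cp Bp"
    and T_Suc: "1 \<le> R \<Longrightarrow> T R (Suc n) x = density_conv (T R n) (\<lambda>y. indicator {R<..} y * g y) x"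
    and T_sums: "1 \<le> R \<Longrightarrow>
      (\<lambda>n. T R n x / fact n) sums (exp (LINT y|lborel. indicator {R<..} y * g y) * f x)"
begin

section \<open>Masses, bounds and series of the convolution terms\<close>

definition tail :: "real \<Rightarrow> real \<Rightarrow> real" where "tail R y = indicator {R<..} y * g y"
definition c :: "real \<Rightarrow> real" where "c R = (LINT y|lborel. tail R y)"

lemma tail_meas [measurable]: "tail R \<in> borel_measurable borel"
  unfolding tail_def[abs_def] by measurable

lemma tail_nonneg: "0 \<le> tail R y" and tail_le: "tail R y \<le> g y"
  using g_nonneg by (auto simp: tail_def indicator_def)

lemma tail_int: "integrable lborel (tail R)"
  using integrable_mult_indicator[OF _ g_int, of "{R<..}"] by (simp add: tail_def[abs_def])

lemma c_nonneg: "0 \<le> c R" unfolding c_def using tail_nonneg by (simp add: integral_nonneg_AE)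

lemma c_tendsto: "(c \<longlongrightarrow> 0) at_top"
proof -
  have "((\<lambda>R. LINT y|lborel. tail R y) \<longlongrightarrow> (LINT y::real|lborel. 0)) at_top"
  proof (rule tendsto_integral_at_top[where w=g])
    fix y :: real
    have "\<forall>\<^sub>F R in at_top. tail R y = 0"
      using eventually_ge_at_top[of y] by eventually_elim (auto simp: tail_def)
    then show "((\<lambda>R. tail R y) \<longlongrightarrow> 0) at_top" by (rule tendsto_eventually)
  qed (use g_int tail_nonneg tail_le in auto)
  then show ?thesis by (simp add: c_def[abs_def])
qed

lemma c_antimono: "R \<le> R' \<Longrightarrow> c R' \<le> c R"
  unfolding c_def by (rule integral_mono[OF tail_int tail_int]) (use g_nonneg in \<open>auto simp: tail_def indicator_def\<close>)

lemma Suc_T: "1 \<le> R \<Longrightarrow> T R (Suc n) x = density_conv (T R n) (tail R) x"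
  unfolding tail_def[abs_def] by (rule T_Suc)

lemma sums_T: "1 \<le> R \<Longrightarrow> (\<lambda>n. T R n x / fact n) sums (exp (c R) * f x)"
  unfolding c_def tail_def[abs_def] by (rule T_sums)

lemma T_nonneg: "1 \<le> R \<Longrightarrow> 0 \<le> T R n x"
proof (induction n arbitrary: x)
  case 0
  then obtain Cp Bp where "light_density (T R 0) Cp Bp" using T_light by blast
  then show ?case by (rule light_density.p_nonneg)
next
  case (Suc n)
  then show ?case unfolding Suc_T[OF Suc.prems] density_conv_def
    using tail_nonneg by (simp add: integral_nonneg_AE)
qed

lemma T_int:
  assumes "1 \<le> R"
  shows "integrable lborel (T R n)" "(LINT x|lborel. T R n x) = c R ^ n"
proof (induction n)
  case 0
  obtain Cp Bp where "light_density (T R 0) Cp Bp" using T_light assms by blast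
  then interpret light_density "T R 0" Cp Bp .
  case 1 show ?case by (rule p_int)
  case 2 show ?case using p_one by simp
next
  case (Suc n)
  have eq: "T R (Suc n) = density_conv (T R n) (tail R)" using Suc_T[OF assms] by auto
  case 1 show ?case unfolding eq using Suc(1) tail_int by (rule density_conv_integral)
  case 2 show ?case unfolding eq using density_conv_integral(2)[OF Suc(1) tail_int] Suc(2) by (simp add: c_def)
qed

lemma T_bound: "1 \<le> R \<Longrightarrow> \<exists>M\<ge>0. \<forall>n x. T R n x \<le> M * c R ^ n"
proof -
  assume R: "1 \<le> R"
  then obtain Cp Bp where "light_density (T R 0) Cp Bp" using T_light by blast
  then interpret light_density "T R 0" Cp Bp .
  have Bp: "0 \<le> Bp" using order_trans[OF p_nonneg p_bounded] .
  have "T R n x \<le> Bp * c R ^ n" for n x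
  proof (induction n arbitrary: x)
    case 0 show ?case using p_bounded by simp
  next
    case (Suc n)
    have "T R (Suc n) x \<le> (LINT y|lborel. Bp * c R ^ n * tail R y)"
      unfolding Suc_T[OF R] density_conv_def
      by (rule integral_mono') (use Suc Bp c_nonneg tail_nonneg tail_int in \<open>auto intro!: mult_right_mono\<close>)
    then show ?case by (simp add: c_def mult_ac)
  qed
  with Bp show ?thesis by blast
qed

lemma term_le: "1 \<le> R \<Longrightarrow> T R n x / fact n \<le> exp (c R) * f x"
  using sum_le_sums[OF sums_T[of R x], of "{n}"] T_nonneg by simp

text \<open>The part of \<open>f\<close> carried by the event that at least one jump exceeds
  \<open>R\<close>.\<close>

definition D :: "real \<Rightarrow> real \<Rightarrow> real" where "D R x = f x - exp (- c R) * T R 0 x"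

lemma D_meas [measurable]: "D R \<in> borel_measurable borel"
  unfolding D_def[abs_def] by measurable

lemma D_props:
  assumes R: "1 \<le> R"
  shows "0 \<le> D R x" "D R x \<le> f x" "integrable lborel (D R)" "(LINT x|lborel. D R x) = 1 - exp (- c R)"
proof -
  have "exp (- c R) * T R 0 x \<le> exp (- c R) * (exp (c R) * f x)"
    using term_le[OF R, of 0 x] by (intro mult_left_mono) auto
  then show "0 \<le> D R x" by (simp add: D_def mult.assoc[symmetric] exp_add[symmetric])
  show "D R x \<le> f x" using T_nonneg[OF R] by (simp add: D_def)
  show "integrable lborel (D R)" "(LINT x|lborel. D R x) = 1 - exp (- c R)"
    using T_int[OF R, of 0] f_int f_one by (simp_all add: D_def[abs_def])
qed

text \<open>Where at least two large jumps occur, one of them is split off: replacing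
  \<open>fact (n + 2)\<close> by the smaller \<open>fact (n + 1)\<close> bounds the series from the
  second term on by the convolution with \<open>tail R\<close> of the series from the first term on.
  This self-referential inequality stands in for termwise bounds on high convolution powers.\<close>

lemma D_le:
  assumes R: "1 \<le> R"
  shows "D R x \<le> exp (- c R) * T R 1 x + density_conv (D R) (tail R) x"
proof -
  let ?E = "exp (c R)"
  have e1: "?E * D R y = ?E * f y - T R 0 y" for y
    by (simp add: D_def right_diff_distrib mult.assoc[symmetric] exp_add[symmetric])
  have s1: "(\<lambda>n. T R (Suc n) y / fact (Suc n)) sums (?E * D R y)" for y
    using sums_T[OF R, of y] sums_Suc_iff[of "\<lambda>n. T R n y / fact n" "?E * D R y"] by (simp add: e1)
  have s2: "(\<lambda>n. T R (n + 2) x / fact (n + 2)) sums (?E * D R x - T R 1 x)"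
    using s1[of x] sums_Suc_iff[of "\<lambda>n. T R (Suc n) x / fact (Suc n)" "?E * D R x - T R 1 x"] by simp
  have iT: "integrable lborel (\<lambda>y. T R (Suc n) (x - y) * tail R y)" for n
  proof -
    obtain M where "\<And>n x. T R n x \<le> M * c R ^ n" using T_bound[OF R] by blast
    then have "\<bar>T R (Suc n) y\<bar> \<le> M * c R ^ Suc n" for y
      using T_nonneg[OF R, of "Suc n" y] by (simp only: abs_of_nonneg)
    from integrable_conv[OF T_meas this tail_int] show ?thesis .
  qed
  have iD: "integrable lborel (\<lambda>y. D R (x - y) * tail R y)"
  proof (rule integrable_conv[OF D_meas _ tail_int])
    show "\<bar>D R y\<bar> \<le> Bf" for y using D_props(1,2)[OF R, of y] f_bounded[of y] by simp
  qed
  \<comment> \<open>Finite partial sums keep the interchange with the integral elementary; the bound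
    is uniform in \<open>N\<close>.\<close>
  have "(\<Sum>n<N. T R (n + 2) x / fact (n + 2)) \<le> ?E * density_conv (D R) (tail R) x" for N
  proof -
    have "(\<Sum>n<N. T R (n + 2) x / fact (n + 2)) \<le> (\<Sum>n<N. T R (Suc (Suc n)) x / fact (Suc n))"
    proof (rule sum_mono)
      fix n
      have "fact (Suc n) \<le> (fact (n + 2) :: real)" by (rule fact_mono) simp
      then show "T R (n + 2) x / fact (n + 2) \<le> T R (Suc (Suc n)) x / fact (Suc n)"
        using T_nonneg[OF R, of "Suc (Suc n)" x] by (simp add: divide_left_mono del: fact_Suc)
    qed
    also have "\<dots> = (\<Sum>n<N. LINT y|lborel. T R (Suc n) (x - y) * tail R y / fact (Suc n))"
      unfolding Suc_T[OF R, of "Suc n" for n] density_conv_def by simp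
    also have "\<dots> = (LINT y|lborel. (\<Sum>n<N. T R (Suc n) (x - y) * tail R y / fact (Suc n)))"
      using iT by (subst Bochner_Integration.integral_sum) auto
    also have "\<dots> \<le> (LINT y|lborel. ?E * (D R (x - y) * tail R y))"
    proof (rule integral_mono)
      show "integrable lborel (\<lambda>y. \<Sum>n<N. T R (Suc n) (x - y) * tail R y / fact (Suc n))"
        using iT by (intro Bochner_Integration.integrable_sum) auto
      show "integrable lborel (\<lambda>y. ?E * (D R (x - y) * tail R y))" using iD by simp
      fix y
      have "(\<Sum>n<N. T R (Suc n) (x - y) / fact (Suc n)) \<le> ?E * D R (x - y)"
        by (rule sum_le_sums[OF s1]) (use T_nonneg[OF R] in auto)
      from mult_right_mono[OF this tail_nonneg[of R y]]
      show "(\<Sum>n<N. T R (Suc n) (x - y) * tail R y / fact (Suc n)) \<le> ?E * (D R (x - y) * tail R y)"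
        by (simp only: sum_distrib_right times_divide_eq_left mult.assoc)
    qed
    finally show ?thesis by (simp add: density_conv_def)
  qed
  then have "?E * D R x - T R 1 x \<le> ?E * density_conv (D R) (tail R) x"
    using s2 by (intro LIMSEQ_le_const2[OF s2[unfolded sums_def]]) auto
  then have "exp (- c R) * (?E * D R x) \<le> exp (- c R) * (T R 1 x + ?E * density_conv (D R) (tail R) x)"
    by (intro mult_left_mono) auto
  then show ?thesis by (simp add: distrib_left mult.assoc[symmetric] exp_add[symmetric])
qed

lemma f_le:
  assumes R: "1 \<le> R"
  shows "f x \<le> T R 0 x + T R 1 x + density_conv (D R) (tail R) x"
proof -
  have "f x = exp (- c R) * T R 0 x + D R x" by (simp add: D_def)
  also have "\<dots> \<le> exp (- c R) * T R 0 x + (exp (- c R) * T R 1 x + density_conv (D R) (tail R) x)"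
    using D_le[OF R] by simp
  also have "exp (- c R) * T R 0 x \<le> 1 * T R 0 x"
    using c_nonneg T_nonneg[OF R] by (intro mult_right_mono) auto
  also have "exp (- c R) * T R 1 x \<le> 1 * T R 1 x"
    using c_nonneg T_nonneg[OF R] by (intro mult_right_mono) auto
  finally show ?thesis by simp
qed


section \<open>From tightness of the jump density to the ratio limit\<close>

lemma c_small:
  assumes "0 < e" shows "\<exists>R\<ge>a. 1 \<le> R \<and> c R \<le> e \<and> exp (c R) \<le> 1 + e \<and> 1 - exp (- c R) \<le> e"
proof -
  have "((\<lambda>R. exp (c R)) \<longlongrightarrow> exp 0) at_top" by (intro tendsto_intros c_tendsto)
  then have "\<forall>\<^sub>F R in at_top. exp (c R) < 1 + e" by (rule order_tendstoD(2)) (use assms in simp)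
  moreover have "\<forall>\<^sub>F R in at_top. c R < e" using c_tendsto by (rule order_tendstoD(2)) (use assms in simp)
  ultimately have "\<forall>\<^sub>F R in at_top. c R < e \<and> exp (c R) < 1 + e \<and> max a 1 \<le> R"
    by (intro eventually_conj eventually_ge_at_top)
  then obtain R where R: "c R < e" "exp (c R) < 1 + e" "max a 1 \<le> R"
    using eventually_happens'[OF trivial_limit_at_top_linorder] by blast
  have "1 - exp (- c R) \<le> c R" using exp_ge_add_one_self[of "- c R"] by simp
  with R show ?thesis by (intro exI[of _ R]) auto
qed

lemma light_exp_le:
  assumes h: "long_tailed_ad h x0 K B" and R: "1 \<le> R" and d: "0 < d"
  shows "\<forall>\<^sub>F x in at_top. T R 0 x \<le> d * h x"
proof -
  interpret long_tailed_ad h x0 K B by fact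
  obtain Cp Bp where "light_density (T R 0) Cp Bp" using T_light R by blast
  then interpret light_density "T R 0" Cp Bp .
  have "((\<lambda>x. Cp * (exp (- x) / h x)) \<longlongrightarrow> Cp * 0) at_top"
    by (intro tendsto_mult_left exp_negligible)
  then have "\<forall>\<^sub>F x in at_top. Cp * (exp (- x) / h x) < d"
    by (rule order_tendstoD(2)) (use d in simp)
  then show ?thesis
    using ev_pos
  proof eventually_elim
    case (elim x)
    then have "Cp * exp (- x) < d * h x" by (simp add: divide_less_eq)
    with p_light[of x] show ?case by linarith
  qed
qed

text \<open>\<open>tail R\<close> agrees with \<open>g\<close> beyond \<open>R\<close>, and
  convolution with a light probability density preserves asymptotics, so the limit is 1 for every
  cutoff.\<close>

lemma T1_limit:
  assumes h: "long_tailed_ad g x0 K B" and R: "1 \<le> R"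
  shows "((\<lambda>x. T R 1 x / g x) \<longlongrightarrow> 1) at_top"
proof -
  interpret long_tailed_ad g x0 K B by fact
  obtain Cp Bp where "light_density (T R 0) Cp Bp" using T_light R by blast
  then interpret light_density "T R 0" Cp Bp .
  interpret light_conv g x0 K B "T R 0" Cp Bp ..
  have "((\<lambda>x. density_conv (T R 0) (tail R) x / g x) \<longlongrightarrow> 1) at_top"
  proof (rule conv_limit[where C=1])
    have "\<forall>\<^sub>F x in at_top. tail R x / g x = 1"
      using eventually_gt_at_top[of R] ev_pos by eventually_elim (simp add: tail_def)
    then show "((\<lambda>x. tail R x / g x) \<longlongrightarrow> 1) at_top" by (rule tendsto_eventually)
  qed (use tail_nonneg tail_int tail_le in auto)
  then show ?thesis using Suc_T[OF R, of 0] by simp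
qed

text \<open>Kesten's bound; thanks to the factorials in the Poisson weights any ratio \<open>\<theta>\<close> is good enough.\<close>

lemma T_geometric:
  assumes h: "long_tailed_ad g x0 K B" and tight: "tight_conv g"
  shows "\<exists>C\<ge>0. \<exists>\<theta>\<ge>0. \<forall>n. \<forall>x\<ge>x0. T 1 n x \<le> C * \<theta> ^ n * g x"
proof -
  interpret long_tailed_ad g x0 K B by fact
  have R: "(1::real) \<le> 1" by simp
  obtain M where M: "\<And>n x. T 1 n x \<le> M * c 1 ^ n" using T_bound[OF R] by blast
  have "\<forall>\<^sub>F x in at_top. T 1 0 x \<le> 1 * g x" by (rule light_exp_le[OF h R]) simp
  from bigo_extend[OF this, of "M * c 1 ^ 0"] M
  obtain C0 where C0: "C0 \<ge> 0" "\<And>x. x0 \<le> x \<Longrightarrow> T 1 0 x \<le> C0 * g x" by blast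
  have gg: "density_conv g g x \<le> B * (LINT y|lborel. g y)" for x
    unfolding density_conv_def integral_mult_right_zero[symmetric]
    by (rule integral_mono') (use bounded nonneg int order_trans[OF nonneg bounded] in \<open>auto intro!: mult_right_mono\<close>)
  have "\<forall>\<^sub>F x in at_top. density_conv g g x \<le>
      (2 * K * (1 * (LINT y|lborel. g y) + 1 * (LINT y|lborel. g y)) + 1) * g x"
    by (rule conv_mid_bound[OF tight]) (use nonneg int bounded in auto)
  from bigo_extend[OF this gg] obtain C1 where C1: "C1 \<ge> 0" "\<And>x. x0 \<le> x \<Longrightarrow> density_conv g g x \<le> C1 * g x"
    by blast
  \<comment> \<open>Where \<open>x - y < x0\<close> the induction hypothesis is silent about
    \<open>T 1 n (x - y)\<close>. There \<open>y > x - x0\<close>, so \<open>tail 1 y\<close> is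
    bounded by this supremum and \<open>T 1 n\<close> contributes only its mass.\<close>
  define G where "G x = (SUP y\<in>{x - x0..}. g y)" for x
  have bdd: "bdd_above (g ` S)" for S using bounded by (auto intro!: bdd_aboveI)
  have G: "g y \<le> G x" if "x - x0 \<le> y" for x y
    unfolding G_def by (rule cSUP_upper[OF _ bdd]) (use that in simp)
  have GB: "G x \<le> B" for x unfolding G_def by (rule cSUP_least) (auto simp: bounded)
  have "\<forall>\<^sub>F x in at_top. G x \<le> 2 * K * g x"
    using ev_left[of x0]
  proof eventually_elim
    case (elim x)
    have "g y \<le> 2 * K * g x" if "x - x0 \<le> y" for y
      using elim[rule_format, of "x - y"] that by simp
    then show ?case unfolding G_def by (intro cSUP_least) auto
  qed
  from bigo_extend[OF this GB] obtain C2 where C2: "C2 \<ge> 0" "\<And>x. x0 \<le> x \<Longrightarrow> G x \<le> C2 * g x"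
    by blast
  \<comment> \<open>\<open>C \<ge> 1\<close> and the summand \<open>c 1\<close> in
    \<open>\<theta>\<close> make \<open>c 1 ^ n \<le> C * \<theta> ^ n\<close>, while
    \<open>C1 + C2 \<le> \<theta>\<close> closes the induction step.\<close>
  define C where "C = max C0 1"
  define \<theta> where "\<theta> = C1 + C2 + c 1"
  have \<theta>: "0 \<le> \<theta>" "c 1 \<le> \<theta>" "C1 + C2 \<le> \<theta>" using C1 C2 c_nonneg by (auto simp: \<theta>_def)
  have C: "1 \<le> C" "C0 \<le> C" by (auto simp: C_def)
  have "T 1 n x \<le> C * \<theta> ^ n * g x" if "x0 \<le> x" for n x
    using that
  proof (induction n arbitrary: x)
    case 0
    have "C0 * g x \<le> C * g x" using C nonneg by (intro mult_right_mono)
    with C0(2)[OF 0] show ?case by simp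
  next
    case (Suc n)
    let ?R = "\<lambda>y. C * \<theta> ^ n * (g (x - y) * g y) + G x * T 1 n (x - y)"
    have Cn: "0 \<le> C * \<theta> ^ n" using C \<theta> by simp
    have G0: "0 \<le> G x" using G[of x x] x0 nonneg[of x] by simp
    have iT: "integrable lborel (\<lambda>y. T 1 n (x - y))" "(LINT y|lborel. T 1 n (x - y)) = c 1 ^ n"
      using integrable_reflect[OF T_int(1)[OF R]] T_int(2)[OF R] by simp_all
    have igg: "integrable lborel (\<lambda>y. g (x - y) * g y)"
      by (rule integrable_conv[OF meas abs_bounded int])
    have "T 1 (Suc n) x \<le> (LINT y|lborel. ?R y)"
      unfolding Suc_T[OF R] density_conv_def
    proof (rule integral_mono')
      show "integrable lborel ?R" using igg iT by simp
      fix y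
      have n: "0 \<le> C * \<theta> ^ n * (g (x - y) * g y)" "0 \<le> G x * T 1 n (x - y)"
        using Cn nonneg G0 T_nonneg[OF R] by simp_all
      then show "0 \<le> ?R y" by simp
      show "T 1 n (x - y) * tail 1 y \<le> ?R y"
      proof (cases "x0 \<le> x - y")
        case True
        have "T 1 n (x - y) * tail 1 y \<le> (C * \<theta> ^ n * g (x - y)) * g y"
          using Suc.IH[OF True] Cn nonneg tail_nonneg tail_le by (intro mult_mono) auto
        with n show ?thesis by (simp add: mult_ac)
      next
        case False
        have "tail 1 y \<le> G x" using tail_le[of 1 y] G[of x y] False by simp
        then have "T 1 n (x - y) * tail 1 y \<le> T 1 n (x - y) * G x"
          by (intro mult_left_mono T_nonneg R)
        with n show ?thesis by (simp add: mult_ac)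
      qed
    qed
    also have "\<dots> = C * \<theta> ^ n * density_conv g g x + G x * c 1 ^ n"
      using igg iT by (simp add: density_conv_def)
    also have "\<dots> \<le> C * \<theta> ^ n * (C1 * g x) + (C2 * g x) * (C * \<theta> ^ n)"
    proof (intro add_mono mult_left_mono mult_mono)
      have "c 1 ^ n \<le> \<theta> ^ n" using \<theta> c_nonneg by (intro power_mono) auto
      also have "\<dots> \<le> C * \<theta> ^ n" using C \<theta> mult_right_mono[of 1 C "\<theta> ^ n"] by simp
      finally show "c 1 ^ n \<le> C * \<theta> ^ n" .
    qed (use C1 C2 Suc.prems Cn c_nonneg nonneg in auto)
    also have "\<dots> = C * \<theta> ^ n * (C1 + C2) * g x" by (simp add: algebra_simps)
    also have "\<dots> \<le> C * \<theta> ^ n * \<theta> * g x"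
      using \<theta> Cn nonneg by (intro mult_right_mono mult_left_mono) auto
    finally show ?case by (simp add: mult_ac)
  qed
  then show ?thesis using C(1) \<theta>(1) by (intro exI[of _ C] conjI exI[of _ \<theta>]) auto
qed

text \<open>The geometric bounds summed against the Poisson weights give the factor
  \<open>exp \<theta>\<close>. The constant is obtained at cutoff 1 and hence does not depend on the
  cutoffs used afterwards.\<close>

lemma f_bigo:
  assumes h: "long_tailed_ad g x0 K B" and tight: "tight_conv g"
  shows "\<exists>C\<ge>0. \<forall>x\<ge>x0. f x \<le> C * g x"
proof -
  obtain C \<theta> where C: "0 \<le> C" "0 \<le> \<theta>" "\<And>n x. x0 \<le> x \<Longrightarrow> T 1 n x \<le> C * \<theta> ^ n * g x"
    using T_geometric[OF assms] by blast
  have "f x \<le> C * exp \<theta> * g x" if "x0 \<le> x" for x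
  proof -
    have "(\<lambda>n. \<theta> ^ n /\<^sub>R fact n) sums exp \<theta>" by (rule exp_converges)
    then have s: "(\<lambda>n. (C * g x) * (\<theta> ^ n /\<^sub>R fact n)) sums (C * g x * exp \<theta>)" by (rule sums_mult)
    have "exp (c 1) * f x \<le> C * g x * exp \<theta>"
    proof (rule sums_le[OF _ sums_T s])
      show "T 1 n x / fact n \<le> (C * g x) * (\<theta> ^ n /\<^sub>R fact n)" for n
        using divide_right_mono[OF C(3)[OF that, of n], of "fact n"] by (simp add: field_simps)
    qed simp
    moreover have "1 * f x \<le> exp (c 1) * f x" using c_nonneg f_nonneg by (intro mult_right_mono) auto
    ultimately show ?thesis by (simp add: mult_ac)
  qed
  then show ?thesis using C by (intro exI[of _ "C * exp \<theta>"]) auto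
qed

text \<open>Since \<open>D R \<le> f \<le> C * g\<close> with \<open>C\<close> independent of
  \<open>R\<close>, the convolution of \<open>D R\<close> with \<open>tail R\<close> is at most a
  fixed constant times the masses \<open>c R\<close> and \<open>1 - exp (- c R)\<close>, plus an
  arbitrarily small error. From below, \<open>f\<close> is at least \<open>exp (- c R)\<close> times
  the single-jump term.\<close>

lemma ratio_limit_of_tight:
  assumes h: "long_tailed_ad g x0 K B" and tight: "tight_conv g"
  shows "((\<lambda>x. f x / g x) \<longlongrightarrow> 1) at_top"
proof (rule tendsto_at_topI_le)
  interpret long_tailed_ad g x0 K B by fact
  fix e :: real assume e: "0 < e"
  obtain C where C: "0 \<le> C" "\<And>x. x0 \<le> x \<Longrightarrow> f x \<le> C * g x" using f_bigo[OF assms] by blast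
  \<comment> \<open>\<open>q\<close> collects the constants of the convolution bound, so that masses
    of at most \<open>d\<close> contribute at most \<open>e / 4\<close>. The upper budget is
    \<open>e / 4\<close> for the light term, \<open>e / 4\<close> for the single-jump term and
    \<open>e / 2\<close> for the convolution.\<close>
  define q where "q = K * (C + 1)"
  have q: "1 \<le> q" unfolding q_def using K C mult_mono[of 1 K 1 "C + 1"] by simp
  define d where "d = min 1 e / (8 * q)"
  have d: "0 < d" using q e by (simp add: d_def)
  have d': "2 * K * (C * d + d) \<le> e / 4" "d \<le> e / 4"
  proof -
    have "2 * K * (C * d + d) = 2 * (q * d)" by (simp add: q_def algebra_simps)
    also have "\<dots> = min 1 e / 4" using q by (simp add: d_def)
    also have "\<dots> \<le> e / 4" by simp
    finally show "2 * K * (C * d + d) \<le> e / 4" .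
    have "1 * d \<le> q * d" using q d by (intro mult_right_mono) auto
    moreover have "q * d \<le> min 1 e / 8" using q by (simp add: d_def)
    ultimately show "d \<le> e / 4" using e by simp
  qed
  obtain R where R: "1 \<le> R" "c R \<le> d" "1 - exp (- c R) \<le> d" using c_small[OF d] by blast
  note D = D_props[OF R(1)]
  have Dk: "\<forall>\<^sub>F x in at_top. density_conv (D R) (tail R) x \<le>
    (2 * K * (C * (LINT y|lborel. tail R y) + 1 * (LINT y|lborel. D R y)) + e / 4) * g x"
  proof (rule conv_mid_bound[OF tight])
    show "D R x \<le> C * g x" if "x0 \<le> x" for x using D(2)[of x] C(2)[OF that] by simp
    show "D R x \<le> Bf" for x using D(2)[of x] f_bounded[of x] by simp
  qed (use D tail_nonneg tail_int tail_le C e in auto)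
  have T0: "\<forall>\<^sub>F x in at_top. T R 0 x \<le> e / 4 * g x" by (rule light_exp_le[OF h R(1)]) (use e in simp)
  have T1: "\<forall>\<^sub>F x in at_top. \<bar>T R 1 x / g x - 1\<bar> < e / 4"
    using tendstoD[OF T1_limit[OF h R(1)], of "e / 4"] e by (simp add: dist_real_def)
  show "\<forall>\<^sub>F x in at_top. \<bar>f x / g x - 1\<bar> \<le> e"
    using Dk T0 T1 ev_pos
  proof eventually_elim
    case (elim x)
    have gx: "0 < g x" using elim by simp
    have "2 * K * (C * (LINT y|lborel. tail R y) + 1 * (LINT y|lborel. D R y)) \<le> 2 * K * (C * d + d)"
      using R D(4) C(1) K by (intro mult_left_mono add_mono) (auto simp: c_def[symmetric])
    also have "\<dots> \<le> e / 4" by (rule d')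
    finally have "(2 * K * (C * (LINT y|lborel. tail R y) + 1 * (LINT y|lborel. D R y)) + e / 4) * g x
        \<le> (e / 4 + e / 4) * g x" using gx by (intro mult_right_mono) auto
    with elim have Dk': "density_conv (D R) (tail R) x \<le> (e / 4 + e / 4) * g x" by linarith
    have u1: "T R 1 x \<le> (1 + e / 4) * g x"
    proof -
      have "T R 1 x / g x \<le> 1 + e / 4" using elim by linarith
      then show ?thesis using gx by (simp add: divide_le_eq)
    qed
    have l1: "(1 - e / 4) * g x \<le> T R 1 x"
    proof -
      have "1 - e / 4 \<le> T R 1 x / g x" using elim by linarith
      then show ?thesis using gx by (simp add: le_divide_eq)
    qed
    have "f x \<le> e / 4 * g x + (1 + e / 4) * g x + (e / 4 + e / 4) * g x"
      using f_le[OF R(1), of x] elim u1 Dk' by linarith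
    also have "\<dots> = (1 + e) * g x" by (simp add: algebra_simps)
    finally have up: "f x / g x \<le> 1 + e" using gx by (simp add: divide_le_eq)
    have "T R 1 x \<le> exp (c R) * f x" using term_le[OF R(1), of 1 x] by simp
    then have "exp (- c R) * T R 1 x \<le> exp (- c R) * (exp (c R) * f x)" by (intro mult_left_mono) auto
    then have ft: "exp (- c R) * T R 1 x \<le> f x" by (simp add: mult.assoc[symmetric] exp_add[symmetric])
    have "T R 1 x - exp (- c R) * T R 1 x = (1 - exp (- c R)) * T R 1 x" by (simp add: algebra_simps)
    \<comment> \<open>The minimum with 1 keeps this product below \<open>e / 2 * g x\<close> also
      for large \<open>e\<close>.\<close>
    also have "\<dots> \<le> min 1 (e / 4) * ((1 + e / 4) * g x)"
    proof (intro mult_mono u1)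
      show "1 - exp (- c R) \<le> min 1 (e / 4)" using R(3) d'(2) by simp
    qed (use T_nonneg[OF R(1)] e in auto)
    also have "\<dots> \<le> (e / 2) * g x"
    proof -
      have "min 1 (e / 4) * (1 + e / 4) \<le> e / 2"
      proof (cases "e \<le> 4")
        case True
        have "min 1 (e / 4) * (1 + e / 4) \<le> (e / 4) * 2" using True e by (intro mult_mono) auto
        then show ?thesis by simp
      next
        case False
        then show ?thesis by (simp add: min_def)
      qed
      from mult_right_mono[OF this less_imp_le[OF gx]] show ?thesis by (simp only: mult.assoc)
    qed
    finally have "(1 - e / 4) * g x - e / 2 * g x \<le> f x" using ft l1 by linarith
    moreover have "(1 - e) * g x \<le> (1 - e / 4) * g x - e / 2 * g x"
      using gx e by (simp add: algebra_simps)
    ultimately have "(1 - e) * g x \<le> f x" by linarith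
    then have lo: "1 - e \<le> f x / g x" using gx by (simp add: le_divide_eq)
    show ?case using up lo by linarith
  qed
qed


text \<open>For every \<open>R \<ge> 1\<close> one has
  \<open>T R 0 u \<le> exp (c R) * f u \<le> exp (c 1) * f u\<close>, so the tails of
  \<open>f\<close> control those of all light factors at once, and the window can be fixed before
  the cutoff.\<close>

lemma mass_outside_uniform: "\<exists>b>0. \<forall>R\<ge>1. 1 / 2 \<le> (LINT u|lborel. indicator {-b..b} u * T R 0 u)"
proof -
  have "\<forall>\<^sub>F b in at_top. (LINT u|lborel. indicator (- {-b..b}) u * f u) < 1 / (2 * exp (c 1))"
    by (rule order_tendstoD(2)[OF integral_outside_tendsto[OF f_int]]) simp
  then have "\<forall>\<^sub>F b in at_top. (LINT u|lborel. indicator (- {-b..b}) u * f u) < 1 / (2 * exp (c 1)) \<and> 0 < b"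
    by (intro eventually_conj eventually_gt_at_top)
  then obtain b where b: "(LINT u|lborel. indicator (- {-b..b}) u * f u) < 1 / (2 * exp (c 1))" "0 < b"
    using eventually_happens'[OF trivial_limit_at_top_linorder] by blast
  have "1 / 2 \<le> (LINT u|lborel. indicator {-b..b} u * T R 0 u)" if R: "1 \<le> R" for R
  proof -
    have i: "integrable lborel (\<lambda>u. indicator S u * T R 0 u)" "integrable lborel (\<lambda>u. indicator S u * f u)"
      if "S \<in> sets borel" for S
      using integrable_mult_indicator[OF _ T_int(1)[OF R, of 0], of S] integrable_mult_indicator[OF _ f_int, of S] that
      by simp_all
    have 1: "1 = (LINT u|lborel. indicator {-b..b} u * T R 0 u) + (LINT u|lborel. indicator (- {-b..b}) u * T R 0 u)"
      using integral_indicator_split[OF T_int(1)[OF R, of 0], of "{-b..b}"] T_int(2)[OF R, of 0] by simp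
    have "(LINT u|lborel. indicator (- {-b..b}) u * T R 0 u) \<le> (LINT u|lborel. exp (c 1) * (indicator (- {-b..b}) u * f u))"
    proof (rule integral_mono)
      fix u
      have "T R 0 u \<le> exp (c R) * f u" using term_le[OF R, of 0 u] by simp
      also have "\<dots> \<le> exp (c 1) * f u" using c_antimono[OF R] f_nonneg by (intro mult_right_mono) auto
      finally show "indicator (- {-b..b}) u * T R 0 u \<le> exp (c 1) * (indicator (- {-b..b}) u * f u)"
        by (simp add: indicator_def)
    qed (use i[of "- {-b..b}"] in auto)
    also have "\<dots> = exp (c 1) * (LINT u|lborel. indicator (- {-b..b}) u * f u)" by simp
    also have "\<dots> \<le> exp (c 1) * (1 / (2 * exp (c 1)))" using b by (intro mult_left_mono) auto
    also have "\<dots> = 1 / 2" by simp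
    finally show ?thesis using 1 by simp
  qed
  with b(2) show ?thesis by blast
qed

section \<open>Lower bounds for the single-jump term, and the converse implications\<close>

lemma T1_eq: "1 \<le> R \<Longrightarrow> T R 1 x = (LINT u|lborel. T R 0 u * tail R (x - u))"
  using Suc_T[of R 0 x] density_conv_commute[of "T R 0" "tail R" x]
  by (simp add: density_conv_def mult.commute)

lemma T1_integrable:
  assumes R: "1 \<le> R" shows "integrable lborel (\<lambda>u. T R 0 u * tail R (x - u))"
proof -
  have "\<bar>tail R y\<bar> \<le> Bg" for y using tail_nonneg[of R y] tail_le[of R y] g_bounded[of y] by simp
  from integrable_conv[OF tail_meas this T_int(1)[OF R, of 0], of x] show ?thesis
    by (simp add: mult.commute)
qed

lemma T1_lower:
  assumes R: "1 \<le> R" and m: "0 \<le> m" "\<And>u. \<bar>u\<bar> \<le> b \<Longrightarrow> m \<le> tail R (x - u)"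
  shows "m * (LINT u|lborel. indicator {-b..b} u * T R 0 u) \<le> T R 1 x"
proof -
  have "(LINT u|lborel. m * (indicator {-b..b} u * T R 0 u)) \<le> (LINT u|lborel. T R 0 u * tail R (x - u))"
  proof (rule integral_mono)
    show "integrable lborel (\<lambda>u. m * (indicator {-b..b} u * T R 0 u))"
      using integrable_mult_indicator[OF _ T_int(1)[OF R, of 0], of "{-b..b}"] by simp
    show "m * (indicator {-b..b} u * T R 0 u) \<le> T R 0 u * tail R (x - u)" for u
    proof (cases "\<bar>u\<bar> \<le> b")
      case True
      from mult_left_mono[OF m(2)[OF True] T_nonneg[OF R, of 0 u]] True show ?thesis
        by (simp add: indicator_def mult.commute abs_le_iff)
    next
      case False
      then show ?thesis using T_nonneg[OF R] tail_nonneg by (auto simp: indicator_def abs_le_iff)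
    qed
  qed (rule T1_integrable[OF R])
  then show ?thesis unfolding T1_eq[OF R] by simp
qed

text \<open>The terms for one and for two large jumps together stay below
  \<open>exp (c R) * f\<close>. The single-jump term alone accounts for \<open>g x\<close> up to a
  factor \<open>1 - d\<close>, so the two-jump term is at most a multiple of \<open>d * g x\<close>;
  on the other hand it dominates a fixed fraction \<open>\<kappa>\<close> of the middle
  part.\<close>

lemma tight_of_ratio_limit:
  assumes h: "long_tailed_ad g x0 K B" and lim: "((\<lambda>x. f x / g x) \<longlongrightarrow> 1) at_top"
  shows "tight_conv g"
  unfolding tight_conv_def
proof (intro allI impI)
  interpret long_tailed_ad g x0 K B by fact
  fix e :: real assume e: "0 < e"
  obtain b where b: "0 < b" "\<And>R. 1 \<le> R \<Longrightarrow> 1 / 2 \<le> (LINT u|lborel. indicator {-b..b} u * T R 0 u)"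
    using mass_outside_uniform by blast
  \<comment> \<open>One factor 1/2 is the mass in the window, another the loss from
    \<open>g v\<close> to \<open>g (v + b)\<close>, and \<open>1 / K\<close> compares
    \<open>g (v + b)\<close> with the values in the window.\<close>
  define \<kappa> where "\<kappa> = 1 / (4 * K)"
  have \<kappa>: "0 < \<kappa>" using K by (simp add: \<kappa>_def)
  \<comment> \<open>\<open>8 * d\<close> is twice the gap between \<open>1 + 3 * d\<close>, which
    bounds \<open>exp (c R) * f x / g x\<close>, and \<open>1 - d\<close>, a lower bound for the
    single-jump ratio.\<close>
  define d where "d = min 1 (\<kappa> * e / 8)"
  have d: "0 < d" "d \<le> 1" "8 * d \<le> \<kappa> * e" using \<kappa> e by (auto simp: d_def)
  have "\<forall>\<^sub>F x in at_top. (1 / 2) * g x \<le> g (x + b)" by (rule ev_shift_ge) simp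
  then obtain v0 where v0: "\<And>v. v0 \<le> v \<Longrightarrow> (1 / 2) * g v \<le> g (v + b)"
    by (auto simp: eventually_at_top_linorder)
  obtain R where R: "max x0 v0 \<le> R" "1 \<le> R" "exp (c R) \<le> 1 + d" using c_small[OF d(1)] by blast
  \<comment> \<open>For \<open>v \<ge> A\<close> the whole window around \<open>v\<close> lies
    beyond \<open>R\<close>, where \<open>tail R\<close> coincides with \<open>g\<close>.\<close>
  define A where "A = R + b + 1"
  have T1_ge: "\<kappa> * g v \<le> T R 1 v" if v: "A \<le> v" for v
  proof -
    have "g (v + b) / K * (1 / 2) \<le> g (v + b) / K * (LINT u|lborel. indicator {-b..b} u * T R 0 u)"
      using b(2)[OF R(2)] K nonneg by (intro mult_left_mono) auto
    also have "\<dots> \<le> T R 1 v"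
    proof (rule T1_lower[OF R(2)])
      show "0 \<le> g (v + b) / K" using K nonneg by simp
      fix u :: real assume u: "\<bar>u\<bar> \<le> b"
      have "g (v + b) \<le> K * g (v - u)"
        by (rule lower_bound_upto) (use u v R in \<open>auto simp: A_def abs_le_iff\<close>)
      moreover have "tail R (v - u) = g (v - u)" using u v by (simp add: tail_def A_def abs_le_iff)
      ultimately show "g (v + b) / K \<le> tail R (v - u)" using K by (simp add: divide_le_eq mult.commute)
    qed
    finally have 1: "g (v + b) / K * (1 / 2) \<le> T R 1 v" .
    have "(1 / 2) * g v \<le> g (v + b)" using v b R by (intro v0) (simp add: A_def)
    then have "\<kappa> * g v \<le> g (v + b) / K * (1 / 2)" using K by (simp add: \<kappa>_def field_simps)
    with 1 show ?thesis by linarith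
  qed
  have T2_ge: "\<kappa> * middle_conv g A x \<le> T R 2 x" for x
  proof -
    have "(LINT y|lborel. \<kappa> * (indicator {A..x - A} y * (g (x - y) * g y))) \<le> (LINT y|lborel. T R 1 (x - y) * tail R y)"
    proof (rule integral_mono)
      show "integrable lborel (\<lambda>y. \<kappa> * (indicator {A..x - A} y * (g (x - y) * g y)))"
        using middle_integrable by simp
      obtain M where M: "\<And>n x. T R n x \<le> M * c R ^ n" using T_bound[OF R(2)] by blast
      have "\<bar>T R 1 y\<bar> \<le> M * c R ^ 1" for y using M[of 1 y] T_nonneg[OF R(2), of 1 y] by (simp only: abs_of_nonneg)
      from integrable_conv[OF T_meas this tail_int] show "integrable lborel (\<lambda>y. T R 1 (x - y) * tail R y)" .
      fix y
      show "\<kappa> * (indicator {A..x - A} y * (g (x - y) * g y)) \<le> T R 1 (x - y) * tail R y"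
      proof (cases "y \<in> {A..x - A}")
        case True
        have "\<kappa> * g (x - y) \<le> T R 1 (x - y)" using True by (intro T1_ge) simp
        from mult_right_mono[OF this g_nonneg[of y]] True show ?thesis
          using b R by (simp add: tail_def A_def mult.assoc)
      next
        case False
        then show ?thesis using T_nonneg[OF R(2)] tail_nonneg by simp
      qed
    qed
    then show ?thesis
      using Suc_T[OF R(2), of 1 x] by (simp add: middle_conv_def density_conv_def numeral_2_eq_2)
  qed
  have lim1: "\<forall>\<^sub>F x in at_top. f x / g x < 1 + d"
    using lim by (rule order_tendstoD(2)) (use d in simp)
  have lim2: "\<forall>\<^sub>F x in at_top. 1 - d < T R 1 x / g x"
    using T1_limit[OF h R(2)] by (rule order_tendstoD(1)) (use d in simp)
  have "\<forall>\<^sub>F x in at_top. middle_conv g A x \<le> e * g x"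
    using lim1 lim2 ev_pos
  proof eventually_elim
    case (elim x)
    have gx: "0 < g x" using elim by simp
    have 1: "f x \<le> (1 + d) * g x" using elim by (simp add: divide_less_eq)
    have 2: "(1 - d) * g x \<le> T R 1 x" using elim by (simp add: less_divide_eq)
    have "sum (\<lambda>n. T R n x / fact n) {1, 2} \<le> exp (c R) * f x"
      by (rule sum_le_sums[OF sums_T[OF R(2)]]) (use T_nonneg[OF R(2)] in auto)
    then have 3: "T R 1 x + T R 2 x / 2 \<le> exp (c R) * f x" by (simp add: numeral_2_eq_2)
    have "exp (c R) * f x \<le> (1 + d) * ((1 + d) * g x)"
      using R(3) 1 d f_nonneg by (intro mult_mono) auto
    also have "\<dots> = (1 + 2 * d + d * d) * g x" by (simp add: algebra_simps)
    also have "\<dots> \<le> (1 + 3 * d) * g x"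
      using d mult_left_mono[of d 1 d] gx by (intro mult_right_mono) auto
    finally have 4: "exp (c R) * f x \<le> (1 + 3 * d) * g x" .
    have "t2 \<le> 2 * (r - q)" if "s \<le> r" "q \<le> t1" "t1 + t2 / 2 \<le> s" for s r q t1 t2 :: real
      using that by (simp add: field_simps)
    from this[OF 4 2 3] have "T R 2 x \<le> 2 * ((1 + 3 * d) * g x - (1 - d) * g x)" .
    also have "\<dots> = 8 * d * g x" by (simp add: algebra_simps)
    also have "\<dots> \<le> \<kappa> * e * g x" using d gx by (intro mult_right_mono) auto
    finally have "\<kappa> * middle_conv g A x \<le> \<kappa> * (e * g x)" using T2_ge[of x] by (simp add: mult.assoc)
    then show ?case using \<kappa> by simp
  qed
  then show "\<exists>A>0. \<forall>\<^sub>F x in at_top. middle_conv g A x \<le> e * g x"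
    using b R by (intro exI[of _ A]) (auto simp: A_def)
qed

text \<open>Only \<open>f\<close> is known to be long-tailed, so shifts of \<open>g\<close> give
  nothing by themselves. By \<open>sup\<close> and \<open>inf\<close> an average of \<open>g\<close>
  over a window is nearly at least its value at the right end and nearly at most its value at the
  left end; the width of the window is then absorbed as a shift of \<open>f\<close>.\<close>

lemma ratio_limit_of_density_tight:
  assumes h: "long_tailed_ad f x0 K B" and tight: "tight_conv f"
    and sup: "\<And>e. 0 < e \<Longrightarrow> \<forall>\<^sub>F x in at_top. \<forall>t\<ge>x. g t \<le> (1 + e) * g x"
    and inf: "\<And>e. 0 < e \<Longrightarrow> \<forall>\<^sub>F x in at_top. \<forall>t\<in>{a..x}. (1 - e) * g x \<le> g t"
  shows "((\<lambda>x. g x / f x) \<longlongrightarrow> 1) at_top"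
proof -
  interpret long_tailed_ad f x0 K B by fact
  have up: "\<forall>\<^sub>F x in at_top. g x \<le> exp (c R) * (1 + d) / (1 - d)\<^sup>2 * f x"
    if R: "1 \<le> R" and d: "0 < d" "d < 1" for R d
  proof -
    obtain Cp Bp where "light_density (T R 0) Cp Bp" using T_light R by blast
    then interpret light_density "T R 0" Cp Bp .
    obtain b0 where b0: "0 < b0" "\<And>b. b0 \<le> b \<Longrightarrow> (LINT u|lborel. indicator (- {-b..b}) u * weight u) \<le> d"
      using mass_outside[OF d(1)] by blast
    define b where "b = b0"
    have i: "integrable lborel (\<lambda>u. indicator S u * T R 0 u)" "integrable lborel (\<lambda>u. indicator S u * weight u)" if "S \<in> sets borel" for S
      using integrable_mult_indicator[OF _ p_int, of S] integrable_mult_indicator[OF _ weight_int, of S] that by simp_all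
    have "(LINT u|lborel. T R 0 u) = (LINT u|lborel. indicator {-b..b} u * T R 0 u) + (LINT u|lborel. indicator (- {-b..b}) u * T R 0 u)"
      by (rule integral_indicator_split[OF p_int]) simp
    also have "(LINT u|lborel. indicator (- {-b..b}) u * T R 0 u) \<le> (LINT u|lborel. indicator (- {-b..b}) u * weight u)"
    proof (rule integral_mono)
      fix u
      have "T R 0 u * 1 \<le> weight u" unfolding weight_def by (intro mult_left_mono p_nonneg) simp
      then show "indicator (- {-b..b}) u * T R 0 u \<le> indicator (- {-b..b}) u * weight u" by (simp add: indicator_def)
    qed (use i[of "- {-b..b}"] in auto)
    also have "\<dots> \<le> d" using b0 by (simp add: b_def)
    finally have mass: "1 - d \<le> (LINT u|lborel. indicator {-b..b} u * T R 0 u)" using p_one by simp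
    obtain z where z: "\<And>x. z \<le> x \<Longrightarrow> \<forall>t\<in>{a..x}. (1 - d) * g x \<le> g t"
      using inf[OF d(1)] by (auto simp: eventually_at_top_linorder)
    have "\<forall>\<^sub>F x in at_top. f (x + - b) \<le> (1 + d) * f x" by (rule ev_shift_le) (use d in simp)
    then show ?thesis
      using eventually_ge_at_top[of z] eventually_ge_at_top[of "max a R + 2 * b + 1"]
    proof eventually_elim
      case (elim x)
      have "(1 - d) * g x * (1 - d) \<le> (1 - d) * g x * (LINT u|lborel. indicator {-b..b} u * T R 0 u)"
        using d g_nonneg mass by (intro mult_left_mono) auto
      \<comment> \<open>At the point \<open>x - b\<close> the window contains only arguments
        \<open>x - b - u \<le> x\<close>, to which the lower comparison with \<open>g x\<close>
        applies.\<close>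
      also have "\<dots> \<le> T R 1 (x - b)"
      proof (rule T1_lower[OF R])
        show "0 \<le> (1 - d) * g x" using d g_nonneg by simp
        fix u :: real assume u: "\<bar>u\<bar> \<le> b"
        have "(1 - d) * g x \<le> g (x - b - u)"
          using z[OF elim(2)] u elim(3) by (auto simp: abs_le_iff)
        also have "g (x - b - u) = tail R (x - b - u)"
        proof -
          have "R < x - b - u" using u elim(3) max.cobounded2[of R a] by linarith
          then show ?thesis by (simp add: tail_def)
        qed
        finally show "(1 - d) * g x \<le> tail R (x - b - u)" .
      qed
      also have "\<dots> \<le> exp (c R) * f (x - b)" using term_le[OF R, of 1 "x - b"] by simp
      also have "\<dots> \<le> exp (c R) * ((1 + d) * f x)" using elim(1) by (intro mult_left_mono) auto
      finally have "(1 - d)\<^sup>2 * g x \<le> exp (c R) * (1 + d) * f x" by (simp add: power2_eq_square mult_ac)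
      moreover have "0 < (1 - d)\<^sup>2" using d by simp
      ultimately show ?case by (simp add: pos_le_divide_eq mult_ac)
    qed
  qed
  have up1: "\<forall>\<^sub>F x in at_top. g x \<le> (1 + e) * f x" if e: "0 < e" for e
  proof -
    have "((\<lambda>d. (1 + d) * (1 + d) / (1 - d)\<^sup>2) \<longlongrightarrow> (1 + 0) * (1 + 0) / (1 - 0)\<^sup>2) (at_right (0::real))"
      by (intro tendsto_intros) auto
    then have "\<forall>\<^sub>F d in at_right 0. (1 + d) * (1 + d) / (1 - d)\<^sup>2 < 1 + e"
      by (rule order_tendstoD(2)) (use e in simp)
    moreover have "\<forall>\<^sub>F d in at_right (0::real). d \<in> {0<..<1}" by (rule eventually_at_right_real) simp
    ultimately have "\<forall>\<^sub>F d in at_right 0. (1 + d) * (1 + d) / (1 - d)\<^sup>2 < 1 + e \<and> d \<in> {0<..<1}"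
      by (rule eventually_conj)
    then obtain d where d: "(1 + d) * (1 + d) / (1 - d)\<^sup>2 < 1 + e" "0 < d" "d < 1"
      using eventually_happens'[OF trivial_limit_at_right_real] by auto
    obtain R where R: "1 \<le> R" "exp (c R) \<le> 1 + d" using c_small[OF d(2)] by blast
    have "exp (c R) * (1 + d) / (1 - d)\<^sup>2 \<le> (1 + d) * (1 + d) / (1 - d)\<^sup>2"
      using R d by (intro divide_right_mono mult_right_mono) auto
    with d(1) have "exp (c R) * (1 + d) / (1 - d)\<^sup>2 \<le> 1 + e" by linarith
    from mult_right_mono[OF this f_nonneg]
    have le: "exp (c R) * (1 + d) / (1 - d)\<^sup>2 * f x \<le> (1 + e) * f x" for x .
    show ?thesis
      by (rule eventually_mono[OF up[OF R(1) d(2,3)]], rule order_trans[OF _ le])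
  qed
  \<comment> \<open>The upper half now supplies \<open>g = O(f)\<close>, the bound on
    \<open>tail R\<close> that the convolution estimates of the lower half require.\<close>
  from bigo_extend[OF up1[of 1] g_bounded] obtain C where C: "0 \<le> C" "\<And>x. x0 \<le> x \<Longrightarrow> g x \<le> C * f x"
    by auto
  have low: "\<forall>\<^sub>F x in at_top. (1 - e) * f x \<le> g x" if e: "0 < e" "e \<le> 1" for e
  proof -
    \<comment> \<open>The light term and the part outside the window cost \<open>d\<close> each, the
      convolution \<open>2 * d\<close>, and the shift a factor \<open>1 - d\<close>; with the factor
      \<open>1 + d\<close> on \<open>g\<close> the total loss stays within
      \<open>10 * d\<close>.\<close>
    define d where "d = e / 10"
    have d: "0 < d" "d \<le> 1 / 10" using e by (auto simp: d_def)
    define q where "q = 2 * K * (C + 1) + 1"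
    have q: "1 \<le> q" using K C by (simp add: q_def)
    have dq: "0 < d / q" "d / q \<le> d" using d q by (auto simp: divide_le_eq mult_le_cancel_left1)
    obtain R where R: "1 \<le> R" "c R \<le> d / q" "1 - exp (- c R) \<le> d / q" using c_small[OF dq(1)] by blast
    note D = D_props[OF R(1)]
    have Dk: "\<forall>\<^sub>F x in at_top. density_conv (D R) (tail R) x \<le>
      (2 * K * (1 * (LINT y|lborel. tail R y) + C * (LINT y|lborel. D R y)) + d) * f x"
    proof (rule conv_mid_bound[OF tight])
      show "D R x \<le> 1 * f x" for x using D(2)[of x] by simp
      show "tail R x \<le> C * f x" if "x0 \<le> x" for x using tail_le[of R x] C(2)[OF that] by simp
      show "D R x \<le> Bf" for x using D(2)[of x] f_bounded[of x] by simp
    qed (use D tail_nonneg tail_int C d in auto)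
    have Dk': "2 * K * (1 * (LINT y|lborel. tail R y) + C * (LINT y|lborel. D R y)) \<le> d"
    proof -
      have "2 * K * (1 * (LINT y|lborel. tail R y) + C * (LINT y|lborel. D R y)) \<le> 2 * K * (1 * (d / q) + C * (d / q))"
        using R D(4) C(1) K by (intro mult_left_mono add_mono) (auto simp: c_def[symmetric])
      also have "\<dots> = (q - 1) * (d / q)"
      proof -
        have "2 * K * (1 * r + C * r) = (q - 1) * r" for r by (simp add: q_def algebra_simps)
        then show ?thesis .
      qed
      also have "\<dots> \<le> q * (d / q)" using dq by (intro mult_right_mono) auto
      also have "\<dots> = d" using q by simp
      finally show ?thesis .
    qed
    obtain Cp Bp where "light_density (T R 0) Cp Bp" using T_light R by blast
    then interpret light_density "T R 0" Cp Bp .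
    interpret light_conv f x0 K B "T R 0" Cp Bp ..
    have tailC: "tail R x \<le> C * f x" if "x0 \<le> x" for x using tail_le[of R x] C(2)[OF that] by simp
    obtain b where b: "0 < b"
      "\<forall>\<^sub>F x in at_top. (LINT u|lborel. indicator (- {-b..b}) u * (T R 0 u * tail R (x - u))) \<le> d * f x"
      using conv_outside[OF tail_meas tail_nonneg tail_int tailC C(1) d(1)] by blast
    obtain z where z: "\<And>x. z \<le> x \<Longrightarrow> \<forall>t\<ge>x. g t \<le> (1 + d) * g x"
      using sup[OF d(1)] by (auto simp: eventually_at_top_linorder)
    have T0: "\<forall>\<^sub>F x in at_top. T R 0 x \<le> d * f x" by (rule light_exp_le[OF h R(1) d(1)])
    have sh: "\<forall>\<^sub>F x in at_top. (1 - d) * f (x - b) \<le> f x"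
    proof -
      have "\<forall>\<^sub>F x in at_top. (1 - d) * f x \<le> f (x + b)" by (rule ev_shift_ge) (use d in simp)
      then have "\<forall>\<^sub>F x in at_top. (1 - d) * f (x - b) \<le> f ((x - b) + b)"
        by (rule eventually_compose_filterlim) real_asymp
      then show ?thesis by simp
    qed
    \<comment> \<open>The upper comparison of \<open>g\<close> lands at the left end
      \<open>x - b\<close> of the window; the inequality is obtained there and afterwards translated
      by \<open>b\<close>.\<close>
    have "\<forall>\<^sub>F x in at_top. (1 - e) * f (x - b) \<le> g (x - b)"
      using Dk b(2) T0 sh ev_pos eventually_ge_at_top[of "z + b"]
    proof eventually_elim
      case (elim x)
      have inner: "(LINT u|lborel. indicator {-b..b} u * (T R 0 u * tail R (x - u))) \<le> (1 + d) * g (x - b)"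
      proof -
        have "(LINT u|lborel. indicator {-b..b} u * (T R 0 u * tail R (x - u))) \<le> (LINT u|lborel. (1 + d) * g (x - b) * T R 0 u)"
        proof (rule integral_mono')
          show "integrable lborel (\<lambda>u. (1 + d) * g (x - b) * T R 0 u)" using p_int by simp
          show n: "0 \<le> (1 + d) * g (x - b) * T R 0 u" for u using d g_nonneg p_nonneg by simp
          show "indicator {-b..b} u * (T R 0 u * tail R (x - u)) \<le> (1 + d) * g (x - b) * T R 0 u" for u
          proof (cases "u \<in> {-b..b}")
            case True
            have "tail R (x - u) \<le> g (x - u)" by (rule tail_le)
            also have "\<dots> \<le> (1 + d) * g (x - b)" using True elim by (intro z[rule_format]) auto
            finally have "T R 0 u * tail R (x - u) \<le> T R 0 u * ((1 + d) * g (x - b))"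
              by (intro mult_left_mono p_nonneg)
            then show ?thesis using True by (simp add: mult_ac)
          next
            case False
            then show ?thesis using n[of u] by simp
          qed
        qed
        then show ?thesis using p_one by simp
      qed
      have "T R 1 x = (LINT u|lborel. indicator {-b..b} u * (T R 0 u * tail R (x - u))) + (LINT u|lborel. indicator (- {-b..b}) u * (T R 0 u * tail R (x - u)))"
        unfolding T1_eq[OF R(1)] by (rule integral_indicator_split[OF T1_integrable[OF R(1)]]) simp
      also have "\<dots> \<le> (1 + d) * g (x - b) + d * f x" using inner elim by linarith
      finally have T1: "T R 1 x \<le> (1 + d) * g (x - b) + d * f x" .
      have "density_conv (D R) (tail R) x \<le> (d + d) * f x"
        using elim(1) Dk' mult_right_mono[of "2 * K * (1 * (LINT y|lborel. tail R y) + C * (LINT y|lborel. D R y)) + d" "d + d" "f x"] f_nonneg[of x]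
        by linarith
      then have "f x \<le> d * f x + ((1 + d) * g (x - b) + d * f x) + (d + d) * f x"
        using f_le[OF R(1), of x] elim(3) T1 by linarith
      then have 1: "(1 - 4 * d) * f x \<le> (1 + d) * g (x - b)" by (simp add: algebra_simps)
      have "(1 - 4 * d) * ((1 - d) * f (x - b)) \<le> (1 - 4 * d) * f x"
        using elim(4) d by (intro mult_left_mono) auto
      with 1 have 2: "(1 - 4 * d) * (1 - d) * f (x - b) \<le> (1 + d) * g (x - b)" by (simp add: mult.assoc)
      have "(1 + d) * (1 - e) \<le> (1 - 4 * d) * (1 - d)"
      proof -
        have "e = 10 * d" by (simp add: d_def)
        moreover have "0 \<le> d * d" by simp
        moreover have "(1 + d) * (1 - 10 * d) = 1 - 9 * d - 10 * (d * d)" "(1 - 4 * d) * (1 - d) = 1 - 5 * d + 4 * (d * d)"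
          by (simp_all add: algebra_simps)
        ultimately show ?thesis using d by simp
      qed
      from mult_right_mono[OF this f_nonneg[of "x - b"]] 2
      have "(1 + d) * ((1 - e) * f (x - b)) \<le> (1 + d) * g (x - b)" by (simp only: mult.assoc)
      then show ?case using d by simp
    qed
    then have "\<forall>\<^sub>F x in at_top. (1 - e) * f (x + b - b) \<le> g (x + b - b)"
      by (rule eventually_compose_filterlim) real_asymp
    then show ?thesis by simp
  qed
  show ?thesis
  proof (rule tendsto_at_topI_le)
    fix e :: real assume e: "0 < e"
    have "\<forall>\<^sub>F x in at_top. (1 - min e 1) * f x \<le> g x" by (rule low) (use e in auto)
    then show "\<forall>\<^sub>F x in at_top. \<bar>g x / f x - 1\<bar> \<le> e"
      using up1[OF e] ev_pos
    proof eventually_elim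
      case (elim x)
      have "g x / f x \<le> 1 + e" using elim by (simp add: divide_le_eq)
      moreover have "1 - min e 1 \<le> g x / f x" using elim by (simp add: le_divide_eq)
      ultimately show ?case by linarith
    qed
  qed
qed

end

section \<open>Inverse Fourier transforms\<close>

text \<open>The bound by \<open>w y\<close> uniform in \<open>z\<close> makes
  \<open>norm (\<phi> z) * w y\<close> an integrable majorant on the product. The second measure is
  a general sigma-finite Borel measure, which covers point masses and jump measures along with
  Lebesgue measure.\<close>

lemma Fubini_weighted:
  fixes \<phi> :: "real \<Rightarrow> complex" and w :: "real \<Rightarrow> real" and k :: "real \<Rightarrow> real \<Rightarrow> complex"
  assumes M: "sigma_finite_measure M" and [measurable_cong]: "sets M = sets borel"
    and \<phi>: "integrable lborel \<phi>" and w: "integrable M w"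
    and [measurable]: "(\<lambda>(z, y). k z y) \<in> borel_measurable (borel \<Otimes>\<^sub>M borel)"
    and bd: "\<And>z y. norm (k z y) \<le> w y"
  shows "(CLINT z|lborel. \<phi> z * (CLINT y|M. k z y)) = (CLINT y|M. CLINT z|lborel. \<phi> z * k z y)"
    and "integrable M (\<lambda>y. CLINT z|lborel. \<phi> z * k z y)"
proof -
  interpret M: sigma_finite_measure M by fact
  interpret P: pair_sigma_finite lborel M ..
  have [measurable]: "\<phi> \<in> borel_measurable borel" "w \<in> borel_measurable borel"
    using \<phi> w by (auto dest!: borel_measurable_integrable cong: measurable_cong_sets)
  have i1: "integrable (lborel \<Otimes>\<^sub>M M) (\<lambda>(z, y). norm (\<phi> z) * w y)"
  proof (rule P.Fubini_integrable)
    show "(\<lambda>(z, y). norm (\<phi> z) * w y) \<in> borel_measurable (lborel \<Otimes>\<^sub>M M)" by measurable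
    have "(\<integral>y. norm (case (z, y) of (z, y) \<Rightarrow> norm (\<phi> z) * w y) \<partial>M) = norm (\<phi> z) * (\<integral>y. \<bar>w y\<bar> \<partial>M)" for z
      by (simp add: abs_mult)
    then show "integrable lborel (\<lambda>z. \<integral>y. norm (case (z, y) of (z, y) \<Rightarrow> norm (\<phi> z) * w y) \<partial>M)"
      using \<phi> by simp
  qed (use w in auto)
  have i2: "integrable (lborel \<Otimes>\<^sub>M M) (\<lambda>(z, y). \<phi> z * k z y)"
  proof (rule integrable_boundI[OF i1])
    show "norm (case x of (z, y) \<Rightarrow> \<phi> z * k z y) \<le> (case x of (z, y) \<Rightarrow> norm (\<phi> z) * w y)" for x
      using bd by (cases x) (simp add: norm_mult mult_left_mono)
  qed simp
  show "(CLINT z|lborel. \<phi> z * (CLINT y|M. k z y)) = (CLINT y|M. CLINT z|lborel. \<phi> z * k z y)"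
    using P.Fubini_integral[OF i2] by simp
  show "integrable M (\<lambda>y. CLINT z|lborel. \<phi> z * k z y)"
    using P.integrable_snd[OF i2] .
qed

text \<open>Unnormalised: the factor \<open>1 / (2 * pi)\<close> is restored only when real
  densities are formed.\<close>

definition finv :: "(real \<Rightarrow> complex) \<Rightarrow> real \<Rightarrow> complex" where
  "finv \<phi> x = (CLINT z|lborel. \<phi> z * iexp (- (z * x)))"

lemma integrable_mult_iexp:
  fixes \<phi> :: "real \<Rightarrow> complex"
  assumes "integrable lborel \<phi>"
  shows "integrable lborel (\<lambda>z. \<phi> z * iexp (c * z))"
  by (rule Bochner_Integration.integrable_bound[OF assms])
    (use assms in \<open>auto simp: norm_mult intro!: borel_measurable_times borel_measurable_continuous_onI continuous_intros\<close>)

lemma integrable_mult_iexp':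
  fixes \<phi> :: "real \<Rightarrow> complex"
  assumes "integrable lborel \<phi>"
  shows "integrable lborel (\<lambda>z. \<phi> z * iexp (- (z * x)))"
  using integrable_mult_iexp[OF assms, of "- x"] by (simp add: mult.commute)

text \<open>Multiplication by the transform of \<open>w\<close> times \<open>M\<close> is
  convolution with that measure; the separate weight allows a tilting \<open>exp (s * y)\<close> of
  \<open>M\<close> without forming the tilted measure.\<close>

lemma finv_convolution:
  fixes \<phi> :: "real \<Rightarrow> complex" and w :: "real \<Rightarrow> real"
  assumes M: "sigma_finite_measure M" "sets M = sets borel"
    and \<phi>: "integrable lborel \<phi>" and w: "integrable M w"
  shows "finv (\<lambda>z. \<phi> z * (CLINT y|M. of_real (w y) * iexp (z * y))) x
      = (CLINT y|M. of_real (w y) * finv \<phi> (x - y))"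
    and "integrable M (\<lambda>y. of_real (w y) * finv \<phi> (x - y))"
proof -
  have [measurable_cong]: "sets M = sets borel" by fact
  have [measurable]: "w \<in> borel_measurable borel"
    using w by (auto dest!: borel_measurable_integrable cong: measurable_cong_sets)
  let ?k = "\<lambda>z y. complex_of_real (w y) * iexp (z * y)"
  have w': "integrable M (\<lambda>y. norm (w y))" using w by simp
  have m: "(\<lambda>(z, y). ?k z y) \<in> borel_measurable (borel \<Otimes>\<^sub>M borel)"
    by (measurable)
  note F = Fubini_weighted[OF M integrable_mult_iexp'[OF \<phi>, of x] w' m]
  have eq: "(CLINT z|lborel. \<phi> z * iexp (- (z * x)) * ?k z y) = of_real (w y) * finv \<phi> (x - y)" for y
  proof -
    have "\<phi> z * iexp (- (z * x)) * ?k z y = of_real (w y) * (\<phi> z * iexp (- (z * (x - y))))" for z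
      by (simp add: exp_add[symmetric] algebra_simps)
    then show ?thesis unfolding finv_def integral_mult_right_zero[symmetric]
      by (intro Bochner_Integration.integral_cong refl)
  qed
  show "finv (\<lambda>z. \<phi> z * (CLINT y|M. of_real (w y) * iexp (z * y))) x
      = (CLINT y|M. of_real (w y) * finv \<phi> (x - y))"
  proof -
    have "finv (\<lambda>z. \<phi> z * (CLINT y|M. of_real (w y) * iexp (z * y))) x
        = (CLINT z|lborel. \<phi> z * iexp (- (z * x)) * (CLINT y|M. ?k z y))"
      unfolding finv_def by (intro Bochner_Integration.integral_cong refl) (simp only: mult_ac)
    also have "\<dots> = (CLINT y|M. CLINT z|lborel. \<phi> z * iexp (- (z * x)) * ?k z y)"
      by (rule F(1)) (simp add: norm_mult)
    finally show ?thesis unfolding eq .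
  qed
  show "integrable M (\<lambda>y. of_real (w y) * finv \<phi> (x - y))"
    using F(2) unfolding eq by (simp add: norm_mult)
qed

lemma norm_finv_le:
  shows "norm (finv \<phi> x) \<le> (LINT z|lborel. norm (\<phi> z))"
  unfolding finv_def
  by (rule order_trans[OF integral_norm_bound]) (simp add: norm_mult)

lemma continuous_finv:
  assumes "integrable lborel \<phi>"
  shows "continuous_on UNIV (finv \<phi>)"
proof -
  have [measurable]: "\<phi> \<in> borel_measurable borel" using assms by auto
  have "isCont (finv \<phi>) x" for x
    unfolding continuous_at_sequentially comp_def finv_def
  proof safe
    fix X assume X: "X \<longlonglongrightarrow> x"
    show "(\<lambda>n. CLINT z|lborel. \<phi> z * iexp (- (z * X n))) \<longlonglongrightarrow> (CLINT z|lborel. \<phi> z * iexp (- (z * x)))"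
    proof (rule integral_dominated_convergence[where w="\<lambda>z. norm (\<phi> z)"])
      show "AE z in lborel. (\<lambda>n. \<phi> z * iexp (- (z * X n))) \<longlonglongrightarrow> \<phi> z * iexp (- (z * x))"
        using X by (intro always_eventually allI tendsto_intros) auto
    qed (use assms in \<open>auto simp: norm_mult\<close>)
  qed
  then show ?thesis by (simp add: continuous_at_imp_continuous_on)
qed

lemma finv_add:
  assumes "integrable lborel \<phi>" "integrable lborel \<psi>"
  shows "finv (\<lambda>z. \<phi> z + \<psi> z) x = finv \<phi> x + finv \<psi> x"
  unfolding finv_def using assms[THEN integrable_mult_iexp'] by (simp add: distrib_right)

lemma finv_scale: "finv (\<lambda>z. c * \<phi> z) x = c * finv \<phi> x"
  unfolding finv_def by (simp add: mult.assoc)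

lemma finv_tendsto:
  assumes [measurable]: "\<And>n. \<phi> n \<in> borel_measurable borel" "\<psi> \<in> borel_measurable borel"
    and w: "integrable lborel w" and "\<And>n z. norm (\<phi> n z) \<le> w z"
    and "\<And>z. (\<lambda>n. \<phi> n z) \<longlonglongrightarrow> \<psi> z" and "X \<longlonglongrightarrow> x"
  shows "(\<lambda>n. finv (\<phi> n) (X n)) \<longlonglongrightarrow> finv \<psi> x"
  unfolding finv_def
  by (rule integral_dominated_convergence[where w=w])
    (use assms in \<open>auto intro!: tendsto_intros always_eventually simp: norm_mult\<close>)

subsection \<open>Gaussian damping\<close>

definition gauss :: "real \<Rightarrow> real \<Rightarrow> real" where
  "gauss \<sigma> z = exp (- (\<sigma> * z)\<^sup>2 / 2)"

lemma gauss_measurable[measurable]: "gauss \<sigma> \<in> borel_measurable borel"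
  unfolding gauss_def[abs_def] by measurable

lemma gauss_pos: "0 < gauss \<sigma> z" and gauss_le_1: "gauss \<sigma> z \<le> 1"
  by (auto simp: gauss_def)

lemma finv_gauss:
  assumes "\<sigma> > 0"
  shows "integrable lborel (gauss \<sigma>)"
    and "finv (\<lambda>z. of_real (gauss \<sigma> z)) x = of_real (sqrt (2 * pi) / \<sigma> * gauss (1 / \<sigma>) x)"
proof -
  have i1: "integrable lborel (gauss 1)"
    using integrable_mult_right[OF integrable_std_normal_moment[of 0], of "sqrt (2 * pi)"]
    by (simp add: std_normal_density_def gauss_def[abs_def])
  have sc: "gauss \<sigma> z = gauss 1 (0 + \<sigma> * z)" for z
    by (simp add: gauss_def)
  show "integrable lborel (gauss \<sigma>)"
    using lborel_integrable_real_affine[OF i1, of \<sigma> 0] assms unfolding sc by simp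
  have ch: "(CLINT u|lborel. of_real (gauss 1 u) * iexp (- (u * y))) = of_real (sqrt (2 * pi) * gauss 1 y)" for y
  proof -
    have "complex_of_real (exp (- (- y)\<^sup>2 / 2)) = (CLINT u|std_normal_distribution. iexp (- y * u))"
      using fun_cong[OF char_std_normal_distribution, of "- y"] by (simp add: char_def)
    also have "\<dots> = (CLINT u|lborel. std_normal_density u *\<^sub>R iexp (- y * u))"
      by (subst integral_density) auto
    also have "\<dots> = (CLINT u|lborel. of_real (1 / sqrt (2 * pi)) * (of_real (gauss 1 u) * iexp (- (u * y))))"
      by (simp add: std_normal_density_def gauss_def scaleR_conv_of_real mult_ac)
    also have "\<dots> = of_real (1 / sqrt (2 * pi)) * (CLINT u|lborel. of_real (gauss 1 u) * iexp (- (u * y)))"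
      by simp
    finally show ?thesis by (simp add: gauss_def field_simps)
  qed
  let ?y = "x / \<sigma>"
  have "of_real (sqrt (2 * pi) * gauss 1 ?y) = (CLINT u|lborel. of_real (gauss 1 u) * iexp (- (u * ?y)))"
    by (rule ch[symmetric])
  also have "\<dots> = \<bar>\<sigma>\<bar> *\<^sub>R (CLINT z|lborel. of_real (gauss 1 (0 + \<sigma> * z)) * iexp (- ((0 + \<sigma> * z) * ?y)))"
    using assms by (intro lborel_integral_real_affine) simp
  also have "\<dots> = of_real \<sigma> * finv (\<lambda>z. of_real (gauss \<sigma> z)) x"
    using assms by (simp add: finv_def sc scaleR_conv_of_real)
  finally have "of_real \<sigma> * finv (\<lambda>z. of_real (gauss \<sigma> z)) x = of_real (sqrt (2 * pi) * gauss 1 ?y)" ..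
  moreover have "gauss 1 ?y = gauss (1 / \<sigma>) x" by (simp add: gauss_def)
  ultimately show "finv (\<lambda>z. of_real (gauss \<sigma> z)) x = of_real (sqrt (2 * pi) / \<sigma> * gauss (1 / \<sigma>) x)"
    using assms by (simp add: field_simps)
qed

text \<open>For a characteristic function \<open>\<phi>\<close> this is \<open>2 * pi\<close> times
  the density of its law convolved with a centred normal law of variance
  \<open>\<sigma>\<^sup>2\<close>; the integral converges for every bounded measurable
  \<open>\<phi>\<close> if \<open>\<sigma> > 0\<close>.\<close>

definition gfinv :: "real \<Rightarrow> (real \<Rightarrow> complex) \<Rightarrow> real \<Rightarrow> complex" where
  "gfinv \<sigma> \<phi> = finv (\<lambda>z. \<phi> z * of_real (gauss \<sigma> z))"

lemma integrable_mult_gauss: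
  fixes \<phi> :: "real \<Rightarrow> complex"
  assumes "\<sigma> > 0" and [measurable]: "\<phi> \<in> borel_measurable borel" and "\<And>z. norm (\<phi> z) \<le> C"
  shows "integrable lborel (\<lambda>z. \<phi> z * of_real (gauss \<sigma> z))"
proof (rule integrable_boundI)
  show "integrable lborel (\<lambda>z. C * gauss \<sigma> z)"
    using finv_gauss(1)[OF assms(1)] by simp
  show "norm (\<phi> z * of_real (gauss \<sigma> z)) \<le> C * gauss \<sigma> z" for z
    using assms(3)[of z] gauss_pos[of \<sigma> z] by (simp add: norm_mult mult_right_mono)
qed measurable

lemma gfinv_tendsto:
  fixes \<phi> :: "real \<Rightarrow> complex"
  assumes \<phi>: "integrable lborel \<phi>" and "\<sigma> \<longlonglongrightarrow> 0" "X \<longlonglongrightarrow> x"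
  shows "(\<lambda>n. gfinv (\<sigma> n) \<phi> (X n)) \<longlonglongrightarrow> finv \<phi> x"
proof -
  have [measurable]: "\<phi> \<in> borel_measurable borel" using \<phi> by auto
  show ?thesis
    unfolding gfinv_def
  proof (rule finv_tendsto[where w="\<lambda>z. norm (\<phi> z)"])
    show "norm (\<phi> z * complex_of_real (gauss (\<sigma> n) z)) \<le> norm (\<phi> z)" for n z
      using gauss_le_1[of "\<sigma> n" z] gauss_pos[of "\<sigma> n" z] by (simp add: norm_mult mult_left_le)
    show "(\<lambda>n. \<phi> z * complex_of_real (gauss (\<sigma> n) z)) \<longlonglongrightarrow> \<phi> z" for z
    proof -
      have "(\<lambda>n. \<phi> z * complex_of_real (gauss (\<sigma> n) z)) \<longlonglongrightarrow> \<phi> z * of_real (exp (- (0 * z)\<^sup>2 / 2))"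
        unfolding gauss_def by (intro tendsto_intros assms) simp
      then show ?thesis by simp
    qed
  qed (use assms in auto)
qed


section \<open>Inversion of an integrable transform with nonnegative inverse\<close>

lemma integral_nonneg_Reals:
  fixes f :: "'a \<Rightarrow> complex"
  assumes "\<And>x. f x \<in> \<real>\<^sub>\<ge>\<^sub>0"
  shows "integral\<^sup>L M f \<in> \<real>\<^sub>\<ge>\<^sub>0"
proof -
  have "integral\<^sup>L M f = (\<integral>x. of_real (Re (f x)) \<partial>M)"
    using assms by (intro Bochner_Integration.integral_cong refl) (auto simp: complex_nonneg_Reals_iff complex_eq_iff)
  also have "\<dots> = of_real (\<integral>x. Re (f x) \<partial>M)"
    by (rule integral_complex_of_real)
  finally have "integral\<^sup>L M f = of_real (\<integral>x. Re (f x) \<partial>M)" .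
  moreover have "0 \<le> (\<integral>x. Re (f x) \<partial>M)"
    using assms by (auto simp: complex_nonneg_Reals_iff intro!: integral_nonneg_AE)
  ultimately show ?thesis by simp
qed

text \<open>The Gaussian acts as an approximate identity; \<open>sqrt (2 * pi)\<close> is its total
  mass.\<close>

lemma gauss_scaled_tendsto:
  fixes \<phi> :: "real \<Rightarrow> complex"
  assumes cont: "continuous_on UNIV \<phi>" and bd: "\<And>z. norm (\<phi> z) \<le> C"
    and s: "s \<longlonglongrightarrow> 0"
  shows "(\<lambda>n. CLINT t|lborel. \<phi> (w + s n * t) * of_real (gauss 1 t)) \<longlonglongrightarrow> of_real (sqrt (2 * pi)) * \<phi> w"
proof -
  have [measurable]: "\<phi> \<in> borel_measurable borel"
    using cont by (rule borel_measurable_continuous_onI)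
  have int: "(LINT t|lborel. gauss 1 t) = sqrt (2 * pi)"
  proof -
    have "complex_of_real (LINT t|lborel. gauss 1 t) = finv (\<lambda>z. of_real (gauss 1 z)) 0"
      by (simp add: finv_def)
    also have "\<dots> = of_real (sqrt (2 * pi))"
      by (subst finv_gauss) (auto simp: gauss_def)
    finally show ?thesis by (simp only: of_real_eq_iff)
  qed
  have "(\<lambda>n. CLINT t|lborel. \<phi> (w + s n * t) * of_real (gauss 1 t)) \<longlonglongrightarrow> (CLINT t|lborel. \<phi> w * of_real (gauss 1 t))"
  proof (rule integral_dominated_convergence[where w="\<lambda>t. C * gauss 1 t"])
    show "integrable lborel (\<lambda>t. C * gauss 1 t)"
      using finv_gauss(1)[of 1] by simp
    show "AE t in lborel. (\<lambda>n. \<phi> (w + s n * t) * of_real (gauss 1 t)) \<longlonglongrightarrow> \<phi> w * of_real (gauss 1 t)"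
    proof (intro always_eventually allI tendsto_intros)
      fix t
      have "(\<lambda>n. w + s n * t) \<longlonglongrightarrow> w + 0 * t" by (intro tendsto_intros s)
      then have "(\<lambda>n. w + s n * t) \<longlonglongrightarrow> w" by simp
      moreover have "isCont \<phi> w" using cont by (simp add: continuous_on_eq_continuous_at)
      ultimately show "(\<lambda>n. \<phi> (w + s n * t)) \<longlonglongrightarrow> \<phi> w"
        by (rule isCont_tendsto_compose[rotated])
    qed
    show "AE t in lborel. norm (\<phi> (w + s n * t) * of_real (gauss 1 t)) \<le> C * gauss 1 t" for n
    proof (rule always_eventually, rule allI)
      fix t
      show "norm (\<phi> (w + s n * t) * of_real (gauss 1 t)) \<le> C * gauss 1 t"
        using bd[of "w + s n * t"] gauss_pos[of 1 t] by (simp add: norm_mult mult_right_mono)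
    qed
  qed simp_all
  also have "(CLINT t|lborel. \<phi> w * of_real (gauss 1 t)) = \<phi> w * of_real (sqrt (2 * pi))"
    by (simp add: int)
  finally show ?thesis by (simp only: mult.commute)
qed

text \<open>That \<open>\<phi>\<close> is a characteristic function is a conclusion; nonnegativity
  of the inverse transform takes its place. By Fubini a damped Fourier integral of \<open>f\<close>
  is a Gaussian average of \<open>\<phi>\<close> around \<open>w\<close>. Removing the damping,
  monotone convergence at \<open>w = 0\<close> shows that \<open>f\<close> is integrable with mass
  \<open>\<phi> 0 = 1\<close>, after which dominated convergence recovers \<open>\<phi> w\<close>
  for every \<open>w\<close>.\<close>

lemma finv_char:
  fixes \<phi> :: "real \<Rightarrow> complex"
  assumes \<phi>: "integrable lborel \<phi>" and cont: "continuous_on UNIV \<phi>" and bd: "\<And>z. norm (\<phi> z) \<le> C"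
    and one: "\<phi> 0 = 1" and pos: "\<And>x. finv \<phi> x \<in> \<real>\<^sub>\<ge>\<^sub>0"
  defines "f \<equiv> \<lambda>x. Re (finv \<phi> x) / (2 * pi)"
  shows "integrable lborel f" "(LINT x|lborel. f x) = 1"
    and "real_distribution (density lborel (\<lambda>x. ennreal (f x)))"
    and "char (density lborel (\<lambda>x. ennreal (f x))) = \<phi>"
proof -
  have [measurable]: "finv \<phi> \<in> borel_measurable borel"
    by (intro borel_measurable_continuous_onI continuous_finv \<phi>)
  have [measurable]: "f \<in> borel_measurable borel" unfolding f_def by measurable
  have f0: "f x \<ge> 0" for x using pos[of x] by (simp add: f_def complex_nonneg_Reals_iff)
  have f: "complex_of_real (f x) = finv \<phi> x / of_real (2 * pi)" for x
    using pos[of x] by (simp add: f_def complex_nonneg_Reals_iff complex_eq_iff)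
  define s where "s n = 1 / (real n + 1)" for n :: nat
  have s: "s n > 0" for n by (simp add: s_def)
  have s0: "s \<longlonglongrightarrow> 0"
    unfolding s_def using LIMSEQ_inverse_real_of_nat by (simp add: inverse_eq_divide add.commute)
  \<comment> \<open>Integrating out \<open>x\<close> leaves a Gaussian in \<open>z\<close> of width
    \<open>s n\<close> centred at \<open>w\<close>, which the substitution
    \<open>z = w + s n * t\<close> normalises.\<close>
  have key: "(CLINT x|lborel. of_real (f x) * (iexp (w * x) * of_real (gauss (s n) x)))
      = of_real (1 / sqrt (2 * pi)) * (CLINT t|lborel. \<phi> (w + s n * t) * of_real (gauss 1 t))"
    and key_int: "integrable lborel (\<lambda>x. complex_of_real (f x) * (iexp (w * x) * of_real (gauss (s n) x)))" for n w
  proof -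
    let ?k = "\<lambda>z x. of_real (gauss (s n) x) * iexp (w * x - z * x)"
    have m: "(\<lambda>(z, x). ?k z x) \<in> borel_measurable (borel \<Otimes>\<^sub>M borel)"
      by measurable
    note F = Fubini_weighted[OF sigma_finite_lborel _ \<phi> finv_gauss(1)[OF s[of n]] m]
    have nb: "norm (?k z x) \<le> gauss (s n) x" for z x
      using gauss_pos[of "s n" x] by (simp add: norm_mult)
    have L: "(CLINT z|lborel. \<phi> z * ?k z x) = of_real (2 * pi) * (of_real (f x) * (iexp (w * x) * of_real (gauss (s n) x)))" for x
    proof -
      have "\<phi> z * ?k z x = (of_real (gauss (s n) x) * iexp (w * x)) * (\<phi> z * iexp (- (z * x)))" for z
      proof -
        have "iexp (w * x - z * x) = iexp (w * x) * iexp (- (z * x))"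
          by (simp add: exp_add[symmetric] algebra_simps)
        then show ?thesis by (simp only: mult_ac)
      qed
      then have "(CLINT z|lborel. \<phi> z * ?k z x) = (of_real (gauss (s n) x) * iexp (w * x)) * finv \<phi> x"
        unfolding finv_def integral_mult_right_zero[symmetric]
        by (intro Bochner_Integration.integral_cong refl)
      then show ?thesis by (simp add: f)
    qed
    have R: "(CLINT x|lborel. ?k z x) = of_real (sqrt (2 * pi) / s n * gauss (1 / s n) (z - w))" for z
    proof -
      have "(CLINT x|lborel. ?k z x) = finv (\<lambda>x. of_real (gauss (s n) x)) (z - w)"
        unfolding finv_def by (intro Bochner_Integration.integral_cong refl) (simp add: algebra_simps)
      then show ?thesis using finv_gauss(2)[OF s] by simp
    qed
    have "integrable lborel (\<lambda>x. of_real (2 * pi) * (complex_of_real (f x) * (iexp (w * x) * of_real (gauss (s n) x))))"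
      using F(2)[OF _ nb] unfolding L by simp
    then have "integrable lborel (\<lambda>x. of_real (1 / (2 * pi)) * (of_real (2 * pi) * (complex_of_real (f x) * (iexp (w * x) * of_real (gauss (s n) x)))))"
      by (rule integrable_mult_right)
    then show "integrable lborel (\<lambda>x. complex_of_real (f x) * (iexp (w * x) * of_real (gauss (s n) x)))"
      by simp
    have "of_real (2 * pi) * (CLINT x|lborel. of_real (f x) * (iexp (w * x) * of_real (gauss (s n) x)))
       = (CLINT z|lborel. \<phi> z * of_real (sqrt (2 * pi) / s n * gauss (1 / s n) (z - w)))"
      using F(1)[OF _ nb] unfolding L R by simp
    also have "\<dots> = of_real (sqrt (2 * pi) / s n) * (CLINT z|lborel. \<phi> z * of_real (gauss (1 / s n) (z - w)))"
      unfolding integral_mult_right_zero[symmetric]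
      by (intro Bochner_Integration.integral_cong refl) simp
    also have "(CLINT z|lborel. \<phi> z * of_real (gauss (1 / s n) (z - w)))
        = \<bar>s n\<bar> *\<^sub>R (CLINT t|lborel. \<phi> (w + s n * t) * of_real (gauss (1 / s n) (w + s n * t - w)))"
      using s[of n] by (intro lborel_integral_real_affine) simp
    also have "\<dots> = \<bar>s n\<bar> *\<^sub>R (CLINT t|lborel. \<phi> (w + s n * t) * of_real (gauss 1 t))"
      using s[of n] by (simp add: gauss_def)
    finally have *: "of_real (2 * pi) * (CLINT x|lborel. of_real (f x) * (iexp (w * x) * of_real (gauss (s n) x)))
       = of_real (sqrt (2 * pi)) * (CLINT t|lborel. \<phi> (w + s n * t) * of_real (gauss 1 t))"
      using s[of n] by (simp add: scaleR_conv_of_real)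
    have "sqrt (2 * pi) * sqrt (2 * pi) = 2 * pi" by simp
    then have "complex_of_real (2 * pi) = of_real (sqrt (2 * pi)) * of_real (sqrt (2 * pi))"
      unfolding of_real_mult[symmetric] by simp
    with * have "of_real (sqrt (2 * pi)) * (of_real (sqrt (2 * pi)) * (CLINT x|lborel. of_real (f x) * (iexp (w * x) * of_real (gauss (s n) x))))
       = of_real (sqrt (2 * pi)) * (CLINT t|lborel. \<phi> (w + s n * t) * of_real (gauss 1 t))"
      by (simp only: mult.assoc)
    then have "of_real (sqrt (2 * pi)) * (CLINT x|lborel. of_real (f x) * (iexp (w * x) * of_real (gauss (s n) x)))
       = (CLINT t|lborel. \<phi> (w + s n * t) * of_real (gauss 1 t))"
      by (subst (asm) mult_cancel_left) auto
    then show "(CLINT x|lborel. of_real (f x) * (iexp (w * x) * of_real (gauss (s n) x)))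
      = of_real (1 / sqrt (2 * pi)) * (CLINT t|lborel. \<phi> (w + s n * t) * of_real (gauss 1 t))"
      by (metis (no_types, lifting) mult.assoc mult.left_neutral nonzero_divide_eq_eq of_real_1 of_real_divide of_real_eq_0_iff pi_neq_zero real_sqrt_eq_zero_cancel_iff mult_eq_0_iff zero_neq_numeral times_divide_eq_left)
  qed
  have lim: "(\<lambda>n. CLINT x|lborel. of_real (f x) * (iexp (w * x) * of_real (gauss (s n) x))) \<longlonglongrightarrow> \<phi> w" for w
    using tendsto_mult_left[OF gauss_scaled_tendsto[OF cont bd s0, of w], of "of_real (1 / sqrt (2 * pi))"]
    unfolding key by simp
  have r: "complex_of_real (f x) * (iexp (0 * x) * of_real (gauss (s n) x)) = of_real (f x * gauss (s n) x)" for x n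
    by simp
  have int_n: "integrable lborel (\<lambda>x. f x * gauss (s n) x)" for n
    using key_int[of 0 n] unfolding r by (simp only: complex_of_real_integrable_eq)
  have "(\<lambda>n. complex_of_real (LINT x|lborel. f x * gauss (s n) x)) \<longlonglongrightarrow> of_real 1"
    using lim[of 0] unfolding r integral_complex_of_real one of_real_1 .
  then have lim0: "(\<lambda>n. LINT x|lborel. f x * gauss (s n) x) \<longlonglongrightarrow> 1"
    by (simp only: tendsto_of_real_iff)
  have s_anti: "s n \<le> s m" if "m \<le> n" for m n using that by (simp add: s_def frac_le)
  have gauss_mono: "gauss (s m) x \<le> gauss (s n) x" if "m \<le> n" for m n x
  proof -
    have "\<bar>s n * x\<bar> \<le> \<bar>s m * x\<bar>"
      using s_anti[OF that] s[of n] s[of m] by (simp add: abs_mult mult_right_mono)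
    then have "(s n * x)\<^sup>2 \<le> (s m * x)\<^sup>2" by (rule abs_le_square_iff[THEN iffD1])
    then show ?thesis by (simp add: gauss_def)
  qed
  have gauss_lim: "(\<lambda>n. gauss (s n) x) \<longlonglongrightarrow> 1" for x
  proof -
    have "(\<lambda>n. gauss (s n) x) \<longlonglongrightarrow> exp (- (0 * x)\<^sup>2 / 2)"
      unfolding gauss_def by (intro tendsto_intros s0) simp
    then show ?thesis by simp
  qed
  have mono: "AE x in lborel. mono (\<lambda>n. f x * gauss (s n) x)"
    using f0 gauss_mono by (auto simp: mono_def intro!: mult_left_mono)
  have conv: "AE x in lborel. (\<lambda>n. f x * gauss (s n) x) \<longlonglongrightarrow> f x"
    using tendsto_mult_left[OF gauss_lim] by (auto intro!: always_eventually)
  have MC: "has_bochner_integral lborel f 1"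
    using int_n mono conv lim0 by (rule has_bochner_integral_monotone_convergence) measurable
  show fint: "integrable lborel f" and f1: "(LINT x|lborel. f x) = 1"
    using MC by (auto simp: has_bochner_integral_iff)
  have "prob_space (density lborel (\<lambda>x. ennreal (f x)))"
    by (rule prob_spaceI) (simp add: emeasure_density nn_integral_eq_integral[OF fint] f0 f1)
  then show "real_distribution (density lborel (\<lambda>x. ennreal (f x)))"
    by (simp add: real_distribution_def real_distribution_axioms_def)
  show "char (density lborel (\<lambda>x. ennreal (f x))) = \<phi>"
  proof
    fix w
    have "(\<lambda>n. CLINT x|lborel. of_real (f x) * (iexp (w * x) * of_real (gauss (s n) x)))
        \<longlonglongrightarrow> (CLINT x|lborel. of_real (f x) * (iexp (w * x) * of_real 1))"
    proof (rule integral_dominated_convergence[where w=f])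
      show "AE x in lborel. norm (of_real (f x) * (iexp (w * x) * of_real (gauss (s n) x))) \<le> f x" for n
      proof (rule always_eventually, rule allI)
        fix x
        have "f x * gauss (s n) x \<le> f x * 1"
          using f0 gauss_le_1 by (rule mult_left_mono[rotated])
        then show "norm (of_real (f x) * (iexp (w * x) * of_real (gauss (s n) x))) \<le> f x"
          using f0[of x] gauss_pos[of "s n" x] by (simp add: norm_mult)
      qed
      show "AE x in lborel. (\<lambda>n. of_real (f x) * (iexp (w * x) * of_real (gauss (s n) x)))
        \<longlonglongrightarrow> of_real (f x) * (iexp (w * x) * of_real 1)"
        by (intro always_eventually allI tendsto_intros gauss_lim)
    qed (use fint in measurable)
    then have "(CLINT x|lborel. of_real (f x) * (iexp (w * x) * of_real 1)) = \<phi> w"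
      using lim by (rule LIMSEQ_unique)
    then show "char (density lborel (\<lambda>x. ennreal (f x))) w = \<phi> w"
      unfolding char_def by (subst integral_density) (use f0 in \<open>auto simp: scaleR_conv_of_real\<close>)
  qed
qed

section \<open>Exponential tilting on the Fourier side\<close>

text \<open>A Laplace transform \<open>\<Phi>\<close> of a positive measure is recorded on the lines of real part 0 and 1,
  that is, as the Fourier transforms of the measure and of its tilting by \<open>exp\<close>. Damping by a Gaussian
  makes positivity and the tilting relation meaningful without integrability and stable under bounded
  pointwise limits, so that no measure with transform \<open>\<Phi>\<close> has to be constructed.\<close>

definition tilt_pos :: "(complex \<Rightarrow> complex) \<Rightarrow> bool" where
  "tilt_pos \<Phi> \<longleftrightarrow> (\<exists>C. \<forall>\<zeta>. Re \<zeta> \<in> {0, 1} \<longrightarrow> norm (\<Phi> \<zeta>) \<le> C) \<and>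
     (\<forall>s\<in>{0, 1}. (\<lambda>z. \<Phi> (Complex s z)) \<in> borel_measurable borel) \<and>
     (\<forall>\<sigma>>0. \<forall>x. gfinv \<sigma> (\<lambda>z. \<Phi> (Complex 0 z)) x \<in> \<real>\<^sub>\<ge>\<^sub>0) \<and>
     (\<forall>\<sigma>>0. \<forall>x. gfinv \<sigma> (\<lambda>z. \<Phi> (Complex 1 z)) x
        = of_real (exp (x + \<sigma>\<^sup>2 / 2)) * gfinv \<sigma> (\<lambda>z. \<Phi> (Complex 0 z)) (x + \<sigma>\<^sup>2))"

lemma tilt_posD:
  assumes "tilt_pos \<Phi>"
  shows "\<exists>C\<ge>0. \<forall>\<zeta>. Re \<zeta> \<in> {0, 1} \<longrightarrow> norm (\<Phi> \<zeta>) \<le> C"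
    and "s \<in> {0, 1} \<Longrightarrow> (\<lambda>z. \<Phi> (Complex s z)) \<in> borel_measurable borel"
    and "\<sigma> > 0 \<Longrightarrow> gfinv \<sigma> (\<lambda>z. \<Phi> (Complex 0 z)) x \<in> \<real>\<^sub>\<ge>\<^sub>0"
    and "\<sigma> > 0 \<Longrightarrow> gfinv \<sigma> (\<lambda>z. \<Phi> (Complex 1 z)) x
        = of_real (exp (x + \<sigma>\<^sup>2 / 2)) * gfinv \<sigma> (\<lambda>z. \<Phi> (Complex 0 z)) (x + \<sigma>\<^sup>2)"
    and "\<sigma> > 0 \<Longrightarrow> s \<in> {0, 1} \<Longrightarrow> integrable lborel (\<lambda>z. \<Phi> (Complex s z) * of_real (gauss \<sigma> z))"
proof -
  obtain C where C: "\<forall>\<zeta>. Re \<zeta> \<in> {0, 1} \<longrightarrow> norm (\<Phi> \<zeta>) \<le> C"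
    using assms unfolding tilt_pos_def by blast
  then show "\<exists>C\<ge>0. \<forall>\<zeta>. Re \<zeta> \<in> {0, 1} \<longrightarrow> norm (\<Phi> \<zeta>) \<le> C"
    by (intro exI[of _ "max C 0"]) (auto simp: le_max_iff_disj)
  show m: "s \<in> {0, 1} \<Longrightarrow> (\<lambda>z. \<Phi> (Complex s z)) \<in> borel_measurable borel"
    using assms unfolding tilt_pos_def by blast
  show "\<sigma> > 0 \<Longrightarrow> s \<in> {0, 1} \<Longrightarrow> integrable lborel (\<lambda>z. \<Phi> (Complex s z) * of_real (gauss \<sigma> z))"
    using m C by (intro integrable_mult_gauss[where C=C]) auto
  show "\<sigma> > 0 \<Longrightarrow> gfinv \<sigma> (\<lambda>z. \<Phi> (Complex 0 z)) x \<in> \<real>\<^sub>\<ge>\<^sub>0"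
    using assms unfolding tilt_pos_def by simp
  show "\<sigma> > 0 \<Longrightarrow> gfinv \<sigma> (\<lambda>z. \<Phi> (Complex 1 z)) x
        = of_real (exp (x + \<sigma>\<^sup>2 / 2)) * gfinv \<sigma> (\<lambda>z. \<Phi> (Complex 0 z)) (x + \<sigma>\<^sup>2)"
    using assms unfolding tilt_pos_def by simp
qed

lemma tilt_posI:
  assumes "\<And>\<zeta>. Re \<zeta> \<in> {0, 1} \<Longrightarrow> norm (\<Phi> \<zeta>) \<le> C"
    and "\<And>s. s \<in> {0, 1} \<Longrightarrow> (\<lambda>z. \<Phi> (Complex s z)) \<in> borel_measurable borel"
    and "\<And>\<sigma> x. \<sigma> > 0 \<Longrightarrow> gfinv \<sigma> (\<lambda>z. \<Phi> (Complex 0 z)) x \<in> \<real>\<^sub>\<ge>\<^sub>0"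
    and "\<And>\<sigma> x. \<sigma> > 0 \<Longrightarrow> gfinv \<sigma> (\<lambda>z. \<Phi> (Complex 1 z)) x
        = of_real (exp (x + \<sigma>\<^sup>2 / 2)) * gfinv \<sigma> (\<lambda>z. \<Phi> (Complex 0 z)) (x + \<sigma>\<^sup>2)"
  shows "tilt_pos \<Phi>"
  unfolding tilt_pos_def
  by (intro conjI exI[of _ C] allI impI ballI assms)

text \<open>The point mass at 0. Damped, it is a normal density \<open>n\<close>, and completing the
  square gives \<open>n x = exp (x + \<sigma>\<^sup>2 / 2) * n (x + \<sigma>\<^sup>2)\<close>.
  Superposing translates of this identity is the origin of the shift and of the factor in the
  tilting relation.\<close>

lemma tilt_pos_one: "tilt_pos (\<lambda>_. 1)"
proof -
  have tilt: "gfinv \<sigma> (\<lambda>_. 1) x = of_real (exp (x + \<sigma>\<^sup>2 / 2)) * gfinv \<sigma> (\<lambda>_. 1) (x + \<sigma>\<^sup>2)" if "\<sigma> > 0" for \<sigma> x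
  proof -
    have "- (1 / \<sigma> * x)\<^sup>2 / 2 = (x + \<sigma>\<^sup>2 / 2) + - (1 / \<sigma> * (x + \<sigma>\<^sup>2))\<^sup>2 / 2"
    proof -
      have "(1 / \<sigma> * (x + \<sigma>\<^sup>2))\<^sup>2 = (1 / \<sigma> * x)\<^sup>2 + 2 * x + \<sigma>\<^sup>2"
      proof -
        have "1 / \<sigma> * (x + \<sigma>\<^sup>2) = 1 / \<sigma> * x + \<sigma>"
          using that by (simp add: distrib_left power2_eq_square)
        moreover have "2 * (1 / \<sigma> * x) * \<sigma> = 2 * x" using that by simp
        ultimately show ?thesis by (simp only: power2_sum)
      qed
      then show ?thesis by linarith
    qed
    then have "gauss (1 / \<sigma>) x = exp (x + \<sigma>\<^sup>2 / 2) * gauss (1 / \<sigma>) (x + \<sigma>\<^sup>2)"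
      unfolding gauss_def exp_add[symmetric] by (rule arg_cong)
    then show ?thesis
      by (simp add: gfinv_def finv_gauss(2)[OF that])
  qed
  have pos: "gfinv \<sigma> (\<lambda>_. 1) x \<in> \<real>\<^sub>\<ge>\<^sub>0" if "\<sigma> > 0" for \<sigma> x
  proof -
    have "0 \<le> sqrt (2 * pi) / \<sigma> * gauss (1 / \<sigma>) x"
      using that gauss_pos[of "1 / \<sigma>" x] by simp
    then show ?thesis
      unfolding gfinv_def mult_1 finv_gauss(2)[OF that] nonneg_Reals_of_real_iff .
  qed
  show ?thesis
    by (rule tilt_posI[where C=1]) (simp, simp, rule pos, assumption, rule tilt, assumption)
qed

section \<open>Closure of two-line positivity under sums, limits, convolutions and
  exponentials\<close>

lemma gfinv_add:
  assumes "tilt_pos \<Phi>" "tilt_pos \<Psi>" "\<sigma> > 0" "s \<in> {0, 1}"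
  shows "gfinv \<sigma> (\<lambda>z. \<Phi> (Complex s z) + \<Psi> (Complex s z)) x
    = gfinv \<sigma> (\<lambda>z. \<Phi> (Complex s z)) x + gfinv \<sigma> (\<lambda>z. \<Psi> (Complex s z)) x"
  unfolding gfinv_def distrib_right
  using tilt_posD(5)[OF assms(1,3,4)] tilt_posD(5)[OF assms(2,3,4)] by (rule finv_add)

lemma gfinv_scale: "gfinv \<sigma> (\<lambda>z. c * \<phi> z) x = c * gfinv \<sigma> \<phi> x"
  unfolding gfinv_def by (simp add: mult.assoc finv_scale)

lemma tilt_pos_add:
  assumes "tilt_pos \<Phi>" "tilt_pos \<Psi>"
  shows "tilt_pos (\<lambda>\<zeta>. \<Phi> \<zeta> + \<Psi> \<zeta>)"
proof -
  obtain C D where C: "\<forall>\<zeta>. Re \<zeta> \<in> {0, 1} \<longrightarrow> norm (\<Phi> \<zeta>) \<le> C"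
    and D: "\<forall>\<zeta>. Re \<zeta> \<in> {0, 1} \<longrightarrow> norm (\<Psi> \<zeta>) \<le> D"
    using tilt_posD(1)[OF assms(1)] tilt_posD(1)[OF assms(2)] by blast
  show ?thesis
  proof (rule tilt_posI)
    show "norm (\<Phi> \<zeta> + \<Psi> \<zeta>) \<le> C + D" if "Re \<zeta> \<in> {0, 1}" for \<zeta>
      using C[rule_format, OF that] D[rule_format, OF that] norm_triangle_ineq[of "\<Phi> \<zeta>" "\<Psi> \<zeta>"] by linarith
    show "(\<lambda>z. \<Phi> (Complex s z) + \<Psi> (Complex s z)) \<in> borel_measurable borel" if "s \<in> {0, 1}" for s
      using tilt_posD(2)[OF assms(1) that] tilt_posD(2)[OF assms(2) that] by (rule borel_measurable_add)
    fix \<sigma> x :: real assume \<sigma>: "\<sigma> > 0"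
    show "gfinv \<sigma> (\<lambda>z. \<Phi> (Complex 0 z) + \<Psi> (Complex 0 z)) x \<in> \<real>\<^sub>\<ge>\<^sub>0"
      using tilt_posD(3)[OF assms(1) \<sigma>] tilt_posD(3)[OF assms(2) \<sigma>]
      by (simp only: gfinv_add[OF assms \<sigma>] insert_iff simp_thms nonneg_Reals_add_I)
    show "gfinv \<sigma> (\<lambda>z. \<Phi> (Complex 1 z) + \<Psi> (Complex 1 z)) x
        = of_real (exp (x + \<sigma>\<^sup>2 / 2)) * gfinv \<sigma> (\<lambda>z. \<Phi> (Complex 0 z) + \<Psi> (Complex 0 z)) (x + \<sigma>\<^sup>2)"
      by (simp only: gfinv_add[OF assms \<sigma>] insert_iff simp_thms distrib_left
        tilt_posD(4)[OF assms(1) \<sigma>] tilt_posD(4)[OF assms(2) \<sigma>])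
  qed
qed

lemma tilt_pos_scale:
  assumes "tilt_pos \<Phi>" "r \<ge> 0"
  shows "tilt_pos (\<lambda>\<zeta>. of_real r * \<Phi> \<zeta>)"
proof -
  obtain C where C: "\<forall>\<zeta>. Re \<zeta> \<in> {0, 1} \<longrightarrow> norm (\<Phi> \<zeta>) \<le> C"
    using tilt_posD(1)[OF assms(1)] by blast
  show ?thesis
  proof (rule tilt_posI)
    show "norm (of_real r * \<Phi> \<zeta>) \<le> r * C" if "Re \<zeta> \<in> {0, 1}" for \<zeta>
      using C[rule_format, OF that] assms(2) by (simp add: norm_mult mult_left_mono)
    show "(\<lambda>z. of_real r * \<Phi> (Complex s z)) \<in> borel_measurable borel" if "s \<in> {0, 1}" for s
      by (intro borel_measurable_times borel_measurable_const tilt_posD(2)[OF assms(1) that])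
    fix \<sigma> x :: real assume \<sigma>: "\<sigma> > 0"
    show "gfinv \<sigma> (\<lambda>z. of_real r * \<Phi> (Complex 0 z)) x \<in> \<real>\<^sub>\<ge>\<^sub>0"
      using assms(2) tilt_posD(3)[OF assms(1) \<sigma>, of x] by (simp add: gfinv_scale)
    show "gfinv \<sigma> (\<lambda>z. of_real r * \<Phi> (Complex 1 z)) x
        = of_real (exp (x + \<sigma>\<^sup>2 / 2)) * gfinv \<sigma> (\<lambda>z. of_real r * \<Phi> (Complex 0 z)) (x + \<sigma>\<^sup>2)"
      by (simp only: gfinv_scale tilt_posD(4)[OF assms(1) \<sigma>] mult.left_commute)
  qed
qed

text \<open>The damping turns bounded pointwise convergence on the two lines into dominated
  convergence; nonnegativity and the tilting relation are closed conditions.\<close>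

lemma tilt_pos_limit:
  assumes F: "\<And>n. tilt_pos (F n)"
    and bd: "\<And>n \<zeta>. Re \<zeta> \<in> {0, 1} \<Longrightarrow> norm (F n \<zeta>) \<le> C"
    and lim: "\<And>\<zeta>. Re \<zeta> \<in> {0, 1} \<Longrightarrow> (\<lambda>n. F n \<zeta>) \<longlonglongrightarrow> \<Phi> \<zeta>"
  shows "tilt_pos \<Phi>"
proof -
  have meas: "(\<lambda>z. \<Phi> (Complex s z)) \<in> borel_measurable borel" if "s \<in> {0, 1}" for s
  proof (rule borel_measurable_LIMSEQ_metric)
    show "(\<lambda>z. F n (Complex s z)) \<in> borel_measurable borel" for n by (rule tilt_posD(2)[OF F that])
    show "(\<lambda>n. F n (Complex s z)) \<longlonglongrightarrow> \<Phi> (Complex s z)" for z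
      by (rule lim) (use that in simp)
  qed
  have g: "(\<lambda>n. gfinv \<sigma> (\<lambda>z. F n (Complex s z)) x) \<longlonglongrightarrow> gfinv \<sigma> (\<lambda>z. \<Phi> (Complex s z)) x"
    if "s \<in> {0, 1}" "\<sigma> > 0" for s \<sigma> x
    unfolding gfinv_def
  proof (rule finv_tendsto)
    show "integrable lborel (\<lambda>z. C * gauss \<sigma> z)" using finv_gauss(1)[OF that(2)] by simp
    show "norm (F n (Complex s z) * of_real (gauss \<sigma> z)) \<le> C * gauss \<sigma> z" for n z
      using bd[of "Complex s z" n] that(1) gauss_pos[of \<sigma> z] by (auto simp: norm_mult intro!: mult_right_mono)
    show "(\<lambda>n. F n (Complex s z) * of_real (gauss \<sigma> z)) \<longlonglongrightarrow> \<Phi> (Complex s z) * of_real (gauss \<sigma> z)" for z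
      using lim[of "Complex s z"] that(1) by (intro tendsto_intros) auto
    show "(\<lambda>z. F n (Complex s z) * of_real (gauss \<sigma> z)) \<in> borel_measurable borel" for n
      using tilt_posD(2)[OF F that(1)] by measurable
    show "(\<lambda>z. \<Phi> (Complex s z) * of_real (gauss \<sigma> z)) \<in> borel_measurable borel"
      using meas[OF that(1)] by measurable
  qed simp
  have bd': "norm (\<Phi> \<zeta>) \<le> C" if "Re \<zeta> \<in> {0, 1}" for \<zeta>
    using bd[OF that] by (intro LIMSEQ_le_const2[OF tendsto_norm[OF lim[OF that]]]) blast
  have pos: "gfinv \<sigma> (\<lambda>z. \<Phi> (Complex 0 z)) x \<in> \<real>\<^sub>\<ge>\<^sub>0" if "\<sigma> > 0" for \<sigma> x
    by (rule Lim_in_closed_set[OF closed_nonneg_Reals_complex _ _ g[OF _ that]])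
      (simp_all add: tilt_posD(3)[OF F that])
  have tilt: "gfinv \<sigma> (\<lambda>z. \<Phi> (Complex 1 z)) x
        = of_real (exp (x + \<sigma>\<^sup>2 / 2)) * gfinv \<sigma> (\<lambda>z. \<Phi> (Complex 0 z)) (x + \<sigma>\<^sup>2)" if "\<sigma> > 0" for \<sigma> x
  proof (rule LIMSEQ_unique)
    show "(\<lambda>n. gfinv \<sigma> (\<lambda>z. F n (Complex 1 z)) x) \<longlonglongrightarrow> gfinv \<sigma> (\<lambda>z. \<Phi> (Complex 1 z)) x"
      by (rule g) (use that in simp_all)
    show "(\<lambda>n. gfinv \<sigma> (\<lambda>z. F n (Complex 1 z)) x)
        \<longlonglongrightarrow> of_real (exp (x + \<sigma>\<^sup>2 / 2)) * gfinv \<sigma> (\<lambda>z. \<Phi> (Complex 0 z)) (x + \<sigma>\<^sup>2)"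
      unfolding tilt_posD(4)[OF F that] by (intro tendsto_mult_left g) (use that in simp_all)
  qed
  show ?thesis
    by (rule tilt_posI) (fact bd' meas pos tilt)+
qed

lemma exp_Complex_mult: "exp (Complex s z * of_real y) = of_real (exp (s * y)) * iexp (z * y)"
  by (simp add: Complex_eq exp_of_real[symmetric] exp_add[symmetric] algebra_simps)

lemma tilt_pos_mult_measure:
  assumes \<Phi>: "tilt_pos \<Phi>" and M: "finite_measure M" and [measurable_cong]: "sets M = sets borel"
    and exp: "integrable M (\<lambda>y. exp y)"
  shows "tilt_pos (\<lambda>\<zeta>. \<Phi> \<zeta> * (CLINT y|M. exp (\<zeta> * of_real y)))"
proof -
  interpret finite_measure M by fact
  have w: "integrable M (\<lambda>y. exp (s * y))" if "s \<in> {0, 1}" for s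
    using that exp by auto
  obtain C where C: "C \<ge> 0" "\<forall>\<zeta>. Re \<zeta> \<in> {0, 1} \<longrightarrow> norm (\<Phi> \<zeta>) \<le> C"
    using tilt_posD(1)[OF \<Phi>] by blast
  define B where "B = (LINT y|M. exp (0 * y)) + (LINT y|M. exp (1 * y))"
  have B: "(LINT y|M. exp (s * y)) \<le> B" if "s \<in> {0, 1}" for s :: real
    using that by (auto simp: B_def)
  have bd: "norm (\<Phi> \<zeta> * (CLINT y|M. exp (\<zeta> * of_real y))) \<le> C * B" if "Re \<zeta> \<in> {0, 1}" for \<zeta>
  proof -
    have "norm (CLINT y|M. exp (\<zeta> * of_real y)) \<le> (LINT y|M. norm (exp (\<zeta> * of_real y)))"
      by (rule integral_norm_bound)
    also have "\<dots> = (LINT y|M. exp (Re \<zeta> * y))"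
      by simp
    also have "\<dots> \<le> B" by (rule B[OF that])
    finally show ?thesis using C that by (auto simp: norm_mult intro!: mult_mono)
  qed
  have meas: "(\<lambda>z. \<Phi> (Complex s z) * (CLINT y|M. exp (Complex s z * of_real y))) \<in> borel_measurable borel"
    if "s \<in> {0, 1}" for s
  proof -
    have [measurable]: "(\<lambda>z. \<Phi> (Complex s z)) \<in> borel_measurable borel" by (rule tilt_posD(2)[OF \<Phi> that])
    show ?thesis unfolding exp_Complex_mult by measurable
  qed
  have conv: "gfinv \<sigma> (\<lambda>z. \<Phi> (Complex s z) * (CLINT y|M. exp (Complex s z * of_real y))) x
     = (CLINT y|M. of_real (exp (s * y)) * gfinv \<sigma> (\<lambda>z. \<Phi> (Complex s z)) (x - y))"
    if "s \<in> {0, 1}" "\<sigma> > 0" for s \<sigma> x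
  proof -
    have "(\<lambda>z. \<Phi> (Complex s z) * (CLINT y|M. exp (Complex s z * of_real y)) * of_real (gauss \<sigma> z))
      = (\<lambda>z. \<Phi> (Complex s z) * of_real (gauss \<sigma> z) * (CLINT y|M. of_real (exp (s * y)) * iexp (z * y)))"
      unfolding exp_Complex_mult by (simp add: mult_ac)
    then show ?thesis
      unfolding gfinv_def
      using finv_convolution(1)[OF sigma_finite_measure_axioms assms(3) tilt_posD(5)[OF \<Phi> that(2,1)] w[OF that(1)]]
      by simp
  qed
  have pos: "gfinv \<sigma> (\<lambda>z. \<Phi> (Complex 0 z) * (CLINT y|M. exp (Complex 0 z * of_real y))) x \<in> \<real>\<^sub>\<ge>\<^sub>0" if "\<sigma> > 0" for \<sigma> x
    using that tilt_posD(3)[OF \<Phi>] by (subst conv) (auto intro!: integral_nonneg_Reals)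
  have tilt: "gfinv \<sigma> (\<lambda>z. \<Phi> (Complex 1 z) * (CLINT y|M. exp (Complex 1 z * of_real y))) x =
      of_real (exp (x + \<sigma>\<^sup>2 / 2)) *
      gfinv \<sigma> (\<lambda>z. \<Phi> (Complex 0 z) * (CLINT y|M. exp (Complex 0 z * of_real y))) (x + \<sigma>\<^sup>2)" if "\<sigma> > 0" for \<sigma> x
  proof -
    have "complex_of_real (exp (1 * y)) * gfinv \<sigma> (\<lambda>z. \<Phi> (Complex 1 z)) (x - y)
      = of_real (exp (x + \<sigma>\<^sup>2 / 2)) * (of_real (exp (0 * y)) * gfinv \<sigma> (\<lambda>z. \<Phi> (Complex 0 z)) (x + \<sigma>\<^sup>2 - y))" for y
    proof -
      have "exp (1 * y) * exp (x - y + \<sigma>\<^sup>2 / 2) = exp (x + \<sigma>\<^sup>2 / 2)"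
        unfolding exp_add[symmetric] by simp
      then have "complex_of_real (exp (1 * y)) * of_real (exp (x - y + \<sigma>\<^sup>2 / 2)) = of_real (exp (x + \<sigma>\<^sup>2 / 2))"
        by (metis of_real_mult)
      then show ?thesis
        unfolding tilt_posD(4)[OF \<Phi> that] by (simp add: algebra_simps)
    qed
    then show ?thesis
      using that by (simp only: conv insert_iff simp_thms integral_mult_right_zero)
  qed
  show ?thesis
    by (rule tilt_posI) (fact bd meas pos tilt)+
qed

lemma tilt_pos_shift:
  assumes "tilt_pos \<Phi>"
  shows "tilt_pos (\<lambda>\<zeta>. \<Phi> \<zeta> * exp (\<zeta> * of_real a))"
proof -
  interpret prob_space "return borel a" by (rule prob_space_return) simp
  have "integrable (return borel a) (\<lambda>y::real. exp y)"
    by (rule integrableI_bounded) (auto simp: nn_integral_return)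
  from tilt_pos_mult_measure[OF assms finite_measure_axioms _ this] show ?thesis
    by (simp add: integral_return)
qed

text \<open>Compound Poisson exponentiation by partial sums of the exponential series, whose
  coefficients are nonnegative. The premise \<open>mult\<close> is a closure property, so that
  \<open>\<theta>\<close> may be the transform of a jump measure or a scaled translation.\<close>

lemma tilt_pos_exp:
  assumes \<Phi>: "tilt_pos \<Phi>" and mult: "\<And>\<Psi>. tilt_pos \<Psi> \<Longrightarrow> tilt_pos (\<lambda>\<zeta>. \<Psi> \<zeta> * \<theta> \<zeta>)"
    and bd: "\<And>\<zeta>. Re \<zeta> \<in> {0, 1} \<Longrightarrow> norm (\<theta> \<zeta>) \<le> B"
  shows "tilt_pos (\<lambda>\<zeta>. \<Phi> \<zeta> * exp (\<theta> \<zeta>))"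
proof -
  obtain C where C: "C \<ge> 0" "\<forall>\<zeta>. Re \<zeta> \<in> {0, 1} \<longrightarrow> norm (\<Phi> \<zeta>) \<le> C"
    using tilt_posD(1)[OF \<Phi>] by blast
  have B0: "0 \<le> B" using bd[of 0] norm_ge_zero[of "\<theta> 0"] by (simp del: norm_ge_zero)
  have pow: "tilt_pos (\<lambda>\<zeta>. \<Phi> \<zeta> * \<theta> \<zeta> ^ n)" for n
  proof (induction n)
    case (Suc n)
    from mult[OF this] show ?case by (simp add: mult_ac)
  qed (simp add: \<Phi>)
  have sum: "tilt_pos (\<lambda>\<zeta>. \<Sum>i\<le>n. of_real (1 / fact i) * (\<Phi> \<zeta> * \<theta> \<zeta> ^ i))" for n
  proof (induction n)
    case 0
    then show ?case using tilt_pos_scale[OF pow[of 0], of "1 / fact 0"] by simp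
  next
    case (Suc n)
    from tilt_pos_add[OF this tilt_pos_scale[OF pow[of "Suc n"], of "1 / fact (Suc n)"]]
    show ?case by (simp only: sum.atMost_Suc) simp
  qed
  have eq: "(\<Sum>i\<le>n. of_real (1 / fact i) * (\<Phi> \<zeta> * \<theta> \<zeta> ^ i)) = \<Phi> \<zeta> * (\<Sum>i\<le>n. \<theta> \<zeta> ^ i /\<^sub>R fact i)" for n \<zeta>
    by (simp add: sum_distrib_left scaleR_conv_of_real field_simps)
  show ?thesis
  proof (rule tilt_pos_limit[OF sum])
    show "norm (\<Sum>i\<le>n. of_real (1 / fact i) * (\<Phi> \<zeta> * \<theta> \<zeta> ^ i)) \<le> C * exp B" if "Re \<zeta> \<in> {0, 1}" for n \<zeta>
    proof -
      have "norm (\<Sum>i\<le>n. \<theta> \<zeta> ^ i /\<^sub>R fact i) \<le> (\<Sum>i\<le>n. B ^ i /\<^sub>R fact i)"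
        by (rule order_trans[OF norm_sum])
          (use bd[OF that] in \<open>auto simp: norm_power intro!: sum_mono divide_right_mono mult_left_mono power_mono\<close>)
      also have "\<dots> \<le> exp B"
        unfolding exp_def using B0
        by (intro sum_le_suminf summable_exp_generic) auto
      finally show ?thesis
        unfolding eq norm_mult using C that by (intro mult_mono) auto
    qed
    show "(\<lambda>n. \<Sum>i\<le>n. of_real (1 / fact i) * (\<Phi> \<zeta> * \<theta> \<zeta> ^ i)) \<longlonglongrightarrow> \<Phi> \<zeta> * exp (\<theta> \<zeta>)" if "Re \<zeta> \<in> {0, 1}" for \<zeta>
      unfolding eq using exp_converges[of "\<theta> \<zeta>"]
      by (intro tendsto_mult_left) (simp add: sums_def_le)
  qed
qed

text \<open>The Gaussian factor is a limit of compound Poisson factors with jumps \<open>t n\<close>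
  and \<open>- t n\<close> of rate \<open>r n\<close> each. The exponent \<open>w n\<close> is
  \<open>b\<^sup>2 / 2\<close> times the square of a symmetric difference quotient of the map from
  \<open>h\<close> to \<open>exp (\<zeta> * h)\<close> at 0, whose limit is
  \<open>\<zeta>\<close>.\<close>

lemma tilt_pos_gaussian:
  assumes \<Phi>: "tilt_pos \<Phi>"
  shows "tilt_pos (\<lambda>\<zeta>. \<Phi> \<zeta> * exp (of_real (b\<^sup>2 / 2) * \<zeta>\<^sup>2))"
proof -
  obtain C where C: "C \<ge> 0" "\<forall>\<zeta>. Re \<zeta> \<in> {0, 1} \<longrightarrow> norm (\<Phi> \<zeta>) \<le> C"
    using tilt_posD(1)[OF \<Phi>] by blast
  define t where "t n = 1 / (real n + 1)" for n :: nat
  have t: "t n > 0" "t n \<le> 1" for n by (auto simp: t_def)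
  have t0: "t \<longlonglongrightarrow> 0"
    unfolding t_def using LIMSEQ_inverse_real_of_nat by (simp add: inverse_eq_divide add.commute)
  define r where "r n = b\<^sup>2 / (2 * (t n)\<^sup>2)" for n
  have r: "r n \<ge> 0" for n by (simp add: r_def)
  define w where "w n \<zeta> = of_real (r n) * (exp (\<zeta> * of_real (t n)) + exp (\<zeta> * of_real (- t n)) - 2)" for n and \<zeta> :: complex
  have m: "tilt_pos (\<lambda>\<zeta>. \<Psi> \<zeta> * exp (of_real (r n) * exp (\<zeta> * of_real a)))" if "tilt_pos \<Psi>" for \<Psi> n a
  proof (rule tilt_pos_exp[OF that])
    show "tilt_pos (\<lambda>\<zeta>. \<Psi>' \<zeta> * (of_real (r n) * exp (\<zeta> * of_real a)))" if "tilt_pos \<Psi>'" for \<Psi>'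
      using tilt_pos_scale[OF tilt_pos_shift[OF that, of a] r[of n]] by (simp add: mult_ac)
    show "norm (of_real (r n) * exp (\<zeta> * of_real a)) \<le> r n * exp \<bar>a\<bar>" if "Re \<zeta> \<in> {0, 1}" for \<zeta>
      using that r[of n] by (auto simp: norm_mult intro!: mult_left_mono)
  qed
  have F: "tilt_pos (\<lambda>\<zeta>. \<Phi> \<zeta> * exp (w n \<zeta>))" for n
  proof -
    have *: "\<Phi> \<zeta> * exp (w n \<zeta>) = of_real (exp (- 2 * r n)) * (\<Phi> \<zeta> * exp (of_real (r n) * exp (\<zeta> * of_real (t n)))
        * exp (of_real (r n) * exp (\<zeta> * of_real (- t n))))" for \<zeta>
      by (simp add: w_def exp_add exp_diff exp_minus exp_of_real[symmetric] algebra_simps divide_inverse)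
    show ?thesis
      unfolding * by (intro tilt_pos_scale m \<Phi>) simp
  qed
  have sq: "exp (\<zeta> * of_real (t n)) + exp (\<zeta> * of_real (- t n)) - 2
      = (exp (\<zeta> * of_real (t n / 2)) - exp (\<zeta> * of_real (- t n / 2)))\<^sup>2" for \<zeta> :: complex and n
    by (simp add: power2_diff power2_eq_square exp_add[symmetric] exp_minus field_simps)
  have d: "(\<lambda>n. (exp (\<zeta> * of_real (t n / 2)) - exp (\<zeta> * of_real (- t n / 2))) / of_real (t n)) \<longlonglongrightarrow> \<zeta>" for \<zeta> :: complex
  proof -
    have "((\<lambda>h. exp (\<zeta> * (h / 2)) - exp (\<zeta> * (- h / 2))) has_field_derivative \<zeta>) (at 0)"
      by (auto intro!: derivative_eq_intros)
    then have "((\<lambda>h. (exp (\<zeta> * (h / 2)) - exp (\<zeta> * (- h / 2))) / h) \<longlongrightarrow> \<zeta>) (at 0)"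
      by (simp add: has_field_derivative_iff)
    moreover have "filterlim (\<lambda>n. complex_of_real (t n)) (at 0) sequentially"
      using t tendsto_of_real[OF t0, where 'a=complex]
      by (auto simp: filterlim_at less_imp_neq[symmetric] intro!: always_eventually)
    ultimately show ?thesis
      using filterlim_compose[of "\<lambda>h. (exp (\<zeta> * (h / 2)) - exp (\<zeta> * (- h / 2))) / h" "nhds \<zeta>" "at 0" "\<lambda>n. complex_of_real (t n)" sequentially]
      by simp
  qed
  have wn: "w n \<zeta> = of_real (b\<^sup>2 / 2) * ((exp (\<zeta> * of_real (t n / 2)) - exp (\<zeta> * of_real (- t n / 2))) / of_real (t n))\<^sup>2" for n \<zeta>
    using t[of n] unfolding w_def sq r_def by (simp add: power_divide field_simps)
  have lim: "(\<lambda>n. w n \<zeta>) \<longlonglongrightarrow> of_real (b\<^sup>2 / 2) * \<zeta>\<^sup>2" for \<zeta>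
    unfolding wn by (intro tendsto_intros d)
  \<comment> \<open>On a vertical line the real part of \<open>w n\<close> is largest on the real
    axis, so a uniform bound is required only at 0, where \<open>w n\<close> vanishes, and at
    1.\<close>
  have "Bseq (\<lambda>n. w n 1)" using lim[of 1] by (rule convergent_imp_Bseq[OF convergentI])
  then obtain K where K: "\<And>n. norm (w n 1) \<le> K" unfolding Bseq_def by blast
  show ?thesis
  proof (rule tilt_pos_limit[OF F])
    show "(\<lambda>n. \<Phi> \<zeta> * exp (w n \<zeta>)) \<longlonglongrightarrow> \<Phi> \<zeta> * exp (of_real (b\<^sup>2 / 2) * \<zeta>\<^sup>2)" for \<zeta>
      by (intro tendsto_intros lim)
    show "norm (\<Phi> \<zeta> * exp (w n \<zeta>)) \<le> C * exp K" if "Re \<zeta> \<in> {0, 1}" for n \<zeta>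
    proof -
      have "Re (exp (\<zeta> * of_real a)) \<le> exp (Re \<zeta> * a)" for a
        using complex_Re_le_cmod[of "exp (\<zeta> * of_real a)"] by simp
      from add_mono[OF this[of "t n"] this[of "- t n"]]
      have "Re (w n \<zeta>) \<le> r n * (exp (Re \<zeta> * t n) + exp (Re \<zeta> * (- t n)) - 2)"
        unfolding w_def using r[of n] by (simp add: mult_left_mono)
      also have "\<dots> = Re (w n (of_real (Re \<zeta>)))"
        by (simp add: w_def Re_exp)
      also have "\<dots> \<le> norm (w n (of_real (Re \<zeta>)))" by (rule complex_Re_le_cmod)
      also have "\<dots> \<le> K"
        using that K[of n] order_trans[OF norm_ge_zero K[of n]] by (auto simp: w_def)
      finally show ?thesis
        using C that by (auto simp: norm_mult intro!: mult_mono)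
    qed
  qed
qed

text \<open>The damping is removed by letting its width tend to 0. The evaluation point in the
  tilting relation moves with the width, which is why the limit of \<open>gfinv\<close> is taken
  along a convergent sequence of points.\<close>

lemma tilt_pos_finv:
  assumes \<Phi>: "tilt_pos \<Phi>" and i0: "integrable lborel (\<lambda>z. \<Phi> (Complex 0 z))"
  shows "finv (\<lambda>z. \<Phi> (Complex 0 z)) x \<in> \<real>\<^sub>\<ge>\<^sub>0"
    and "integrable lborel (\<lambda>z. \<Phi> (Complex 1 z)) \<Longrightarrow>
      finv (\<lambda>z. \<Phi> (Complex 1 z)) x = of_real (exp x) * finv (\<lambda>z. \<Phi> (Complex 0 z)) x"
proof -
  define t where "t n = 1 / (real n + 1)" for n :: nat
  have t: "t n > 0" for n by (auto simp: t_def)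
  have t0: "t \<longlonglongrightarrow> 0"
    unfolding t_def using LIMSEQ_inverse_real_of_nat by (simp add: inverse_eq_divide add.commute)
  have "(\<lambda>n. gfinv (t n) (\<lambda>z. \<Phi> (Complex 0 z)) x) \<longlonglongrightarrow> finv (\<lambda>z. \<Phi> (Complex 0 z)) x"
    by (rule gfinv_tendsto[OF i0 t0]) simp
  then show "finv (\<lambda>z. \<Phi> (Complex 0 z)) x \<in> \<real>\<^sub>\<ge>\<^sub>0"
    by (rule Lim_in_closed_set[OF closed_nonneg_Reals_complex, rotated 2])
      (simp_all add: tilt_posD(3)[OF \<Phi> t])
  assume i1: "integrable lborel (\<lambda>z. \<Phi> (Complex 1 z))"
  have x': "(\<lambda>n. x + (t n)\<^sup>2) \<longlonglongrightarrow> x"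
    using tendsto_add[OF tendsto_const tendsto_power[OF t0, of 2], of x] by simp
  have e: "(\<lambda>n. complex_of_real (exp (x + (t n)\<^sup>2 / 2))) \<longlonglongrightarrow> of_real (exp (x + 0\<^sup>2 / 2))"
    by (intro tendsto_intros t0) simp
  have "(\<lambda>n. of_real (exp (x + (t n)\<^sup>2 / 2)) * gfinv (t n) (\<lambda>z. \<Phi> (Complex 0 z)) (x + (t n)\<^sup>2))
      \<longlonglongrightarrow> of_real (exp x) * finv (\<lambda>z. \<Phi> (Complex 0 z)) x"
    using tendsto_mult[OF e gfinv_tendsto[OF i0 t0 x']] by simp
  moreover have "(\<lambda>n. gfinv (t n) (\<lambda>z. \<Phi> (Complex 1 z)) x) \<longlonglongrightarrow> finv (\<lambda>z. \<Phi> (Complex 1 z)) x"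
    by (rule gfinv_tendsto[OF i1 t0]) simp
  ultimately show "finv (\<lambda>z. \<Phi> (Complex 1 z)) x = of_real (exp x) * finv (\<lambda>z. \<Phi> (Complex 0 z)) x"
    unfolding tilt_posD(4)[OF \<Phi> t] by (rule LIMSEQ_unique[rotated])
qed

section \<open>Splitting off the large jumps\<close>

text \<open>The Levy-Khintchine integrand continued to complex arguments: the imaginary axis gives
  the characteristic exponent, the line of real part 1 its exponential tilting.\<close>

definition kern :: "complex \<Rightarrow> real \<Rightarrow> complex" where
  "kern \<zeta> y = exp (\<zeta> * of_real y) - 1 - \<zeta> * of_real (y * indicator {-1..1} y)"

lemma kern_meas [measurable]: "kern \<zeta> \<in> borel_measurable borel"
  unfolding kern_def[abs_def] by measurable

lemma kern_small:
  assumes "\<bar>y\<bar> \<le> 1" "\<bar>Re \<zeta>\<bar> \<le> 1"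
  shows "norm (kern \<zeta> y) \<le> exp 1 * (norm \<zeta>)\<^sup>2 * min 1 (y\<^sup>2)"
proof -
  let ?w = "\<zeta> * of_real y"
  have y2: "y\<^sup>2 \<le> 1" using assms(1) by (simp add: abs_square_le_1)
  have "kern \<zeta> y = exp ?w - (\<Sum>k\<le>1. ?w ^ k / fact k)"
    using assms(1) by (simp add: kern_def indicator_def abs_le_iff)
  also have "norm \<dots> \<le> exp \<bar>Re ?w\<bar> * norm ?w ^ Suc 1 / fact 1" by (rule Taylor_exp)
  also have "\<dots> = exp \<bar>Re ?w\<bar> * ((norm \<zeta>)\<^sup>2 * y\<^sup>2)"
    by (simp add: norm_mult power_mult_distrib numeral_2_eq_2)
  also have "\<dots> \<le> exp 1 * ((norm \<zeta>)\<^sup>2 * y\<^sup>2)"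
  proof (rule mult_right_mono)
    have "\<bar>Re \<zeta>\<bar> * \<bar>y\<bar> \<le> 1 * 1" using assms by (intro mult_mono) auto
    then show "exp \<bar>Re ?w\<bar> \<le> exp 1" by (simp add: abs_mult)
  qed simp
  finally show ?thesis using y2 by (simp add: min_def mult.assoc)
qed

lemma kern_large: "1 < \<bar>y\<bar> \<Longrightarrow> kern \<zeta> y = exp (\<zeta> * of_real y) - 1"
  by (auto simp: kern_def indicator_def)

lemma min_one_sq: "1 < \<bar>y\<bar> \<Longrightarrow> min 1 (y\<^sup>2) = (1::real)"
  using abs_square_less_1[of y] by (auto simp: min_def)

text \<open>An upper cutoff on \<open>y\<close> suffices: for real part in \<open>[0, 1]\<close> the
  exponential has modulus at most 1 at negative jumps and at most \<open>exp R\<close> at positive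
  ones.\<close>

lemma kern_bound:
  assumes "0 \<le> Re \<zeta>" "Re \<zeta> \<le> 1" "y \<le> R" "1 \<le> R"
  shows "norm (kern \<zeta> y) \<le> (exp 1 * (norm \<zeta>)\<^sup>2 + exp R + 1) * min 1 (y\<^sup>2)"
proof (cases "\<bar>y\<bar> \<le> 1")
  case True
  have "norm (kern \<zeta> y) \<le> exp 1 * (norm \<zeta>)\<^sup>2 * min 1 (y\<^sup>2)" using True assms by (intro kern_small) auto
  also have "\<dots> \<le> (exp 1 * (norm \<zeta>)\<^sup>2 + exp R + 1) * min 1 (y\<^sup>2)"
    by (intro mult_right_mono) (auto simp: add_increasing2)
  finally show ?thesis .
next
  case False
  have "Re \<zeta> * y \<le> R"
  proof (cases "0 \<le> y")
    case True
    then have "Re \<zeta> * y \<le> 1 * y" using assms by (intro mult_right_mono) auto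
    then show ?thesis using assms by simp
  next
    case False
    then have "Re \<zeta> * y \<le> 0" using assms by (simp add: mult_nonneg_nonpos)
    then show ?thesis using assms by simp
  qed
  then have "norm (exp (\<zeta> * of_real y)) + norm (1 :: complex) \<le> exp R + 1" by simp
  moreover have "norm (kern \<zeta> y) \<le> norm (exp (\<zeta> * of_real y)) + norm (1 :: complex)"
    unfolding kern_large[OF False[unfolded not_le]] by (rule norm_triangle_ineq4)
  ultimately have "norm (kern \<zeta> y) \<le> exp R + 1" by linarith
  also have "\<dots> \<le> exp 1 * (norm \<zeta>)\<^sup>2 + exp R + 1" by simp
  finally show ?thesis unfolding min_one_sq[OF False[unfolded not_le]] by simp
qed

text \<open>On the imaginary axis the exponential has modulus 1, so no cutoff enters and the full
  exponent of \<open>\<mu>\<close> is covered.\<close>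

lemma kern_bound0:
  assumes "Re \<zeta> = 0"
  shows "norm (kern \<zeta> y) \<le> (exp 1 * (norm \<zeta>)\<^sup>2 + 2) * min 1 (y\<^sup>2)"
proof (cases "\<bar>y\<bar> \<le> 1")
  case True
  have "norm (kern \<zeta> y) \<le> exp 1 * (norm \<zeta>)\<^sup>2 * min 1 (y\<^sup>2)" using True assms by (intro kern_small) auto
  also have "\<dots> \<le> (exp 1 * (norm \<zeta>)\<^sup>2 + 2) * min 1 (y\<^sup>2)"
    by (intro mult_right_mono) auto
  finally show ?thesis .
next
  case False
  have "norm (exp (\<zeta> * of_real y)) + norm (1 :: complex) = 2" using assms by simp
  moreover have "norm (kern \<zeta> y) \<le> norm (exp (\<zeta> * of_real y)) + norm (1 :: complex)"
    unfolding kern_large[OF False[unfolded not_le]] by (rule norm_triangle_ineq4)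
  ultimately have "norm (kern \<zeta> y) \<le> 2" by linarith
  also have "\<dots> \<le> exp 1 * (norm \<zeta>)\<^sup>2 + 2" by simp
  finally show ?thesis unfolding min_one_sq[OF False[unfolded not_le]] by simp
qed

lemma Re_kern: "Re (kern (Complex s z) y) = exp (s * y) * cos (z * y) - 1 - s * (y * indicator {-1..1} y)"
  by (simp add: kern_def Re_exp)

lemma integrable_kern_0:
  assumes [measurable]: "g \<in> borel_measurable borel" "A \<in> sets borel" and g0: "\<And>x. 0 \<le> g x"
    and levy: "integrable lborel (\<lambda>y. min 1 (y\<^sup>2) * g y)"
  shows "integrable lborel (\<lambda>y. of_real (indicator A y * g y) * kern (Complex 0 z) y)"
proof (rule integrable_boundI)
  let ?C = "exp 1 * (norm (Complex 0 z))\<^sup>2 + 2"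
  show "integrable lborel (\<lambda>y. ?C * (min 1 (y\<^sup>2) * g y))" using levy by (rule integrable_mult_right)
  show "norm (of_real (indicator A y * g y) * kern (Complex 0 z) y) \<le> ?C * (min 1 (y\<^sup>2) * g y)" for y
  proof -
    have "norm (kern (Complex 0 z) y) \<le> ?C * min 1 (y\<^sup>2)" by (rule kern_bound0) simp
    from mult_left_mono[OF this g0[of y]]
    have "g y * norm (kern (Complex 0 z) y) \<le> ?C * (min 1 (y\<^sup>2) * g y)" by (simp only: mult_ac)
    moreover have "norm (of_real (indicator A y * g y) * kern (Complex 0 z) y) \<le> g y * norm (kern (Complex 0 z) y)"
      using g0[of y] by (simp add: norm_mult indicator_def)
    ultimately show ?thesis by linarith
  qed
qed measurable

text \<open>\<open>\<phi>\<close> stands for the characteristic function of \<open>\<mu>\<close>,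
  and the integrand in \<open>dom\<close> is the modulus of that of \<open>\<mu>\<^sub>p\<close>, to
  which only the real part of the exponent contributes.\<close>

locale levy_density =
  fixes g :: "real \<Rightarrow> real" and a b :: real and \<phi> :: "real \<Rightarrow> complex"
  assumes g_meas [measurable]: "g \<in> borel_measurable borel"
    and g_nonneg: "0 \<le> g y"
    and g_levy: "integrable lborel (\<lambda>y. min 1 (y\<^sup>2) * g y)"
    and \<phi>: "\<phi> z = exp ((CLINT y|lborel. of_real (g y) * kern (Complex 0 z) y)
          + of_real a * Complex 0 z + of_real (b\<^sup>2 / 2) * (Complex 0 z)\<^sup>2)"
    and \<phi>_cont: "continuous_on UNIV \<phi>"
    and dom: "integrable lborel (\<lambda>z. exp (LINT y|lborel. indicator {0..} y * (g y * (cos (z * y) - 1))))"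
begin

definition tail :: "real \<Rightarrow> real \<Rightarrow> real" where "tail R y = indicator {R<..} y * g y"
definition c :: "real \<Rightarrow> real" where "c R = (LINT y|lborel. tail R y)"
definition L :: real where "L = (LINT y|lborel. min 1 (y\<^sup>2) * g y)"

lemma tail_meas [measurable]: "tail R \<in> borel_measurable borel"
  unfolding tail_def[abs_def] by measurable

lemma tail_nonneg: "0 \<le> tail R y" using g_nonneg by (simp add: tail_def)

lemma tail_int: "1 \<le> R \<Longrightarrow> integrable lborel (tail R)"
proof (rule integrable_boundI[OF g_levy])
  assume R: "1 \<le> R"
  show "norm (tail R y) \<le> min 1 (y\<^sup>2) * g y" for y
  proof (cases "R < y")
    case True
    then have "min 1 (y\<^sup>2) = 1" using R by (intro min_one_sq) simp
    then show ?thesis using True g_nonneg by (simp add: tail_def)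
  qed (simp add: tail_def g_nonneg)
qed measurable

lemma c_nonneg: "0 \<le> c R" unfolding c_def using tail_nonneg by (simp add: integral_nonneg_AE)

lemma L_nonneg: "0 \<le> L" unfolding L_def using g_nonneg by (simp add: integral_nonneg_AE)

section \<open>Transforms of the factors with restricted jumps, on the lines of real part 0 and
  1\<close>

definition levy_exp :: "real set \<Rightarrow> complex \<Rightarrow> complex" where
  "levy_exp A \<zeta> = (CLINT y|lborel. of_real (indicator A y * g y) * kern \<zeta> y)"

lemma levy_exp_int:
  assumes "A \<in> sets borel" "A \<subseteq> {..R}" "1 \<le> R" "0 \<le> Re \<zeta>" "Re \<zeta> \<le> 1"
  shows "integrable lborel (\<lambda>y. of_real (indicator A y * g y) * kern \<zeta> y)"
    and "norm (of_real (indicator A y * g y) * kern \<zeta> y) \<le> (exp 1 * (norm \<zeta>)\<^sup>2 + exp R + 1) * (min 1 (y\<^sup>2) * g y)"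
proof -
  let ?C = "exp 1 * (norm \<zeta>)\<^sup>2 + exp R + 1"
  have C: "0 \<le> ?C" by (simp add: add_nonneg_nonneg)
  show bd: "norm (of_real (indicator A y * g y) * kern \<zeta> y) \<le> ?C * (min 1 (y\<^sup>2) * g y)" for y
  proof (cases "y \<in> A")
    case True
    then have "norm (kern \<zeta> y) \<le> ?C * min 1 (y\<^sup>2)" using assms by (intro kern_bound) auto
    from mult_left_mono[OF this g_nonneg[of y]] show ?thesis
      using True g_nonneg[of y] by (simp add: norm_mult mult_ac)
  next
    case False
    then show ?thesis using C g_nonneg[of y] by simp
  qed
  have [measurable]: "A \<in> sets borel" by fact
  show "integrable lborel (\<lambda>y. of_real (indicator A y * g y) * kern \<zeta> y)"
    by (rule integrable_boundI[OF integrable_mult_right[OF g_levy, of ?C] _ bd]) measurable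
qed

lemma Re_levy_exp:
  assumes "A \<in> sets borel" "A \<subseteq> {..R}" "1 \<le> R" "0 \<le> s" "s \<le> 1"
  shows "Re (levy_exp A (Complex s z)) = (LINT y|lborel. indicator A y * g y * (exp (s * y) * cos (z * y) - 1 - s * (y * indicator {-1..1} y)))"
    and "integrable lborel (\<lambda>y. indicator A y * g y * (exp (s * y) * cos (z * y) - 1 - s * (y * indicator {-1..1} y)))"
proof -
  have i: "integrable lborel (\<lambda>y. of_real (indicator A y * g y) * kern (Complex s z) y)"
    using levy_exp_int(1)[OF assms(1-3), of "Complex s z"] assms by simp
  have e: "Re (of_real (indicator A y * g y) * kern (Complex s z) y)
      = indicator A y * g y * (exp (s * y) * cos (z * y) - 1 - s * (y * indicator {-1..1} y))" for y
    by (simp only: Re_kern Re_complex_of_real Im_complex_of_real times_complex.sel mult_zero_left diff_zero)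
  show "Re (levy_exp A (Complex s z)) = (LINT y|lborel. indicator A y * g y * (exp (s * y) * cos (z * y) - 1 - s * (y * indicator {-1..1} y)))"
    unfolding levy_exp_def integral_Re[OF i, symmetric] e ..
  show "integrable lborel (\<lambda>y. indicator A y * g y * (exp (s * y) * cos (z * y) - 1 - s * (y * indicator {-1..1} y)))"
    using integrable_Re[OF i] unfolding e .
qed

lemma Re_levy_exp_0:
  assumes "A \<in> sets borel" "A \<subseteq> {..R}" "1 \<le> R" "s \<in> {0, 1}"
  shows "Re (levy_exp A (Complex s 0)) \<le> (exp 1 + exp R + 1) * L"
proof -
  have s: "0 \<le> s" "s \<le> 1" using assms by auto
  have "norm (levy_exp A (Complex s 0)) \<le> (LINT y|lborel. norm (of_real (indicator A y * g y) * kern (Complex s 0) y))"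
    unfolding levy_exp_def by (rule integral_norm_bound)
  also have "\<dots> \<le> (LINT y|lborel. (exp 1 * (norm (Complex s 0))\<^sup>2 + exp R + 1) * (min 1 (y\<^sup>2) * g y))"
  proof (rule integral_mono)
    show "integrable lborel (\<lambda>y. norm (of_real (indicator A y * g y) * kern (Complex s 0) y))"
      using levy_exp_int(1)[OF assms(1-3), of "Complex s 0"] s by (intro integrable_norm) simp
    show "integrable lborel (\<lambda>y. (exp 1 * (norm (Complex s 0))\<^sup>2 + exp R + 1) * (min 1 (y\<^sup>2) * g y))"
      using g_levy by (rule integrable_mult_right)
    show "norm (of_real (indicator A y * g y) * kern (Complex s 0) y)
        \<le> (exp 1 * (norm (Complex s 0))\<^sup>2 + exp R + 1) * (min 1 (y\<^sup>2) * g y)" for y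
      using s by (intro levy_exp_int(2)[OF assms(1-3)]) auto
  qed
  also have "\<dots> = (exp 1 * (norm (Complex s 0))\<^sup>2 + exp R + 1) * L"
    by (simp only: L_def integral_mult_right_zero)
  also have "\<dots> \<le> (exp 1 + exp R + 1) * L"
    using assms(4) L_nonneg by (intro mult_right_mono) (auto simp: cmod_def)
  finally show ?thesis using complex_Re_le_cmod[of "levy_exp A (Complex s 0)"] by linarith
qed

text \<open>The Laplace transform of \<open>\<mu>\<close> with the jumps outside \<open>A\<close>
  removed; drift, Gaussian part and the compensation of the small jumps in \<open>A\<close> are
  kept.\<close>

definition trunc :: "real set \<Rightarrow> complex \<Rightarrow> complex" where
  "trunc A \<zeta> = exp (levy_exp A \<zeta> + of_real a * \<zeta> + of_real (b\<^sup>2 / 2) * \<zeta>\<^sup>2)"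

definition trunc_bound :: "real \<Rightarrow> real" where
  "trunc_bound R = exp ((exp 1 + exp R + 1) * L + \<bar>a\<bar> + b\<^sup>2 / 2)"

lemma Re_rest:
  assumes "s \<in> {0, 1}"
  shows "Re (of_real a * Complex s z + of_real (b\<^sup>2 / 2) * (Complex s z)\<^sup>2) \<le> \<bar>a\<bar> + b\<^sup>2 / 2"
proof -
  have "a * s \<le> \<bar>a\<bar>" using assms by auto
  moreover have "s\<^sup>2 \<le> 1" using assms by auto
  then have "s\<^sup>2 - z\<^sup>2 \<le> 1" using zero_le_power2[of z] by linarith
  then have "b\<^sup>2 / 2 * (s\<^sup>2 - z\<^sup>2) \<le> b\<^sup>2 / 2 * 1" by (intro mult_left_mono) auto
  moreover have "Re (of_real a * Complex s z + of_real (b\<^sup>2 / 2) * (Complex s z)\<^sup>2) = a * s + b\<^sup>2 / 2 * (s\<^sup>2 - z\<^sup>2)"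
    by (simp add: power2_eq_square)
  ultimately show ?thesis by linarith
qed

text \<open>As the cosine is at most 1, the real part of the jump exponent is largest on the real
  axis. The bound depends on \<open>A\<close> only through the cutoff \<open>R\<close>, so it is
  uniform along a sequence of sets.\<close>

lemma norm_trunc_le:
  assumes "A \<in> sets borel" "A \<subseteq> {..R}" "1 \<le> R" "Re \<zeta> \<in> {0, 1}"
  shows "norm (trunc A \<zeta>) \<le> trunc_bound R"
proof -
  obtain s z where \<zeta>: "\<zeta> = Complex s z" by (cases \<zeta>)
  have s: "s \<in> {0, 1}" "0 \<le> s" "s \<le> 1" using assms(4) \<zeta> by auto
  have "Re (levy_exp A (Complex s z)) \<le> Re (levy_exp A (Complex s 0))"
    unfolding Re_levy_exp(1)[OF assms(1-3) s(2,3)]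
  proof (rule integral_mono[OF Re_levy_exp(2)[OF assms(1-3) s(2,3)] Re_levy_exp(2)[OF assms(1-3) s(2,3)]])
    fix y
    show "indicator A y * g y * (exp (s * y) * cos (z * y) - 1 - s * (y * indicator {-1..1} y))
        \<le> indicator A y * g y * (exp (s * y) * cos (0 * y) - 1 - s * (y * indicator {-1..1} y))"
      using g_nonneg by (intro mult_left_mono) auto
  qed
  also have "\<dots> \<le> (exp 1 + exp R + 1) * L" by (rule Re_levy_exp_0[OF assms(1-3) s(1)])
  finally have "Re (levy_exp A \<zeta> + of_real a * \<zeta> + of_real (b\<^sup>2 / 2) * \<zeta>\<^sup>2) \<le> (exp 1 + exp R + 1) * L + (\<bar>a\<bar> + b\<^sup>2 / 2)"
    using Re_rest[OF s(1), of z] by (simp only: \<zeta> plus_complex.sel add.assoc add_mono)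
  then show ?thesis unfolding trunc_def norm_exp_eq_Re trunc_bound_def by (simp add: add.assoc)
qed

text \<open>With jumps bounded away from 0 the jump measure is finite and its exponent splits into
  transform, mass and linear compensation; \<open>trunc\<close> is then a positive constant times a
  compound Poisson, a drift and a Gaussian transform.\<close>

lemma tilt_pos_away:
  assumes R: "1 \<le> R" and d: "0 < d" "d \<le> 1"
  shows "tilt_pos (trunc ({..R} \<inter> {y. d < \<bar>y\<bar>}))"
proof -
  define S where "S = {..R} \<inter> {y. d < \<bar>y\<bar>}"
  have S [measurable]: "S \<in> sets borel" unfolding S_def by measurable
  have SR: "S \<subseteq> {..R}" by (auto simp: S_def)
  define w where "w y = indicator S y * g y" for y
  have [measurable]: "w \<in> borel_measurable borel" unfolding w_def[abs_def] by measurable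
  have w0: "0 \<le> w y" for y using g_nonneg by (simp add: w_def)
  have w_le: "w y \<le> (1 / d\<^sup>2) * (min 1 (y\<^sup>2) * g y)" for y
  proof (cases "y \<in> S")
    case True
    then have "d\<^sup>2 \<le> y\<^sup>2" using d power_mono[of d "\<bar>y\<bar>" 2] by (simp add: S_def)
    moreover have "d\<^sup>2 \<le> 1" using d by (simp add: power_le_one)
    ultimately have "d\<^sup>2 \<le> min 1 (y\<^sup>2)" by simp
    from mult_right_mono[OF this g_nonneg[of y]] show ?thesis using True d by (simp add: w_def field_simps)
  next
    case False
    then show ?thesis using g_nonneg by (simp add: w_def)
  qed
  have w_int: "integrable lborel w"
    by (rule integrable_boundI[OF integrable_mult_right[OF g_levy, of "1 / d\<^sup>2"]]) (use w_le w0 in auto)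
  let ?M = "density lborel (\<lambda>y. ennreal (w y))"
  have M: "finite_measure ?M"
    by (rule finite_measureI) (simp add: emeasure_density nn_integral_eq_integral[OF w_int] w0)
  have exp_le: "norm (exp (\<zeta> * complex_of_real y)) \<le> exp R" if "y \<in> S" "Re \<zeta> \<in> {0, 1}" for y \<zeta>
    using that R by (auto simp: S_def)
  have exp_w: "norm (of_real (w y) * exp (\<zeta> * complex_of_real y)) \<le> exp R * w y" if "Re \<zeta> \<in> {0, 1}" for y \<zeta>
  proof (cases "y \<in> S")
    case True
    from mult_left_mono[OF exp_le[OF True that] w0[of y]] show ?thesis
      using w0[of y] by (simp add: norm_mult mult.commute)
  qed (simp add: w_def)
  have int_exp: "integrable lborel (\<lambda>y. of_real (w y) * exp (\<zeta> * complex_of_real y))" if "Re \<zeta> \<in> {0, 1}" for \<zeta>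
    by (rule integrable_boundI[OF integrable_mult_right[OF w_int, of "exp R"] _ exp_w[OF that]]) measurable
  have "integrable lborel (\<lambda>y. w y * exp y)"
  proof -
    have eq: "Re (of_real (w y) * exp (1 * complex_of_real y)) = w y * exp y" for y
      by (simp add: Re_exp)
    have "integrable lborel (\<lambda>y. of_real (w y) * exp (1 * complex_of_real y))"
      by (rule int_exp) simp
    from integrable_Re[OF this] show ?thesis unfolding eq .
  qed
  then have M_exp: "integrable ?M (\<lambda>y. exp y)"
    using w0 by (subst integrable_density) auto
  define tail_ft where "tail_ft \<zeta> = (CLINT y|?M. exp (\<zeta> * of_real y))" for \<zeta>
  have tail_ft: "tail_ft \<zeta> = (CLINT y|lborel. of_real (w y) * exp (\<zeta> * of_real y))" for \<zeta>
    unfolding tail_ft_def using w0 by (subst integral_density) (auto simp: scaleR_conv_of_real)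
  define l where "l = (LINT y|lborel. w y)"
  define m where "m = (LINT y|lborel. w y * (y * indicator {-1..1} y))"
  have m_int: "integrable lborel (\<lambda>y. w y * (y * indicator {-1..1} y))"
    by (rule integrable_boundI[OF w_int]) (auto simp: indicator_def abs_mult mult_left_le abs_le_iff w0)
  have ex_eq: "levy_exp S \<zeta> = tail_ft \<zeta> - of_real l - \<zeta> * of_real m" if "Re \<zeta> \<in> {0, 1}" for \<zeta>
  proof -
    have "levy_exp S \<zeta> = (CLINT y|lborel. of_real (w y) * exp (\<zeta> * of_real y) - of_real (w y) - \<zeta> * of_real (w y * (y * indicator {-1..1} y)))"
      unfolding levy_exp_def w_def kern_def
      by (intro Bochner_Integration.integral_cong refl) (simp add: algebra_simps)
    also have "\<dots> = tail_ft \<zeta> - of_real l - \<zeta> * of_real m"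
      unfolding tail_ft l_def m_def integral_complex_of_real[symmetric] integral_mult_right_zero[symmetric]
      using int_exp[OF that] w_int m_int
      by (subst Bochner_Integration.integral_diff; (subst Bochner_Integration.integral_diff)?)
        (auto intro!: integrable_mult_right simp del: of_real_mult integral_mult_right_zero)
    finally show ?thesis .
  qed
  have "tilt_pos (\<lambda>\<zeta>. of_real (exp (- l)) * (1 * exp (tail_ft \<zeta>) * exp (\<zeta> * of_real (a - m)) * exp (of_real (b\<^sup>2 / 2) * \<zeta>\<^sup>2)))"
  proof (intro tilt_pos_scale tilt_pos_gaussian tilt_pos_shift)
    show "tilt_pos (\<lambda>\<zeta>. 1 * exp (tail_ft \<zeta>))"
    proof (rule tilt_pos_exp[OF tilt_pos_one])
      show "tilt_pos (\<lambda>\<zeta>. \<Psi> \<zeta> * tail_ft \<zeta>)" if "tilt_pos \<Psi>" for \<Psi>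
        unfolding tail_ft_def by (rule tilt_pos_mult_measure[OF that M _ M_exp]) simp
      show "norm (tail_ft \<zeta>) \<le> exp R * l" if "Re \<zeta> \<in> {0, 1}" for \<zeta>
      proof -
        have "norm (tail_ft \<zeta>) \<le> (LINT y|lborel. norm (of_real (w y) * exp (\<zeta> * complex_of_real y)))"
          unfolding tail_ft by (rule integral_norm_bound)
        also have "\<dots> \<le> (LINT y|lborel. exp R * w y)"
        proof (rule integral_mono)
          show "integrable lborel (\<lambda>y. norm (of_real (w y) * exp (\<zeta> * complex_of_real y)))"
            using int_exp[OF that] by (rule integrable_norm)
          show "integrable lborel (\<lambda>y. exp R * w y)" using w_int by simp
        qed (rule exp_w[OF that])
        finally show ?thesis by (simp add: l_def)
      qed
    qed
  qed simp
  then have Psi: "tilt_pos (\<lambda>\<zeta>. of_real (exp (- l)) * (1 * exp (tail_ft \<zeta>) * exp (\<zeta> * of_real (a - m)) * exp (of_real (b\<^sup>2 / 2) * \<zeta>\<^sup>2)))" .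
  have eq: "trunc S \<zeta> = of_real (exp (- l)) * (1 * exp (tail_ft \<zeta>) * exp (\<zeta> * of_real (a - m)) * exp (of_real (b\<^sup>2 / 2) * \<zeta>\<^sup>2))"
    if "Re \<zeta> \<in> {0, 1}" for \<zeta>
    unfolding trunc_def ex_eq[OF that] exp_of_real[symmetric] mult_1 exp_add[symmetric]
    by (rule arg_cong[where f=exp]) (simp add: algebra_simps)
  \<comment> \<open>The product formula is established only on the two lines; as the limit of a
    constant sequence, \<open>trunc\<close> inherits the property from a function that agrees with
    it there.\<close>
  show ?thesis
    unfolding S_def[symmetric]
    by (rule tilt_pos_limit[OF Psi, of "trunc_bound R"]) (use norm_trunc_le[OF S SR R] eq in \<open>auto simp del: insert_iff\<close>)
qed

text \<open>The small jumps are restored by letting the gap around 0 shrink, with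
  \<open>trunc_bound R\<close> as a common bound for all gaps.\<close>

lemma tilt_pos_trunc:
  assumes R: "1 \<le> R"
  shows "tilt_pos (trunc {..R})"
proof -
  define S where "S n = {..R} \<inter> {y. 1 / (real n + 1) < \<bar>y\<bar>}" for n :: nat
  have "S n \<in> sets borel" for n unfolding S_def by measurable
  moreover have "S n \<subseteq> {..R}" for n unfolding S_def by auto
  ultimately have S: "S n \<in> sets borel" "S n \<subseteq> {..R}" for n by blast+
  show ?thesis
  proof (rule tilt_pos_limit)
    show "tilt_pos (trunc (S n))" for n
      unfolding S_def by (rule tilt_pos_away[OF R]) auto
    show "norm (trunc (S n) \<zeta>) \<le> trunc_bound R" if "Re \<zeta> \<in> {0, 1}" for n \<zeta>
      by (rule norm_trunc_le[OF S R that])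
    show "(\<lambda>n. trunc (S n) \<zeta>) \<longlonglongrightarrow> trunc {..R} \<zeta>" if "Re \<zeta> \<in> {0, 1}" for \<zeta>
    proof -
      have s: "0 \<le> Re \<zeta>" "Re \<zeta> \<le> 1" using that by auto
      have "(\<lambda>n. levy_exp (S n) \<zeta>) \<longlonglongrightarrow> levy_exp {..R} \<zeta>"
        unfolding levy_exp_def
      proof (rule integral_dominated_convergence)
        show "integrable lborel (\<lambda>y. (exp 1 * (norm \<zeta>)\<^sup>2 + exp R + 1) * (min 1 (y\<^sup>2) * g y))"
          using g_levy by (rule integrable_mult_right)
        show "AE y in lborel. norm (of_real (indicator (S n) y * g y) * kern \<zeta> y)
            \<le> (exp 1 * (norm \<zeta>)\<^sup>2 + exp R + 1) * (min 1 (y\<^sup>2) * g y)" for n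
          by (intro always_eventually allI levy_exp_int(2)[OF S R s])
        show "AE y in lborel. (\<lambda>n. of_real (indicator (S n) y * g y) * kern \<zeta> y)
            \<longlonglongrightarrow> of_real (indicator {..R} y * g y) * kern \<zeta> y"
        proof (rule always_eventually, rule allI, rule tendsto_eventually)
          fix y
          show "\<forall>\<^sub>F n in sequentially. of_real (indicator (S n) y * g y) * kern \<zeta> y
              = of_real (indicator {..R} y * g y) * kern \<zeta> y"
          \<comment> \<open>No set \<open>S n\<close> contains the point 0, but the kernel vanishes
            there.\<close>
          proof (cases "y = 0")
            case True
            then show ?thesis by (simp add: kern_def)
          next
            case False
            have "(\<lambda>n. 1 / (real n + 1)) \<longlonglongrightarrow> 0"
              using LIMSEQ_inverse_real_of_nat by (simp add: inverse_eq_divide add.commute)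
            then have "\<forall>\<^sub>F n in sequentially. 1 / (real n + 1) < \<bar>y\<bar>"
              by (rule order_tendstoD(2)) (use False in simp)
            then show ?thesis by eventually_elim (simp add: S_def indicator_def)
          qed
        qed
        show "(\<lambda>y. of_real (indicator (S n) y * g y) * kern \<zeta> y) \<in> borel_measurable lborel" for n
          using S(1)[of n] by measurable
      qed measurable
      then show ?thesis unfolding trunc_def by (intro tendsto_intros)
    qed
  qed
qed

definition dom_fun :: "real \<Rightarrow> real" where
  "dom_fun z = exp (LINT y|lborel. indicator {0..} y * (g y * (cos (z * y) - 1)))"

text \<open>This is where the integrability of the transform of \<open>\<mu>\<^sub>p\<close> enters: tilting by \<open>exp\<close> increases
  the density of the positive jumps, and so only shrinks the modulus of the transform.\<close>

lemma norm_trunc_dom: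
  assumes R: "1 \<le> R" and s: "s \<in> {0, 1}"
  shows "norm (trunc {..R} (Complex s z)) \<le> trunc_bound R * exp (2 * c R) * dom_fun z"
proof -
  have s': "0 \<le> s" "s \<le> 1" using s by auto
  have A: "{..R} \<in> sets borel" "{..R} \<subseteq> {..R}" by auto
  let ?I = "\<lambda>y. indicator {0..} y * (g y * (cos (z * y) - 1))"
  let ?F = "\<lambda>z y. indicator {..R} y * g y * (exp (s * y) * cos (z * y) - 1 - s * (y * indicator {-1..1} y))"
  have iI: "integrable lborel ?I"
  proof -
    have i: "integrable lborel (\<lambda>y. of_real (indicator {0..} y * g y) * kern (Complex 0 z) y)"
      by (rule integrable_kern_0) (use g_nonneg g_levy in auto)
    have e: "Re (of_real (indicator {0..} y * g y) * kern (Complex 0 z) y) = ?I y" for y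
      by (simp add: Re_kern mult.assoc)
    show ?thesis using integrable_Re[OF i] unfolding e .
  qed
  \<comment> \<open>Up to the cutoff, \<open>?F z - ?F 0\<close> is
    \<open>exp (s * y) * (cos (z * y) - 1)\<close> times the density: for \<open>0 \<le> y\<close>
    this is at most \<open>?I\<close>, the exponential being at least 1, and for
    \<open>y < 0\<close> it is nonpositive. Above \<open>R\<close> only \<open>?I\<close> is
    present; it is at least \<open>- 2 * g\<close>, which \<open>2 * tail R\<close>
    compensates.\<close>
  have "Re (levy_exp {..R} (Complex s z)) \<le> (LINT y|lborel. ?F 0 y + ?I y + 2 * tail R y)"
    unfolding Re_levy_exp(1)[OF A R s']
  proof (rule integral_mono[OF Re_levy_exp(2)[OF A R s']])
    show "integrable lborel (\<lambda>y. ?F 0 y + ?I y + 2 * tail R y)"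
      by (intro Bochner_Integration.integrable_add Re_levy_exp(2)[OF A R s'] iI integrable_mult_right tail_int[OF R])
    fix y
    have cos: "cos (z * y) - 1 \<le> 0" "-1 \<le> cos (z * y)" by auto
    have split: "exp (s * y) * cos (z * y) - 1 - s * (y * indicator {-1..1} y)
       = (exp (s * y) * cos (0 * y) - 1 - s * (y * indicator {-1..1} y)) + exp (s * y) * (cos (z * y) - 1)"
      by (simp add: algebra_simps)
    consider "R < y" | "y \<le> R" "0 \<le> y" | "y \<le> R" "y < 0" by linarith
    then show "?F z y \<le> ?F 0 y + ?I y + 2 * tail R y"
    proof cases
      case 1
      have "0 \<le> g y * (cos (z * y) - 1) + 2 * g y"
        using mult_left_mono[OF cos(2) g_nonneg[of y]] by (simp add: algebra_simps)
      then show ?thesis using 1 R by (simp add: tail_def)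
    next
      case 2
      have "exp (s * y) * (cos (z * y) - 1) \<le> 1 * (cos (z * y) - 1)"
        using 2 s' cos by (intro mult_right_mono_neg) auto
      then have "g y * (exp (s * y) * (cos (z * y) - 1)) \<le> g y * (cos (z * y) - 1)"
        using g_nonneg by (intro mult_left_mono) auto
      then have "?F z y \<le> ?F 0 y + ?I y" unfolding split distrib_left using 2 by (simp add: mult.assoc)
      then show ?thesis using tail_nonneg[of R y] by linarith
    next
      case 3
      have "g y * (exp (s * y) * (cos (z * y) - 1)) \<le> 0"
        using g_nonneg[of y] cos(1) by (intro mult_nonneg_nonpos) auto
      then have "?F z y \<le> ?F 0 y + ?I y" unfolding split distrib_left using 3 by (simp add: mult.assoc)
      then show ?thesis using tail_nonneg[of R y] by linarith
    qed
  qed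
  also have "\<dots> = Re (levy_exp {..R} (Complex s 0)) + (LINT y|lborel. ?I y) + 2 * c R"
    unfolding Re_levy_exp(1)[OF A R s'] c_def integral_mult_right_zero[symmetric]
    using Re_levy_exp(2)[OF A R s', of 0] iI tail_int[OF R]
    by (subst Bochner_Integration.integral_add; (subst Bochner_Integration.integral_add)?)
       (auto simp del: integral_mult_right_zero)
  also have "\<dots> \<le> (exp 1 + exp R + 1) * L + (LINT y|lborel. ?I y) + 2 * c R"
    using Re_levy_exp_0[OF A R s] by simp
  finally have "Re (levy_exp {..R} (Complex s z) + of_real a * Complex s z + of_real (b\<^sup>2 / 2) * (Complex s z)\<^sup>2)
      \<le> ((exp 1 + exp R + 1) * L + \<bar>a\<bar> + b\<^sup>2 / 2) + 2 * c R + (LINT y|lborel. ?I y)"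
    using Re_rest[OF s, of z] by (simp only: plus_complex.sel add.assoc)
  then show ?thesis
    unfolding trunc_def norm_exp_eq_Re trunc_bound_def dom_fun_def exp_add[symmetric] by (simp only: exp_le_cancel_iff)
qed

lemma trunc_integrable:
  assumes R: "1 \<le> R" and s: "s \<in> {0, 1}"
  shows "integrable lborel (\<lambda>z. trunc {..R} (Complex s z))"
proof (rule integrable_boundI[OF _ _ norm_trunc_dom[OF R s]])
  show "integrable lborel (\<lambda>z. trunc_bound R * exp (2 * c R) * dom_fun z)"
    using dom unfolding dom_fun_def by (rule integrable_mult_right)
  show "(\<lambda>z. trunc {..R} (Complex s z)) \<in> borel_measurable lborel"
    using tilt_posD(2)[OF tilt_pos_trunc[OF R] s] by simp
qed

section \<open>Factorisation of the transform and the Poisson series\<close>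

definition tail_ft :: "real \<Rightarrow> real \<Rightarrow> complex" where
  "tail_ft R z = (CLINT y|lborel. of_real (tail R y) * iexp (z * y))"

definition \<phi>R :: "real \<Rightarrow> real \<Rightarrow> complex" where "\<phi>R R z = trunc {..R} (Complex 0 z)"

lemma norm_tail_ft_le: "1 \<le> R \<Longrightarrow> norm (tail_ft R z) \<le> c R"
  unfolding tail_ft_def c_def
  by (rule order_trans[OF integral_norm_bound]) (use tail_nonneg in \<open>simp add: norm_mult\<close>)

lemma tail_ft_finv: "tail_ft R z = finv (\<lambda>y. of_real (tail R y)) (- z)"
  unfolding tail_ft_def finv_def by (simp add: mult.commute)

lemma tail_ft_cont: "1 \<le> R \<Longrightarrow> continuous_on UNIV (tail_ft R)"
proof -
  assume "1 \<le> R"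
  then have "continuous_on UNIV (finv (\<lambda>y. of_real (tail R y)))"
    using tail_int by (intro continuous_finv integrable_of_real)
  then have "continuous_on UNIV (\<lambda>z. finv (\<lambda>y. of_real (tail R y)) (- z))"
    by (rule continuous_on_compose2) (auto intro: continuous_intros)
  then show ?thesis unfolding tail_ft_finv[abs_def] .
qed

lemma tail_ft_meas: "1 \<le> R \<Longrightarrow> tail_ft R \<in> borel_measurable borel"
  by (intro borel_measurable_continuous_onI tail_ft_cont)

text \<open>As \<open>R \<ge> 1\<close>, the jumps above \<open>R\<close> are not compensated and
  contribute exactly \<open>tail_ft R z - c R\<close> to the exponent.\<close>

lemma \<phi>_split:
  assumes R: "1 \<le> R"
  shows "\<phi> z = \<phi>R R z * exp (tail_ft R z - of_real (c R))"
proof -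
  have i1: "integrable lborel (\<lambda>y. of_real (indicator {..R} y * g y) * kern (Complex 0 z) y)"
    using levy_exp_int(1)[of "{..R}" R "Complex 0 z"] R by simp
  have i2: "integrable lborel (\<lambda>y. complex_of_real (tail R y) * iexp (z * y))"
    by (rule Bochner_Integration.integrable_bound[OF tail_int[OF R]]) (auto simp: norm_mult)
  have i3: "integrable lborel (\<lambda>y. complex_of_real (tail R y))"
    using tail_int[OF R] by (rule integrable_of_real)
  have "(CLINT y|lborel. of_real (g y) * kern (Complex 0 z) y)
    = (CLINT y|lborel. of_real (indicator {..R} y * g y) * kern (Complex 0 z) y
        + (of_real (tail R y) * iexp (z * y) - of_real (tail R y)))"
  proof (intro Bochner_Integration.integral_cong refl)
    fix y
    have e: "exp (Complex 0 z * complex_of_real y) = iexp (z * y)"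
      unfolding exp_Complex_mult by simp
    show "of_real (g y) * kern (Complex 0 z) y = of_real (indicator {..R} y * g y) * kern (Complex 0 z) y
        + (of_real (tail R y) * iexp (z * y) - of_real (tail R y))"
    proof (cases "y \<le> R")
      case False
      then have "kern (Complex 0 z) y = iexp (z * y) - 1"
        using R kern_large[of y "Complex 0 z"] unfolding e by simp
      then show ?thesis using False by (simp add: tail_def right_diff_distrib)
    qed (simp add: tail_def)
  qed
  also have "\<dots> = levy_exp {..R} (Complex 0 z) + (tail_ft R z - of_real (c R))"
    unfolding levy_exp_def tail_ft_def c_def using i1 i2 i3
    by (subst Bochner_Integration.integral_add, simp, simp, subst Bochner_Integration.integral_diff) auto
  finally have *: "(CLINT y|lborel. of_real (g y) * kern (Complex 0 z) y)
    = levy_exp {..R} (Complex 0 z) + (tail_ft R z - of_real (c R))" .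
  show ?thesis
    unfolding \<phi> * \<phi>R_def trunc_def exp_add[symmetric]
    by (rule arg_cong[where f=exp]) (simp only: add_ac)
qed

text \<open>The last bound is the exponential decay of the light factor: the tilted transform is
  integrable too, so its inverse is bounded, and that inverse is \<open>exp x\<close> times the
  inverse of \<open>\<phi>R R\<close>.\<close>

lemma \<phi>R_props:
  assumes R: "1 \<le> R"
  shows "integrable lborel (\<phi>R R)" "continuous_on UNIV (\<phi>R R)" "norm (\<phi>R R z) \<le> trunc_bound R"
    "finv (\<phi>R R) x \<in> \<real>\<^sub>\<ge>\<^sub>0"
    "norm (finv (\<phi>R R) x) \<le> (LINT z|lborel. norm (trunc {..R} (Complex 1 z))) * exp (- x)"
proof -
  show i: "integrable lborel (\<phi>R R)" unfolding \<phi>R_def[abs_def] by (rule trunc_integrable[OF R]) simp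
  \<comment> \<open>Dividing by the nonvanishing Poisson factor lets continuity be inherited from
    \<open>\<phi>\<close> and \<open>tail_ft\<close>.\<close>
  have "\<phi>R R z = \<phi> z * exp (of_real (c R) - tail_ft R z)" for z
    unfolding \<phi>_split[OF R] mult.assoc exp_add[symmetric] by simp
  then have eq: "\<phi>R R = (\<lambda>z. \<phi> z * exp (of_real (c R) - tail_ft R z))" by auto
  show "continuous_on UNIV (\<phi>R R)"
    unfolding eq by (intro continuous_intros \<phi>_cont tail_ft_cont R)
  show "norm (\<phi>R R z) \<le> trunc_bound R"
    unfolding \<phi>R_def by (rule norm_trunc_le[OF _ _ R]) auto
  show "finv (\<phi>R R) x \<in> \<real>\<^sub>\<ge>\<^sub>0"
    unfolding \<phi>R_def[abs_def] by (rule tilt_pos_finv(1)[OF tilt_pos_trunc[OF R] trunc_integrable[OF R]]) simp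
  have "finv (\<lambda>z. trunc {..R} (Complex 1 z)) x = of_real (exp x) * finv (\<phi>R R) x"
    unfolding \<phi>R_def[abs_def]
    by (rule tilt_pos_finv(2)[OF tilt_pos_trunc[OF R] trunc_integrable[OF R] trunc_integrable[OF R]]) auto
  then have "finv (\<phi>R R) x = of_real (exp (- x)) * finv (\<lambda>z. trunc {..R} (Complex 1 z)) x"
    by (simp add: exp_minus)
  then show "norm (finv (\<phi>R R) x) \<le> (LINT z|lborel. norm (trunc {..R} (Complex 1 z))) * exp (- x)"
    using norm_finv_le[of "\<lambda>z. trunc {..R} (Complex 1 z)" x] by (simp add: norm_mult mult.commute)
qed

text \<open>The compound Poisson factor has modulus at most 1; integrability thus passes from the
  truncated transform to that of \<open>\<mu>\<close>.\<close>

lemma norm_\<phi>_le: "norm (\<phi> z) \<le> norm (\<phi>R 1 z)"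
proof -
  have "Re (tail_ft 1 z) \<le> c 1" using norm_tail_ft_le[of 1 z] complex_Re_le_cmod[of "tail_ft 1 z"] by simp
  then have "norm (exp (tail_ft 1 z - of_real (c 1))) \<le> 1" by simp
  then show ?thesis unfolding \<phi>_split[OF order_refl] norm_mult by (rule mult_left_le) simp
qed

lemma \<phi>_int: "integrable lborel \<phi>"
proof (rule Bochner_Integration.integrable_bound[OF \<phi>R_props(1)[OF order_refl]])
  show "\<phi> \<in> borel_measurable lborel"
    using borel_measurable_continuous_onI[OF \<phi>_cont] by simp
qed (use norm_\<phi>_le in auto)

definition conv_ft :: "real \<Rightarrow> nat \<Rightarrow> real \<Rightarrow> complex" where
  "conv_ft R n x = finv (\<lambda>z. \<phi>R R z * tail_ft R z ^ n) x"

lemma conv_ft_int: "1 \<le> R \<Longrightarrow> integrable lborel (\<lambda>z. \<phi>R R z * tail_ft R z ^ n)"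
proof (rule integrable_boundI)
  assume R: "1 \<le> R"
  show "integrable lborel (\<lambda>z. c R ^ n * norm (\<phi>R R z))" using \<phi>R_props(1)[OF R] by simp
  have [measurable]: "tail_ft R \<in> borel_measurable borel" "\<phi>R R \<in> borel_measurable borel"
    using tail_ft_meas[OF R] borel_measurable_integrable[OF \<phi>R_props(1)[OF R]] by auto
  show "(\<lambda>z. \<phi>R R z * tail_ft R z ^ n) \<in> borel_measurable lborel" by measurable
  have "norm (tail_ft R z) ^ n \<le> c R ^ n" for z using norm_tail_ft_le[OF R] by (intro power_mono) auto
  then show "norm (\<phi>R R z * tail_ft R z ^ n) \<le> c R ^ n * norm (\<phi>R R z)" for z
    by (simp add: norm_mult norm_power mult.commute mult_right_mono)
qed

lemma conv_ft_Suc: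
  assumes R: "1 \<le> R"
  shows "conv_ft R (Suc n) x = (CLINT y|lborel. of_real (tail R y) * conv_ft R n (x - y))"
    and "integrable lborel (\<lambda>y. of_real (tail R y) * conv_ft R n (x - y))"
proof -
  have "(\<lambda>z. \<phi>R R z * tail_ft R z ^ Suc n) = (\<lambda>z. \<phi>R R z * tail_ft R z ^ n * (CLINT y|lborel. of_real (tail R y) * iexp (z * y)))"
    by (simp add: tail_ft_def mult_ac)
  then show "conv_ft R (Suc n) x = (CLINT y|lborel. of_real (tail R y) * conv_ft R n (x - y))"
    unfolding conv_ft_def using finv_convolution(1)[OF sigma_finite_lborel _ conv_ft_int[OF R, of n] tail_int[OF R], of x] by simp
  show "integrable lborel (\<lambda>y. of_real (tail R y) * conv_ft R n (x - y))"
    unfolding conv_ft_def using finv_convolution(2)[OF sigma_finite_lborel _ conv_ft_int[OF R, of n] tail_int[OF R], of x] by simp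
qed

lemma conv_ft_nonneg: "1 \<le> R \<Longrightarrow> conv_ft R n x \<in> \<real>\<^sub>\<ge>\<^sub>0"
proof (induction n arbitrary: x)
  case 0
  then show ?case using \<phi>R_props(4)[OF 0] by (simp add: conv_ft_def)
next
  case (Suc n)
  show ?case unfolding conv_ft_Suc(1)[OF Suc.prems]
    using Suc tail_nonneg by (intro integral_nonneg_Reals nonneg_Reals_mult_I) auto
qed

text \<open>The exponential series of the Poisson factor is inverted term by term, all partial sums
  being dominated by \<open>norm (\<phi>R R z) * exp (c R)\<close>.\<close>

lemma conv_ft_sums:
  assumes R: "1 \<le> R"
  shows "(\<lambda>n. conv_ft R n x / fact n) sums (of_real (exp (c R)) * finv \<phi> x)"
proof -
  have [measurable]: "tail_ft R \<in> borel_measurable borel" "\<phi>R R \<in> borel_measurable borel"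
    using tail_ft_meas[OF R] borel_measurable_integrable[OF \<phi>R_props(1)[OF R]] by auto
  let ?S = "\<lambda>N z. \<phi>R R z * (\<Sum>n<N. tail_ft R z ^ n /\<^sub>R fact n)"
  have lim: "(\<lambda>N. finv (?S N) x) \<longlonglongrightarrow> finv (\<lambda>z. \<phi>R R z * exp (tail_ft R z)) x"
  proof (rule finv_tendsto)
    show "integrable lborel (\<lambda>z. norm (\<phi>R R z) * exp (c R))" using \<phi>R_props(1)[OF R] by simp
    show "norm (?S N z) \<le> norm (\<phi>R R z) * exp (c R)" for N z
    proof -
      have "norm (\<Sum>n<N. tail_ft R z ^ n /\<^sub>R fact n) \<le> (\<Sum>n<N. c R ^ n /\<^sub>R fact n)"
      proof (rule order_trans[OF norm_sum], rule sum_mono)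
        fix n
        have "norm (tail_ft R z) ^ n \<le> c R ^ n" using norm_tail_ft_le[OF R] by (intro power_mono) auto
        then show "norm (tail_ft R z ^ n /\<^sub>R fact n) \<le> c R ^ n /\<^sub>R fact n"
          by (simp add: norm_power divide_right_mono)
      qed
      also have "\<dots> \<le> exp (c R)"
        by (rule sum_le_sums[OF exp_converges]) (use c_nonneg in auto)
      finally show ?thesis unfolding norm_mult by (intro mult_left_mono) auto
    qed
    show "(\<lambda>N. ?S N z) \<longlonglongrightarrow> \<phi>R R z * exp (tail_ft R z)" for z
      using exp_converges[of "tail_ft R z"] by (intro tendsto_mult_left) (simp add: sums_def)
  qed measurable
  have part: "finv (?S N) x = (\<Sum>n<N. conv_ft R n x / fact n)" and "integrable lborel (?S N)" for N
  proof (induction N)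
    case 0
    case 1 show ?case by (simp add: finv_def)
    case 2 show ?case by simp
  next
    case (Suc N)
    have eq: "?S (Suc N) = (\<lambda>z. ?S N z + of_real (1 / fact N) * (\<phi>R R z * tail_ft R z ^ N))"
      by (simp add: fun_eq_iff distrib_left scaleR_conv_of_real mult_ac divide_inverse)
    have i: "integrable lborel (\<lambda>z. of_real (1 / fact N) * (\<phi>R R z * tail_ft R z ^ N))"
      by (intro integrable_mult_right conv_ft_int R)
    case 1 show ?case
      unfolding eq finv_add[OF Suc(2) i] finv_scale Suc(1) by (simp add: conv_ft_def)
    case 2 show ?case unfolding eq by (intro Bochner_Integration.integrable_add Suc(2) i)
  qed
  have "(\<lambda>z. \<phi>R R z * exp (tail_ft R z)) = (\<lambda>z. of_real (exp (c R)) * \<phi> z)"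
    unfolding \<phi>_split[OF R] exp_of_real[symmetric]
    by (simp add: fun_eq_iff mult.left_commute exp_add[symmetric])
  then have "finv (\<lambda>z. \<phi>R R z * exp (tail_ft R z)) x = of_real (exp (c R)) * finv \<phi> x"
    by (simp add: finv_scale)
  with lim show ?thesis unfolding sums_def part by simp
qed

text \<open>Positivity is inherited from the terms of the Poisson series at cutoff 1, which makes
  the inversion theorem applicable to \<open>\<phi>\<close> itself.\<close>

lemma finv_\<phi>_nonneg: "finv \<phi> x \<in> \<real>\<^sub>\<ge>\<^sub>0"
proof -
  have s: "(\<lambda>N. \<Sum>n<N. conv_ft 1 n x / fact n) \<longlonglongrightarrow> of_real (exp (c 1)) * finv \<phi> x"
    using conv_ft_sums[of 1 x] by (simp add: sums_def)
  have "(\<Sum>n<N. conv_ft 1 n x / fact n) \<in> \<real>\<^sub>\<ge>\<^sub>0" for N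
  proof (induction N)
    case (Suc N)
    have "(fact N :: complex) = of_nat (fact N)" by simp
    then have "(fact N :: complex) \<in> \<real>\<^sub>\<ge>\<^sub>0" by (metis nonneg_Reals_of_nat_I)
    then show ?case unfolding sum.lessThan_Suc
      by (intro nonneg_Reals_add_I Suc nonneg_Reals_divide_I conv_ft_nonneg order_refl)
  qed simp
  then have "of_real (exp (c 1)) * finv \<phi> x \<in> \<real>\<^sub>\<ge>\<^sub>0"
    by (intro Lim_in_closed_set[OF closed_nonneg_Reals_complex _ _ s]) auto
  then show ?thesis by (simp add: complex_nonneg_Reals_iff zero_le_mult_iff)
qed

section \<open>Densities obtained by inversion, and the instance of the abstract comparison\<close>

definition f :: "real \<Rightarrow> real" where "f x = Re (finv \<phi> x) / (2 * pi)"

text \<open>Cutoffs below 1 play no role; \<open>max 1 R\<close> only makes \<open>T R n\<close> measurable for every \<open>R\<close>.\<close>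

definition T :: "real \<Rightarrow> nat \<Rightarrow> real \<Rightarrow> real" where "T R n x = Re (conv_ft (max 1 R) n x) / (2 * pi)"

lemma \<phi>_zero: "\<phi> 0 = 1" unfolding \<phi> by (simp add: kern_def zero_complex.code[symmetric])

lemma \<phi>R_zero: "1 \<le> R \<Longrightarrow> \<phi>R R 0 = 1"
  unfolding \<phi>R_def trunc_def levy_exp_def by (simp add: kern_def zero_complex.code[symmetric])

lemma f_char:
  shows "integrable lborel f" "(LINT x|lborel. f x) = 1"
    and "real_distribution (density lborel (\<lambda>x. ennreal (f x)))"
    and "char (density lborel (\<lambda>x. ennreal (f x))) = \<phi>"
  unfolding f_def
  using finv_char[OF \<phi>_int \<phi>_cont order_trans[OF norm_\<phi>_le \<phi>R_props(3)[OF order_refl]] \<phi>_zero finv_\<phi>_nonneg]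
  by auto

lemma f_nonneg: "0 \<le> f x"
  using finv_\<phi>_nonneg[of x] by (simp add: f_def complex_nonneg_Reals_iff)

lemma f_cont: "continuous_on UNIV f"
  unfolding f_def by (intro continuous_intros continuous_finv \<phi>_int) simp

lemma f_bounded: "f x \<le> (LINT z|lborel. norm (\<phi> z)) / (2 * pi)"
  unfolding f_def using norm_finv_le[of \<phi> x] complex_Re_le_cmod[of "finv \<phi> x"]
  by (intro divide_right_mono) auto

lemma T_light: "1 \<le> R \<Longrightarrow> \<exists>Cp Bp. light_density (T R 0) Cp Bp"
proof -
  assume R: "1 \<le> R"
  then have T0: "T R 0 x = Re (finv (\<phi>R R) x) / (2 * pi)" for x
    by (simp add: T_def conv_ft_def max_absorb2)
  note fc = finv_char[OF \<phi>R_props(1,2)[OF R] \<phi>R_props(3)[OF R] \<phi>R_zero[OF R] \<phi>R_props(4)[OF R], folded T0]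
  have "light_density (T R 0) ((LINT z|lborel. norm (trunc {..R} (Complex 1 z))) / (2 * pi)) ((LINT z|lborel. norm (\<phi>R R z)) / (2 * pi))"
  proof
    show "T R 0 \<in> borel_measurable borel" using borel_measurable_integrable[OF fc(1)] by simp
    show "0 \<le> T R 0 x" for x using \<phi>R_props(4)[OF R, of x] by (simp add: T0 complex_nonneg_Reals_iff)
    show "T R 0 x \<le> (LINT z|lborel. norm (\<phi>R R z)) / (2 * pi)" for x
      unfolding T0 using norm_finv_le[of "\<phi>R R" x] complex_Re_le_cmod[of "finv (\<phi>R R) x"]
      by (intro divide_right_mono) auto
    show "integrable lborel (T R 0)" "(LINT x|lborel. T R 0 x) = 1" using fc(1,2) by auto
    show "T R 0 x \<le> (LINT z|lborel. norm (trunc {..R} (Complex 1 z))) / (2 * pi) * exp (- x)" for x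
    proof -
      have "Re (finv (\<phi>R R) x) \<le> (LINT z|lborel. norm (trunc {..R} (Complex 1 z))) * exp (- x)"
        using \<phi>R_props(5)[OF R, of x] complex_Re_le_cmod[of "finv (\<phi>R R) x"] by linarith
      from divide_right_mono[OF this, of "2 * pi"] show ?thesis unfolding T0 by simp
    qed
  qed
  then show ?thesis by blast
qed

text \<open>The comparison is run with the unnormalised density \<open>tail 1\<close> of the jumps
  above 1; for \<open>R \<ge> 1\<close>, restricting it to jumps above \<open>R\<close> gives back
  \<open>tail R\<close>.\<close>

lemma jump_split_tail:
  assumes "\<And>y. tail 1 y \<le> B"
  shows "jump_split f (tail 1) ((LINT z|lborel. norm (\<phi> z)) / (2 * pi)) B T"
proof
  have tailR: "indicator {R<..} y * tail 1 y = tail R y" if "1 \<le> R" for R y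
    using that by (auto simp: tail_def indicator_def)
  show "f \<in> borel_measurable borel" by (rule borel_measurable_continuous_onI[OF f_cont])
  show "tail 1 \<in> borel_measurable borel" "integrable lborel (tail 1)" using tail_int[of 1] by auto
  show "T R n \<in> borel_measurable borel" for R n
  proof -
    have "continuous_on UNIV (T R n)"
      unfolding T_def conv_ft_def by (intro continuous_intros continuous_finv conv_ft_int) auto
    then show ?thesis by (rule borel_measurable_continuous_onI)
  qed
  show "T R (Suc n) x = density_conv (T R n) (\<lambda>y. indicator {R<..} y * tail 1 y) x" if R: "1 \<le> R" for R n x
  proof -
    have m: "max 1 R = R" using R by simp
    have "Re (conv_ft R (Suc n) x) = (LINT y|lborel. Re (of_real (tail R y) * conv_ft R n (x - y)))"
      unfolding conv_ft_Suc(1)[OF R] by (rule integral_Re[symmetric, OF conv_ft_Suc(2)[OF R]])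
    then show ?thesis
      unfolding T_def m density_conv_def tailR[OF R] by (simp add: mult.commute)
  qed
  show "(\<lambda>n. T R n x / fact n) sums (exp (LINT y|lborel. indicator {R<..} y * tail 1 y) * f x)" if R: "1 \<le> R" for R x
  proof -
    have m: "max 1 R = R" using R by simp
    have "(\<lambda>n. Re (conv_ft R n x / fact n)) sums Re (of_real (exp (c R)) * finv \<phi> x)"
      by (rule sums_Re[OF conv_ft_sums[OF R]])
    moreover have "Re (conv_ft R n x / fact n) = Re (conv_ft R n x) / fact n" for n
    proof -
      have "conv_ft R n x / fact n = conv_ft R n x / of_real (fact n)" by simp
      then show ?thesis by (simp only: Re_divide_of_real)
    qed
    ultimately have "(\<lambda>n. Re (conv_ft R n x) / fact n) sums (exp (c R) * Re (finv \<phi> x))" by simp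
    from sums_divide[OF this, of "2 * pi"] show ?thesis
      unfolding T_def m f_def tailR[OF R] c_def by (simp add: mult_ac)
  qed
qed (use f_nonneg f_bounded f_char(1,2) tail_nonneg assms T_light in auto)

end

section \<open>Almost decreasing and asymptotically non-increasing functions\<close>

text \<open>The definition gives the quotient limit for positive shifts; negative ones follow by
  reciprocals at the shifted point. The strict inequalities in \<open>almost_decreasing\<close>
  account for \<open>xa + 1\<close>, the admission of shift 0 for \<open>max Ka 1\<close>.\<close>

lemma long_tailed_adI:
  assumes lt: "long_tailed h" and ad: "almost_decreasing h" and B: "\<And>x. h x \<le> B"
  shows "\<exists>x0 K. long_tailed_ad h x0 K B"
proof -
  have pd: "probability_density h" using lt by (simp add: long_tailed_def)
  have [measurable]: "h \<in> borel_measurable borel" and h0: "\<And>x. 0 \<le> h x"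
    using pd by (auto simp: probability_density_def)
  obtain x1 where x1: "x1 > 0" "\<And>x. x1 \<le> x \<Longrightarrow> 0 < h x"
    using lt by (auto simp: long_tailed_def)
  obtain xa Ka where xa: "xa > 0" "Ka > 0" "\<And>x y. xa < x \<Longrightarrow> 0 < y \<Longrightarrow> h (x + y) \<le> Ka * h x"
    using ad by (auto simp: almost_decreasing_def)
  have ev: "\<forall>\<^sub>F x in at_top. 0 < h x"
    using eventually_ge_at_top[of x1] by (rule eventually_mono) (rule x1)
  have up: "((\<lambda>x. h (x + y) / h x) \<longlongrightarrow> 1) at_top" if "0 < y" for y
  proof (rule asymp_equivD_strong)
    show "(\<lambda>x. h (x + y)) \<sim>[at_top] h" using lt that by (simp add: long_tailed_def)
    show "\<forall>\<^sub>F x in at_top. h (x + y) \<noteq> 0 \<or> h x \<noteq> 0" using ev by eventually_elim simp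
  qed
  have "long_tailed_ad h (max x1 (xa + 1)) (max Ka 1) B"
  proof
    show "h (x + y) \<le> max Ka 1 * h x" if "max x1 (xa + 1) \<le> x" "0 \<le> y" for x y
    proof (cases "y = 0")
      case True
      then show ?thesis using mult_right_mono[of 1 "max Ka 1" "h x"] h0[of x] by simp
    next
      case False
      then have "h (x + y) \<le> Ka * h x" using that by (intro xa) auto
      also have "\<dots> \<le> max Ka 1 * h x" using h0 by (intro mult_right_mono) auto
      finally show ?thesis .
    qed
    show "((\<lambda>x. h (x + y) / h x) \<longlongrightarrow> 1) at_top" for y
    proof -
      consider "0 < y" | "y = 0" | "y < 0" by linarith
      then show ?thesis
      proof cases
        case 1 then show ?thesis by (rule up)
      next
        case 2
        have "\<forall>\<^sub>F x in at_top. h (x + y) / h x = 1" using ev by eventually_elim (simp add: 2)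
        then show ?thesis by (rule tendsto_eventually)
      next
        case 3
        have sh: "filterlim (\<lambda>x::real. x + y) at_top at_top" by real_asymp
        have "((\<lambda>x. 1 / (h (x + y + - y) / h (x + y))) \<longlongrightarrow> 1 / 1) at_top"
          by (intro tendsto_divide tendsto_const filterlim_compose[OF up[of "- y"] sh]) (use 3 in auto)
        then show ?thesis by simp
      qed
    qed
  qed (use x1 h0 B probability_density_integral[OF pd] in auto)
  then show ?thesis by blast
qed

lemma asymptotic_to_nonincreasing_upper:
  assumes "asymptotic_to_nonincreasing h" "0 < e"
  shows "\<forall>\<^sub>F x in at_top. \<forall>t\<ge>x. h t \<le> (1 + e) * h x"
proof -
  obtain x0 where x0: "\<And>x. x0 \<le> x \<Longrightarrow> 0 < h x" "\<And>x. x0 \<le> x \<Longrightarrow> bdd_above (h ` {x..})"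
    and sup: "(\<lambda>x. SUP t\<in>{x..}. h t) \<sim>[at_top] h"
    using assms(1) unfolding asymptotic_to_nonincreasing_def by blast
  have ev: "\<forall>\<^sub>F x in at_top. x0 \<le> x \<and> 0 < h x"
    using eventually_ge_at_top[of x0] by (rule eventually_mono) (use x0 in auto)
  have "((\<lambda>x. (SUP t\<in>{x..}. h t) / h x) \<longlongrightarrow> 1) at_top"
    by (rule asymp_equivD_strong[OF sup]) (use ev in \<open>auto elim: eventually_mono\<close>)
  then have "\<forall>\<^sub>F x in at_top. (SUP t\<in>{x..}. h t) / h x < 1 + e"
    by (rule order_tendstoD(2)) (use assms in simp)
  then show ?thesis
    using ev
  proof eventually_elim
    case (elim x)
    show ?case
    proof (intro allI impI)
      fix t assume "x \<le> t"
      then have "h t \<le> (SUP t\<in>{x..}. h t)" using x0(2) elim by (intro cSUP_upper) auto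
      also have "\<dots> \<le> (1 + e) * h x" using elim by (simp add: divide_less_eq)
      finally show "h t \<le> (1 + e) * h x" .
    qed
  qed
qed

text \<open>The left end \<open>a\<close> is independent of \<open>e\<close>: it is the fixed
  starting point of the infimum in the definition, so one range serves all accuracies.\<close>

lemma asymptotic_to_nonincreasing_lower:
  assumes "asymptotic_to_nonincreasing h"
  shows "\<exists>a. \<forall>e>0. \<forall>\<^sub>F x in at_top. \<forall>t\<in>{a..x}. (1 - e) * h x \<le> h t"
proof -
  obtain x0 where x0: "\<And>x. x0 \<le> x \<Longrightarrow> 0 < h x"
    and inf: "(\<lambda>x. INF t\<in>{x0..x}. h t) \<sim>[at_top] h"
    using assms(1) unfolding asymptotic_to_nonincreasing_def by blast
  have ev: "\<forall>\<^sub>F x in at_top. x0 \<le> x \<and> 0 < h x"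
    using eventually_ge_at_top[of x0] by (rule eventually_mono) (use x0 in auto)
  have lim: "((\<lambda>x. (INF t\<in>{x0..x}. h t) / h x) \<longlongrightarrow> 1) at_top"
    by (rule asymp_equivD_strong[OF inf]) (use ev in \<open>auto elim: eventually_mono\<close>)
  have "\<forall>\<^sub>F x in at_top. \<forall>t\<in>{x0..x}. (1 - e) * h x \<le> h t" if e: "0 < e" for e
  proof -
    have "\<forall>\<^sub>F x in at_top. 1 - e < (INF t\<in>{x0..x}. h t) / h x"
      using lim by (rule order_tendstoD(1)) (use e in simp)
    then show ?thesis
      using ev
    proof eventually_elim
      case (elim x)
      show ?case
      proof
        fix t assume t: "t \<in> {x0..x}"
        have bdd: "bdd_below (h ` {x0..x})"
          using x0 by (intro bdd_belowI[of _ 0]) (auto intro: less_imp_le)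
        have "(1 - e) * h x \<le> (INF t\<in>{x0..x}. h t)" using elim by (simp add: less_divide_eq)
        also have "\<dots> \<le> h t" using bdd t by (rule cINF_lower)
        finally show "(1 - e) * h x \<le> h t" .
      qed
    qed
  qed
  then show ?thesis by blast
qed

lemma asymptotic_to_nonincreasing_imp_almost_decreasing:
  assumes "asymptotic_to_nonincreasing h"
  shows "almost_decreasing h"
proof -
  obtain a where a: "\<And>x t. a \<le> x \<Longrightarrow> x \<le> t \<Longrightarrow> h t \<le> (1 + 1) * h x"
    using asymptotic_to_nonincreasing_upper[OF assms zero_less_one]
    unfolding eventually_at_top_linorder by blast
  show ?thesis
    unfolding almost_decreasing_def
    by (rule exI[of _ "max a 1"], rule conjI, simp, rule exI[of _ 2]) (use a in auto)
qed

section \<open>From the hypotheses on the measures to the comparison of densities\<close>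

lemma integrable_levy:
  assumes [measurable]: "g \<in> borel_measurable borel" and g0: "\<And>x. 0 \<le> g x"
    and "levy_measure (density lborel (\<lambda>x. ennreal (g x)))"
  shows "integrable lborel (\<lambda>y. min 1 (y\<^sup>2) * g y)"
proof (rule integrableI_nonneg)
  have "(\<integral>\<^sup>+ x. ennreal (min 1 (x\<^sup>2)) \<partial>density lborel (\<lambda>x. ennreal (g x)))
      = (\<integral>\<^sup>+ x. ennreal (g x) * ennreal (min 1 (x\<^sup>2)) \<partial>lborel)"
    by (rule nn_integral_density) auto
  also have "\<dots> = (\<integral>\<^sup>+ x. ennreal (min 1 (x\<^sup>2) * g x) \<partial>lborel)"
    by (intro nn_integral_cong) (simp add: ennreal_mult g0 mult.commute)
  finally show "(\<integral>\<^sup>+ x. ennreal (min 1 (x\<^sup>2) * g x) \<partial>lborel) < \<infinity>"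
    using assms(3) by (simp add: levy_measure_def)
qed (use g0 in auto)

theorem theorem3p5:
  fixes \<mu> \<mu>\<^sub>p \<nu> :: "real measure" and g g\<^sub>1 :: "real \<Rightarrow> real"
  assumes g_measurable: "g \<in> borel_measurable borel"
    and g_nonneg: "\<And>x. g x \<ge> 0"
    and \<nu>_eq: "\<nu> = density lborel (\<lambda>x. ennreal (g x))"
    and \<mu>: "infinitely_divisible_with_levy_measure \<mu> \<nu>"
    and \<nu>_pos: "measure \<nu> {1<..} > 0"
    and g\<^sub>1_eq: "g\<^sub>1 = (\<lambda>x. indicator {1<..} x * g x / measure \<nu> {1<..})"
    and g\<^sub>1_bounded: "bounded (range g\<^sub>1)"
    and \<mu>\<^sub>p: "infinitely_divisible \<mu>\<^sub>p"
    and char_\<mu>\<^sub>p: "\<And>z. char \<mu>\<^sub>p z =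
       exp (CLINT x:{0..}|\<nu>. iexp (z * x) - 1 - \<i> * of_real z * of_real x * indicator {0<..1} x)"
    and char_\<mu>\<^sub>p_integrable: "integrable lborel (\<lambda>z. cmod (char \<mu>\<^sub>p z))"
  shows "integrable lborel (\<lambda>z. cmod (char \<mu> z)) \<and>
    (\<exists>f. bounded_continuous_density \<mu> f) \<and>
    (asymptotic_to_nonincreasing g \<longrightarrow>
      (\<exists>f. bounded_continuous_density \<mu> f \<and>
        ((weakly_subexponential f \<and> almost_decreasing f) \<longleftrightarrow> weakly_subexponential g\<^sub>1) \<and>
        (weakly_subexponential g\<^sub>1 \<longleftrightarrow>
          long_tailed g\<^sub>1 \<and> ((\<lambda>x. f x / g\<^sub>1 x) \<longlongrightarrow> measure \<nu> {1<..}) at_top))) \<and>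
    (almost_decreasing g \<longrightarrow>
      (\<exists>f. bounded_continuous_density \<mu> f \<and>
        (weakly_subexponential g\<^sub>1 \<longleftrightarrow>
          long_tailed g\<^sub>1 \<and> ((\<lambda>x. f x / g\<^sub>1 x) \<longlongrightarrow> measure \<nu> {1<..}) at_top) \<and>
        (weakly_subexponential g\<^sub>1 \<longrightarrow>
          weakly_subexponential f \<and> almost_decreasing f)))"
proof -
  note [measurable] = g_measurable
  have \<mu>_id: "infinitely_divisible \<mu>" and levy: "levy_measure \<nu>"
    using \<mu> by (auto simp: infinitely_divisible_with_levy_measure_def)
  obtain a b where ab: "\<And>z. char \<mu> z = exp (levy_khintchine_exponent \<nu> a b z)"
    using \<mu> by (auto simp: infinitely_divisible_with_levy_measure_def)
  interpret \<mu>: real_distribution \<mu> using \<mu>_id by (simp add: infinitely_divisible_def)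
  have g_levy: "integrable lborel (\<lambda>y. min 1 (y\<^sup>2) * g y)"
    using levy unfolding \<nu>_eq by (intro integrable_levy g_measurable g_nonneg)
  have exp0: "exp (Complex 0 z * complex_of_real y) = iexp (z * y)" for z y
    unfolding exp_Complex_mult by simp
  have Complex0: "Complex 0 z = \<i> * of_real z" for z by (simp add: Complex_eq)
  interpret L: levy_density g a b "char \<mu>"
  proof
    show "char \<mu> z = exp ((CLINT y|lborel. of_real (g y) * kern (Complex 0 z) y)
        + of_real a * Complex 0 z + of_real (b\<^sup>2 / 2) * (Complex 0 z)\<^sup>2)" for z
    proof -
      have k: "iexp (z * y) - 1 - \<i> * of_real z * of_real y * indicator {y. \<bar>y\<bar> \<le> 1} y = kern (Complex 0 z) y" for y
        unfolding kern_def exp0 unfolding Complex0 by (auto simp: indicator_def abs_le_iff)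
      have "(CLINT y|\<nu>. iexp (z * y) - 1 - \<i> * of_real z * of_real y * indicator {y. \<bar>y\<bar> \<le> 1} y)
          = (CLINT y|lborel. of_real (g y) * kern (Complex 0 z) y)"
        unfolding k \<nu>_eq by (subst integral_density) (auto simp: scaleR_conv_of_real g_nonneg)
      then show ?thesis
        unfolding ab levy_khintchine_exponent_def Complex0
        by (intro arg_cong[where f=exp]) (simp add: power_mult_distrib)
    qed
    show "continuous_on UNIV (char \<mu>)"
      by (intro continuous_at_imp_continuous_on ballI \<mu>.isCont_char)
    have "cmod (char \<mu>\<^sub>p z) = exp (LINT y|lborel. indicator {0..} y * (g y * (cos (z * y) - 1)))" for z
    proof -
      have i: "integrable lborel (\<lambda>y. of_real (indicator {0..} y * g y) * kern (Complex 0 z) y)"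
        by (rule integrable_kern_0) (use g_nonneg g_levy in auto)
      \<comment> \<open>On the half line the compensation sets \<open>{0<..1}\<close> and
        \<open>{-1..1}\<close> differ only at 0, where the compensating term vanishes.\<close>
      have k: "g y *\<^sub>R (indicator {0..} y *\<^sub>R (iexp (z * y) - 1 - \<i> * of_real z * of_real y * indicator {0<..1} y))
          = of_real (indicator {0..} y * g y) * kern (Complex 0 z) y" for y
        unfolding kern_def exp0 unfolding Complex0 by (auto simp: indicator_def scaleR_conv_of_real)
      have "(CLINT x:{0..}|\<nu>. iexp (z * x) - 1 - \<i> * of_real z * of_real x * indicator {0<..1} x)
          = (CLINT y|lborel. g y *\<^sub>R (indicator {0..} y *\<^sub>R (iexp (z * y) - 1 - \<i> * of_real z * of_real y * indicator {0<..1} y)))"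
        unfolding set_lebesgue_integral_def \<nu>_eq by (subst integral_density) (auto simp: g_nonneg)
      also have "\<dots> = (CLINT y|lborel. of_real (indicator {0..} y * g y) * kern (Complex 0 z) y)"
        unfolding k ..
      also have "Re \<dots> = (LINT y|lborel. Re (of_real (indicator {0..} y * g y) * kern (Complex 0 z) y))"
        by (rule integral_Re[symmetric, OF i])
      also have "\<dots> = (LINT y|lborel. indicator {0..} y * (g y * (cos (z * y) - 1)))"
        by (simp add: Re_kern mult.assoc)
      finally show ?thesis unfolding char_\<mu>\<^sub>p norm_exp_eq_Re by simp
    qed
    then show "integrable lborel (\<lambda>z. exp (LINT y|lborel. indicator {0..} y * (g y * (cos (z * y) - 1))))"
      using char_\<mu>\<^sub>p_integrable by simp
  qed (use g_nonneg g_levy in auto)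
  define f where "f = L.f"
  \<comment> \<open>This is \<open>C * g\<^sub>1\<close>. For the unnormalised density the limit in
    (iii) becomes 1, and tightness is insensitive to the constant.\<close>
  define k where "k = L.tail 1"
  define Bf where "Bf = (LINT z|lborel. norm (char \<mu> z)) / (2 * pi)"
  define C where "C = measure \<nu> {1<..}"
  have C: "0 < C" using \<nu>_pos by (simp add: C_def)
  have k_meas [measurable]: "k \<in> borel_measurable borel" and k_int: "integrable lborel k" and k0: "0 \<le> k y" for y
    unfolding k_def using L.tail_int[of 1] L.tail_nonneg by auto
  have C_eq: "C = (LINT y|lborel. k y)"
  proof -
    have "emeasure \<nu> {1<..} = (\<integral>\<^sup>+ y. ennreal (k y) \<partial>lborel)"
      unfolding \<nu>_eq k_def L.tail_def
      by (subst emeasure_density) (auto intro!: nn_integral_cong simp: indicator_def)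
    also have "\<dots> = ennreal (LINT y|lborel. k y)"
      using k_int k0 by (intro nn_integral_eq_integral) auto
    finally show ?thesis unfolding C_def measure_def using k0 by (simp add: integral_nonneg_AE)
  qed
  have g1: "g\<^sub>1 = (\<lambda>x. k x / C)" unfolding g\<^sub>1_eq k_def L.tail_def C_def ..
  have g1_meas [measurable]: "g\<^sub>1 \<in> borel_measurable borel" and g1_int: "integrable lborel g\<^sub>1"
    and g1_0: "0 \<le> g\<^sub>1 x" for x
    unfolding g1 using k_int k0 C by auto
  obtain B where B: "\<And>x. g\<^sub>1 x \<le> B"
    using g\<^sub>1_bounded unfolding bounded_iff by (force simp: abs_le_iff)
  have kB: "k x \<le> B * C" for x using B[of x] C by (simp add: g1 divide_le_eq)
  interpret J: jump_split f k Bf "B * C" L.T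
    unfolding f_def k_def Bf_def by (rule L.jump_split_tail) (use kB in \<open>simp add: k_def\<close>)
  have f_pd: "probability_density f"
    unfolding probability_density_def
    using J.f_nonneg nn_integral_eq_integral[OF J.f_int] J.f_one by simp
  have g1_pd: "probability_density g\<^sub>1"
    unfolding probability_density_def
    using g1_0 nn_integral_eq_integral[OF g1_int] C by (simp add: g1 C_eq[symmetric])
  \<comment> \<open>The inverted function has the characteristic function of \<open>\<mu>\<close>;
    this one continuous density serves both (a) and (b).\<close>
  have \<mu>_f: "\<mu> = density lborel (\<lambda>x. ennreal (f x))"
    unfolding f_def using L.f_char(3,4) by (intro Levy_uniqueness \<mu>.real_distribution_axioms) auto
  have bcd: "bounded_continuous_density \<mu> f"
    unfolding bounded_continuous_density_def has_density_def
  proof (intro conjI allI)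
    show "continuous_on UNIV f" unfolding f_def by (rule L.f_cont)
    show "bounded (range f)"
      using J.f_nonneg J.f_bounded by (intro boundedI[where B=Bf]) auto
  qed (use J.f_nonneg \<mu>_f in auto)
  have k_g1: "((\<lambda>x. k x / g\<^sub>1 x) \<longlongrightarrow> C) at_top" "((\<lambda>x. g\<^sub>1 x / k x) \<longlongrightarrow> 1 / C) at_top"
    if "\<forall>\<^sub>F x in at_top. 0 < k x"
  proof -
    have "\<forall>\<^sub>F x in at_top. k x / g\<^sub>1 x = C" using that by eventually_elim (use C in \<open>simp add: g1\<close>)
    then show "((\<lambda>x. k x / g\<^sub>1 x) \<longlongrightarrow> C) at_top" by (rule tendsto_eventually)
    have "\<forall>\<^sub>F x in at_top. g\<^sub>1 x / k x = 1 / C" using that by eventually_elim (use C in \<open>simp add: g1\<close>)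
    then show "((\<lambda>x. g\<^sub>1 x / k x) \<longlongrightarrow> 1 / C) at_top" by (rule tendsto_eventually)
  qed
  have ad_g1: "almost_decreasing g\<^sub>1" if ad: "almost_decreasing g"
  proof -
    obtain x0 K where x0: "0 < x0" "0 < K" "\<And>x y. x0 < x \<Longrightarrow> 0 < y \<Longrightarrow> g (x + y) \<le> K * g x"
      using ad by (auto simp: almost_decreasing_def)
    show ?thesis
      unfolding almost_decreasing_def
    proof (rule exI[of _ "max x0 1"], rule conjI, simp, rule exI[of _ K], intro conjI x0 allI impI)
      fix x y :: real assume xy: "max x0 1 < x" "0 < y"
      then have "g (x + y) / C \<le> K * g x / C" using x0 C by (intro divide_right_mono) auto
      then show "g\<^sub>1 (x + y) \<le> K * g\<^sub>1 x" using xy by (simp add: g1 k_def L.tail_def)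
    qed
  qed
  have tight_iff: "tight_conv g\<^sub>1 \<longleftrightarrow> tight_conv k" if "long_tailed_ad k x0 K B'" "long_tailed_ad g\<^sub>1 x0' K' B''" for x0 K B' x0' K' B''
  proof
    have k_eq: "k x = C * g\<^sub>1 x" "g\<^sub>1 x = 1 / C * k x" for x using C by (auto simp: g1)
    show "tight_conv k" if t: "tight_conv g\<^sub>1"
      by (rule long_tailed_ad.tight_conv_transfer[OF \<open>long_tailed_ad g\<^sub>1 x0' K' B''\<close> t k_meas k0, where C=C and C'="1 / C"])
        (use k_eq in auto)
    show "tight_conv g\<^sub>1" if t: "tight_conv k"
      by (rule long_tailed_ad.tight_conv_transfer[OF \<open>long_tailed_ad k x0 K B'\<close> t g1_meas g1_0, where C="1 / C" and C'=C])
        (use k_eq in auto)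
  qed
  \<comment> \<open>Both (ii) and (iii) contain long-tailedness of \<open>g\<^sub>1\<close>, so
    almost decrease of \<open>g\<close> puts \<open>g\<^sub>1\<close> and \<open>k\<close> into the
    common setting.\<close>
  have LA: "\<exists>x0 K x0' K'. long_tailed_ad g\<^sub>1 x0 K B \<and> long_tailed_ad k x0' K' (B * C)"
    if lt: "long_tailed g\<^sub>1" and ad: "almost_decreasing g"
  proof -
    obtain x0 K where g1_la: "long_tailed_ad g\<^sub>1 x0 K B"
      using long_tailed_adI[OF lt ad_g1[OF ad] B] by blast
    have "\<forall>\<^sub>F x in at_top. 0 < k x"
      using long_tailed_ad.ev_pos[OF g1_la] by eventually_elim (use C in \<open>simp add: g1 zero_less_divide_iff\<close>)
    from long_tailed_ad_transfer[OF g1_la k_meas k0 kB k_int k_g1(1)[OF this] C]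
    show ?thesis using g1_la by blast
  qed
  have ratio: "((\<lambda>x. f x / k x) \<longlongrightarrow> 1) at_top \<longleftrightarrow> ((\<lambda>x. f x / g\<^sub>1 x) \<longlongrightarrow> C) at_top"
  proof
    assume "((\<lambda>x. f x / k x) \<longlongrightarrow> 1) at_top"
    from tendsto_mult_left[OF this, of C] C show "((\<lambda>x. f x / g\<^sub>1 x) \<longlongrightarrow> C) at_top" by (simp add: g1 mult.commute)
  next
    assume "((\<lambda>x. f x / g\<^sub>1 x) \<longlongrightarrow> C) at_top"
    from tendsto_mult_left[OF this, of "1 / C"] C show "((\<lambda>x. f x / k x) \<longlongrightarrow> 1) at_top" by (simp add: g1)
  qed
  have two_three: "weakly_subexponential g\<^sub>1 \<longleftrightarrow> long_tailed g\<^sub>1 \<and> ((\<lambda>x. f x / g\<^sub>1 x) \<longlongrightarrow> C) at_top"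
    if ad: "almost_decreasing g"
  \<comment> \<open>If \<open>g\<^sub>1\<close> is not long-tailed, both sides fail by
    definition.\<close>
  proof (cases "long_tailed g\<^sub>1")
    case True
    from LA[OF True ad] obtain x0 K x0' K' where la: "long_tailed_ad g\<^sub>1 x0 K B" "long_tailed_ad k x0' K' (B * C)"
      by blast
    have "weakly_subexponential g\<^sub>1 \<longleftrightarrow> tight_conv k"
      using long_tailed_ad.weakly_subexponential_iff_tight[OF la(1) g1_pd] tight_iff[OF la(2,1)] by simp
    also have "\<dots> \<longleftrightarrow> ((\<lambda>x. f x / k x) \<longlongrightarrow> 1) at_top"
      using J.ratio_limit_of_tight[OF la(2)] J.tight_of_ratio_limit[OF la(2)] by blast
    finally show ?thesis using True ratio by simp
  next
    case False
    then show ?thesis by (simp add: weakly_subexponential_def)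
  qed
  have two_one: "weakly_subexponential f \<and> almost_decreasing f"
    if ad: "almost_decreasing g" and w: "weakly_subexponential g\<^sub>1"
  proof -
    have lt: "long_tailed g\<^sub>1" using w by (simp add: weakly_subexponential_def)
    from LA[OF lt ad] obtain x0 K x0' K' where la: "long_tailed_ad g\<^sub>1 x0 K B" "long_tailed_ad k x0' K' (B * C)"
      by blast
    interpret k: long_tailed_ad k x0' K' "B * C" by (rule la)
    have tight: "tight_conv k"
      using w long_tailed_ad.weakly_subexponential_iff_tight[OF la(1) g1_pd] tight_iff[OF la(2,1)] by simp
    have lim: "((\<lambda>x. f x / k x) \<longlongrightarrow> 1) at_top" by (rule J.ratio_limit_of_tight[OF la(2) tight])
    obtain x1 K1 where f_la: "long_tailed_ad f x1 K1 Bf"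
      using long_tailed_ad_transfer[OF la(2) J.f_meas J.f_nonneg J.f_bounded J.f_int lim] by auto
    have "\<forall>\<^sub>F x in at_top. f x / k x < 2" "\<forall>\<^sub>F x in at_top. 1 / 2 < f x / k x"
      by (rule order_tendstoD(2)[OF lim], simp, rule order_tendstoD(1)[OF lim], simp)
    then have "\<forall>\<^sub>F x in at_top. f x \<le> 2 * k x \<and> k x \<le> 2 * f x"
      using k.ev_pos by eventually_elim (auto simp: divide_less_eq less_divide_eq)
    then have "tight_conv f"
      by (intro k.tight_conv_transfer[OF tight J.f_meas J.f_nonneg, where C=2 and C'=2]) (auto elim: eventually_mono)
    then show ?thesis
      using long_tailed_ad.weakly_subexponential_iff_tight[OF f_la f_pd] long_tailed_ad.almost_decreasingI[OF f_la] by simp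
  qed
  have one_two: "weakly_subexponential g\<^sub>1"
    if ani: "asymptotic_to_nonincreasing g" and w: "weakly_subexponential f" and adf: "almost_decreasing f"
  proof -
    have ad: "almost_decreasing g" by (rule asymptotic_to_nonincreasing_imp_almost_decreasing[OF ani])
    have ltf: "long_tailed f" using w by (simp add: weakly_subexponential_def)
    obtain x0 K where f_la: "long_tailed_ad f x0 K Bf"
      using long_tailed_adI[OF ltf adf J.f_bounded] by blast
    interpret f: long_tailed_ad f x0 K Bf by (rule f_la)
    have tightf: "tight_conv f" using w f.weakly_subexponential_iff_tight[OF f_pd] by simp
    have k_eq: "k x = g x" if "1 < x" for x using that by (simp add: k_def L.tail_def)
    have sup: "\<forall>\<^sub>F x in at_top. \<forall>t\<ge>x. k t \<le> (1 + e) * k x" if "0 < e" for e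
      using asymptotic_to_nonincreasing_upper[OF ani that] eventually_gt_at_top[of 1]
      by eventually_elim (auto simp: k_eq)
    obtain a' where a': "\<And>e. 0 < e \<Longrightarrow> \<forall>\<^sub>F x in at_top. \<forall>t\<in>{a'..x}. (1 - e) * g x \<le> g t"
      using asymptotic_to_nonincreasing_lower[OF ani] by blast
    \<comment> \<open>\<open>k\<close> agrees with \<open>g\<close> only beyond 1, hence the range
      starting at \<open>max a' 2\<close>.\<close>
    have inf: "\<forall>\<^sub>F x in at_top. \<forall>t\<in>{max a' 2..x}. (1 - e) * k x \<le> k t" if "0 < e" for e
      using a'[OF that] by eventually_elim (auto simp: k_eq)
    have lim: "((\<lambda>x. k x / f x) \<longlongrightarrow> 1) at_top"
      by (rule J.ratio_limit_of_density_tight[OF f_la tightf sup inf])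
    \<comment> \<open>In this direction long-tailedness of the jump density is a conclusion: it is
      inherited from \<open>f\<close> through the limit 1 of \<open>k x / f x\<close>.\<close>
    obtain x1 K1 where k_la: "long_tailed_ad k x1 K1 (B * C)"
      using long_tailed_ad_transfer[OF f_la k_meas k0 kB k_int lim] by auto
    interpret k: long_tailed_ad k x1 K1 "B * C" by (rule k_la)
    have kpos: "\<forall>\<^sub>F x in at_top. 0 < k x" using k.ev_pos by eventually_elim simp
    obtain x2 K2 where g1_la: "long_tailed_ad g\<^sub>1 x2 K2 B"
      using long_tailed_ad_transfer[OF k_la g1_meas g1_0 B g1_int k_g1(2)[OF kpos]] C by auto
    have "\<forall>\<^sub>F x in at_top. k x / f x < 2" "\<forall>\<^sub>F x in at_top. 1 / 2 < k x / f x"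
      by (rule order_tendstoD(2)[OF lim], simp, rule order_tendstoD(1)[OF lim], simp)
    then have "\<forall>\<^sub>F x in at_top. k x \<le> 2 * f x \<and> f x \<le> 2 * k x"
      using f.ev_pos by eventually_elim (auto simp: divide_less_eq less_divide_eq)
    then have "tight_conv k"
      by (intro f.tight_conv_transfer[OF tightf k_meas k0, where C=2 and C'=2]) (auto elim: eventually_mono)
    then have "tight_conv g\<^sub>1" using tight_iff[OF k_la g1_la] by simp
    then show ?thesis using long_tailed_ad.weakly_subexponential_iff_tight[OF g1_la g1_pd] by simp
  qed
  have "integrable lborel (\<lambda>z. cmod (char \<mu> z))" using L.\<phi>_int by (rule integrable_norm)
  then show ?thesis
    unfolding C_def[symmetric]
    using bcd two_three two_one one_two asymptotic_to_nonincreasing_imp_almost_decreasing[of g] by blast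
qed

end
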